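(* Let $k$ be a field of characteristic zero, let $A$ and $B$ be finite dimensional unital associative $k$-algebras, let $\psi: B\otimes A\to A\otimes B$ be a factorisation, and let $S_\psi=A\otimes_\psi B$ be the corresponding factorisation algebra. Then \[ S_\psi^{\otimes_B(n)}\cong A^{\otimes(n)}\otimes B \] as $X$-$Y$-bimodules for all $X,Y\in\{S_\psi,B\}$ for $n\ge 1$, and as $B$-$B$-bimodules for $n\ge0$.
   Context: Unadorned tensor products are over $k$. Write $\psi(b\otimes a)=a_\alpha\otimes b^\alpha$ (summation understood). A factorisation is a linear map $\psi: B\otimes A\to A\otimes B$ with $\psi(1_B\otimes a)=a\otimes 1_B$, $\psi(b\otimes 1_A)=1_A\otimes b$ and $(ad_\alpha)_\beta\otimes b^\beta c^\alpha=a_\beta d_\alpha\otimes(b^\beta c)^\alpha$ for all $a,d\in A$, $b,c\in B$. The factorisation algebra $S_\psi=A\otimes_\psi B$ is the vector space $A\otimes B$ with the associative unital product $(a\otimes b)(c\otimes d)=a\,\psi(b\otimes c)\,d=ac_\alpha\otimes b^\alpha d$ and unit $1_A\otimes1_B$. $A$ and $B$ are subalgebras via $a\mapsto a\otimes 1_B$, $b\mapsto 1_A\otimes b$. $S_\psi^{\otimes_B(n)}=S_\psi\otimes_B\cdots\otimes_B S_\psi$ ($n$ factors), and $S_\psi^{\otimes_B(0)}=B$; for $n\geq 1$ it is an $S_\psi$-$S_\psi$-bimodule by left multiplication on the first and right multiplication on the last factor, and an $X$-$Y$-bimodule by restriction. The bimodule structure on $A^{\otimes(n)}\otimes B$ for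 $n\ge1$: let $\Psi_n: B\otimes A^{\otimes(n)}\to A^{\otimes(n)}\otimes B$ be obtained by applying $\psi$ successively to move the $B$-factor past all $n$ factors $A$. The left action of $a\otimes b\in S_\psi$ sends $a_1\otimes\cdots\otimes a_n\otimes c$ to the element obtained from $\Psi_n(b\otimes a_1\otimes\cdots\otimes a_n)\in A^{\otimes(n)}\otimes B$ by multiplying the first $A$-factor on the left by $a$ and the $B$-factor on the right by $c$. The right action is $(a_1\otimes\cdots\otimes a_n\otimes b)\cdot(c\otimes d)=a_1\otimes\cdots\otimes a_{n-1}\otimes a_nc_\alpha\otimes b^\alpha d$. For $n=0$, $A^{\otimes(0)}\otimes B=k\otimes B$ with $B$ acting on $B$ by left and right multiplication. *)

theory Defs
  imports "HOL-Algebra.AbelCoset" "HOL-Algebra.Module"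
begin

section \<open>Algebras over a field\<close>

text \<open>The locale \<open>algebra\<close> of the library requires commutativity, so the noncommutative notion is
  defined here. The zero algebra is allowed.\<close>

definition assoc_algebra :: "'k ring \<Rightarrow> ('k, 'a) module \<Rightarrow> bool" where
  "assoc_algebra K A \<longleftrightarrow> module K A \<and> ring A \<and>
     (\<forall>c\<in>carrier K. \<forall>x\<in>carrier A. \<forall>y\<in>carrier A.
        (c \<odot>\<^bsub>A\<^esub> x) \<otimes>\<^bsub>A\<^esub> y = c \<odot>\<^bsub>A\<^esub> (x \<otimes>\<^bsub>A\<^esub> y) \<and>
        x \<otimes>\<^bsub>A\<^esub> (c \<odot>\<^bsub>A\<^esub> y) = c \<odot>\<^bsub>A\<^esub> (x \<otimes>\<^bsub>A\<^esub> y))"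

definition char_zero :: "'k ring \<Rightarrow> bool" where
  "char_zero K \<longleftrightarrow> (\<forall>n::nat. 0 < n \<longrightarrow> [n] \<cdot>\<^bsub>K\<^esub> \<one>\<^bsub>K\<^esub> \<noteq> \<zero>\<^bsub>K\<^esub>)"

definition submodule_span :: "'k ring \<Rightarrow> ('k, 'm) module \<Rightarrow> 'm set \<Rightarrow> 'm set" where
  "submodule_span K M G = \<Inter>{H. submodule H K M \<and> G \<subseteq> H}"

definition finite_dim :: "'k ring \<Rightarrow> ('k, 'm) module \<Rightarrow> bool" where
  "finite_dim K M \<longleftrightarrow> (\<exists>G. finite G \<and> G \<subseteq> carrier M \<and> submodule_span K M G = carrier M)"

definition linear_maps :: "'k ring \<Rightarrow> ('k, 'm) module \<Rightarrow> ('k, 'n) module \<Rightarrow> ('m \<Rightarrow> 'n) set" where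
  "linear_maps K M N = {f \<in> carrier M \<rightarrow> carrier N.
     (\<forall>x\<in>carrier M. \<forall>y\<in>carrier M. f (x \<oplus>\<^bsub>M\<^esub> y) = f x \<oplus>\<^bsub>N\<^esub> f y) \<and>
     (\<forall>c\<in>carrier K. \<forall>x\<in>carrier M. f (c \<odot>\<^bsub>M\<^esub> x) = c \<odot>\<^bsub>N\<^esub> f x)}"


section \<open>Modules given by generators and relations\<close>

text \<open>In structures that are only modules, the ring fields \<open>mult\<close> and \<open>one\<close> of the record
  are irrelevant and left undefined.\<close>

definition free_module :: "'k ring \<Rightarrow> 'x set \<Rightarrow> ('k, 'x \<Rightarrow> 'k) module" where
  "free_module K X = \<lparr>
     carrier = {u. (\<forall>x. u x \<in> carrier K) \<and> (\<forall>x. x \<notin> X \<longrightarrow> u x = \<zero>\<^bsub>K\<^esub>) \<and> finite {x. u x \<noteq> \<zero>\<^bsub>K\<^esub>}},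
     mult = undefined, one = undefined,
     zero = (\<lambda>x. \<zero>\<^bsub>K\<^esub>),
     add = (\<lambda>u v x. u x \<oplus>\<^bsub>K\<^esub> v x),
     smult = (\<lambda>c u x. c \<otimes>\<^bsub>K\<^esub> u x)\<rparr>"

definition basis_vector :: "'k ring \<Rightarrow> 'x \<Rightarrow> 'x \<Rightarrow> 'k" where
  "basis_vector K x = (\<lambda>y. if y = x then \<one>\<^bsub>K\<^esub> else \<zero>\<^bsub>K\<^esub>)"

definition quotient_module :: "('k, 'm) module \<Rightarrow> 'm set \<Rightarrow> ('k, 'm set) module" where
  "quotient_module M H = \<lparr>
     carrier = A_RCOSETS M H,
     mult = undefined, one = undefined,
     zero = H,
     add = (\<lambda>C D. C <+>\<^bsub>M\<^esub> D),
     smult = (\<lambda>c C. \<Union>u\<in>C. H +>\<^bsub>M\<^esub> (c \<odot>\<^bsub>M\<^esub> u))\<rparr>"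

definition presented_module ::
    "'k ring \<Rightarrow> 'x set \<Rightarrow> ('x \<Rightarrow> 'k) set \<Rightarrow> ('k, ('x \<Rightarrow> 'k) set) module" where
  "presented_module K X R =
     quotient_module (free_module K X) (submodule_span K (free_module K X) R)"

definition generator :: "'k ring \<Rightarrow> 'x set \<Rightarrow> ('x \<Rightarrow> 'k) set \<Rightarrow> 'x \<Rightarrow> ('x \<Rightarrow> 'k) set" where
  "generator K X R x =
     submodule_span K (free_module K X) R +>\<^bsub>free_module K X\<^esub> basis_vector K x"

text \<open>The linear map into \<open>N\<close> that sends each generator \<open>x\<close> of a presented module to \<open>f x\<close>.
  It is evaluated on representatives, so it is meaningful whenever \<open>f\<close> respects the relations, as
  every \<open>f\<close> used below does. For tensor products, where the generators are tuples and the relations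
  are those of multilinearity, this renders Sweedler-like notation:
  with \<open>\<psi>(b \<otimes> a) = a\<^sub>\<alpha> \<otimes> b\<^sup>\<alpha>\<close>, the sum of \<open>f(a\<^sub>\<alpha>, b\<^sup>\<alpha>)\<close> is \<open>extend_linearly K N f (\<psi>(b \<otimes> a))\<close>.\<close>

definition extend_linearly ::
    "'k ring \<Rightarrow> ('k, 'n) module \<Rightarrow> ('x \<Rightarrow> 'n) \<Rightarrow> ('x \<Rightarrow> 'k) set \<Rightarrow> 'n" where
  "extend_linearly K N f C =
     the_elem ((\<lambda>u. \<Oplus>\<^bsub>N\<^esub>x\<in>{x. u x \<noteq> \<zero>\<^bsub>K\<^esub>}. u x \<odot>\<^bsub>N\<^esub> f x) ` C)"

text \<open>Linearity in one slot: \<open>g\<close> sends an element of \<open>M\<close> to the tuple with that element in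
  the slot and all other entries fixed.\<close>

definition slot_relations ::
    "'k ring \<Rightarrow> 'x set \<Rightarrow> ('k, 'm) module \<Rightarrow> ('m \<Rightarrow> 'x) \<Rightarrow> ('x \<Rightarrow> 'k) set" where
  "slot_relations K X M g =
     {basis_vector K (g (x \<oplus>\<^bsub>M\<^esub> y)) \<ominus>\<^bsub>free_module K X\<^esub>
        (basis_vector K (g x) \<oplus>\<^bsub>free_module K X\<^esub> basis_vector K (g y))
      | x y. x \<in> carrier M \<and> y \<in> carrier M} \<union>
     {basis_vector K (g (c \<odot>\<^bsub>M\<^esub> x)) \<ominus>\<^bsub>free_module K X\<^esub>
        (c \<odot>\<^bsub>free_module K X\<^esub> basis_vector K (g x))
      | c x. c \<in> carrier K \<and> x \<in> carrier M}"


section \<open>Tensor products over the ground field\<close>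

definition tensor_relations ::
    "'k ring \<Rightarrow> ('k, 'm) module \<Rightarrow> ('k, 'n) module \<Rightarrow> ('m \<times> 'n \<Rightarrow> 'k) set" where
  "tensor_relations K M N =
     (\<Union>n\<in>carrier N. slot_relations K (carrier M \<times> carrier N) M (\<lambda>m. (m, n))) \<union>
     (\<Union>m\<in>carrier M. slot_relations K (carrier M \<times> carrier N) N (\<lambda>n. (m, n)))"

definition tensor ::
    "'k ring \<Rightarrow> ('k, 'm) module \<Rightarrow> ('k, 'n) module \<Rightarrow> ('k, ('m \<times> 'n \<Rightarrow> 'k) set) module" where
  "tensor K M N = presented_module K (carrier M \<times> carrier N) (tensor_relations K M N)"

definition pure_tensor ::
    "'k ring \<Rightarrow> ('k, 'm) module \<Rightarrow> ('k, 'n) module \<Rightarrow> 'm \<Rightarrow> 'n \<Rightarrow> ('m \<times> 'n \<Rightarrow> 'k) set" where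
  "pure_tensor K M N m n = generator K (carrier M \<times> carrier N) (tensor_relations K M N) (m, n)"

definition tuples :: "('k, 'm) module \<Rightarrow> nat \<Rightarrow> 'm list set" where
  "tuples M n = {ms. length ms = n \<and> set ms \<subseteq> carrier M}"

text \<open>The \<open>(n+1)\<close>-fold tensor product \<open>A \<otimes> \<dots> \<otimes> A \<otimes> B\<close>, with generators
  \<open>a\<^sub>1 \<otimes> \<dots> \<otimes> a\<^sub>n \<otimes> b\<close>.\<close>

definition power_tensor_relations ::
    "'k ring \<Rightarrow> ('k, 'a) module \<Rightarrow> ('k, 'b) module \<Rightarrow> nat \<Rightarrow> ('a list \<times> 'b \<Rightarrow> 'k) set" where
  "power_tensor_relations K A B n =
     (\<Union>as\<in>tuples A n. \<Union>b\<in>carrier B. \<Union>i\<in>{..<n}.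
        slot_relations K (tuples A n \<times> carrier B) A (\<lambda>a. (as[i := a], b))) \<union>
     (\<Union>as\<in>tuples A n.
        slot_relations K (tuples A n \<times> carrier B) B (\<lambda>b. (as, b)))"

definition power_tensor ::
    "'k ring \<Rightarrow> ('k, 'a) module \<Rightarrow> ('k, 'b) module \<Rightarrow> nat \<Rightarrow> ('k, ('a list \<times> 'b \<Rightarrow> 'k) set) module" where
  "power_tensor K A B n =
     presented_module K (tuples A n \<times> carrier B) (power_tensor_relations K A B n)"

definition pure_power_tensor ::
    "'k ring \<Rightarrow> ('k, 'a) module \<Rightarrow> ('k, 'b) module \<Rightarrow> 'a list \<Rightarrow> 'b \<Rightarrow> ('a list \<times> 'b \<Rightarrow> 'k) set" where
  "pure_power_tensor K A B as b =
     generator K (tuples A (length as) \<times> carrier B) (power_tensor_relations K A B (length as)) (as, b)"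

definition ground_module :: "'k ring \<Rightarrow> ('k, 'k) module" where
  "ground_module K = \<lparr>carrier = carrier K, mult = mult K, one = one K, zero = zero K,
     add = add K, smult = mult K\<rparr>"


section \<open>Bimodules\<close>

record ('k, 'x, 'y, 'm) bimod =
  space :: "('k, 'm) module"
  lact :: "'x \<Rightarrow> 'm \<Rightarrow> 'm"
  ract :: "'m \<Rightarrow> 'y \<Rightarrow> 'm"

definition bimodule ::
    "'k ring \<Rightarrow> ('k, 'x) module \<Rightarrow> ('k, 'y) module \<Rightarrow> ('k, 'x, 'y, 'm) bimod \<Rightarrow> bool" where
  "bimodule K X Y P \<longleftrightarrow>
     assoc_algebra K X \<and> assoc_algebra K Y \<and> module K (space P) \<and>
     (\<forall>x\<in>carrier X. lact P x \<in> linear_maps K (space P) (space P)) \<and>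
     (\<forall>m\<in>carrier (space P). (\<lambda>x. lact P x m) \<in> linear_maps K X (space P)) \<and>
     (\<forall>m\<in>carrier (space P). lact P \<one>\<^bsub>X\<^esub> m = m) \<and>
     (\<forall>x\<in>carrier X. \<forall>x'\<in>carrier X. \<forall>m\<in>carrier (space P).
        lact P (x \<otimes>\<^bsub>X\<^esub> x') m = lact P x (lact P x' m)) \<and>
     (\<forall>y\<in>carrier Y. (\<lambda>m. ract P m y) \<in> linear_maps K (space P) (space P)) \<and>
     (\<forall>m\<in>carrier (space P). ract P m \<in> linear_maps K Y (space P)) \<and>
     (\<forall>m\<in>carrier (space P). ract P m \<one>\<^bsub>Y\<^esub> = m) \<and>
     (\<forall>y\<in>carrier Y. \<forall>y'\<in>carrier Y. \<forall>m\<in>carrier (space P).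
        ract P m (y \<otimes>\<^bsub>Y\<^esub> y') = ract P (ract P m y) y') \<and>
     (\<forall>x\<in>carrier X. \<forall>y\<in>carrier Y. \<forall>m\<in>carrier (space P).
        ract P (lact P x m) y = lact P x (ract P m y))"

definition isomorphic_bimodules ::
    "'k ring \<Rightarrow> ('k, 'x) module \<Rightarrow> ('k, 'y) module \<Rightarrow>
     ('k, 'x, 'y, 'm) bimod \<Rightarrow> ('k, 'x, 'y, 'n) bimod \<Rightarrow> bool" where
  "isomorphic_bimodules K X Y P Q \<longleftrightarrow>
     bimodule K X Y P \<and> bimodule K X Y Q \<and>
     (\<exists>\<phi>. \<phi> \<in> linear_maps K (space P) (space Q) \<and>
          bij_betw \<phi> (carrier (space P)) (carrier (space Q)) \<and>
          (\<forall>x\<in>carrier X. \<forall>m\<in>carrier (space P). \<phi> (lact P x m) = lact Q x (\<phi> m)) \<and>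
          (\<forall>y\<in>carrier Y. \<forall>m\<in>carrier (space P). \<phi> (ract P m y) = ract Q (\<phi> m) y))"

definition regular_bimodule :: "('k, 'x) module \<Rightarrow> ('k, 'x, 'x, 'x) bimod" where
  "regular_bimodule X = \<lparr>space = X, lact = mult X, ract = mult X\<rparr>"

definition restrict_left ::
    "('z \<Rightarrow> 'x) \<Rightarrow> ('k, 'x, 'y, 'm) bimod \<Rightarrow> ('k, 'z, 'y, 'm) bimod" where
  "restrict_left h P = \<lparr>space = space P, lact = (\<lambda>z. lact P (h z)), ract = ract P\<rparr>"

definition restrict_right ::
    "('z \<Rightarrow> 'y) \<Rightarrow> ('k, 'x, 'y, 'm) bimod \<Rightarrow> ('k, 'x, 'z, 'm) bimod" where
  "restrict_right h P = \<lparr>space = space P, lact = lact P, ract = (\<lambda>m z. ract P m (h z))\<rparr>"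

text \<open>The \<open>n\<close>-fold tensor product over \<open>B\<close>, for \<open>n \<ge> 1\<close>, of a \<open>B\<close>-\<open>B\<close>-bimodule \<open>P\<close> with itself:
  the \<open>n\<close>-fold tensor power over the ground field modulo the relations
  \<open>\<dots> \<otimes> p b \<otimes> q \<otimes> \<dots> = \<dots> \<otimes> p \<otimes> b q \<otimes> \<dots>\<close> in adjacent slots.\<close>

definition balanced_power_relations ::
    "'k ring \<Rightarrow> ('k, 'b) module \<Rightarrow> ('k, 'b, 'b, 'm) bimod \<Rightarrow> nat \<Rightarrow> ('m list \<Rightarrow> 'k) set" where
  "balanced_power_relations K B P n =
     (\<Union>ms\<in>tuples (space P) n. \<Union>i\<in>{..<n}.
        slot_relations K (tuples (space P) n) (space P) (\<lambda>m. ms[i := m])) \<union>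
     {basis_vector K (ms[i := ract P p b, Suc i := q])
        \<ominus>\<^bsub>free_module K (tuples (space P) n)\<^esub> basis_vector K (ms[i := p, Suc i := lact P b q])
      | ms i p b q. ms \<in> tuples (space P) n \<and> Suc i < n \<and>
          p \<in> carrier (space P) \<and> b \<in> carrier B \<and> q \<in> carrier (space P)}"

definition balanced_power ::
    "'k ring \<Rightarrow> ('k, 'b) module \<Rightarrow> ('k, 'b, 'b, 'm) bimod \<Rightarrow> nat \<Rightarrow> ('k, ('m list \<Rightarrow> 'k) set) module" where
  "balanced_power K B P n =
     presented_module K (tuples (space P) n) (balanced_power_relations K B P n)"

definition pure_balanced ::
    "'k ring \<Rightarrow> ('k, 'b) module \<Rightarrow> ('k, 'b, 'b, 'm) bimod \<Rightarrow> 'm list \<Rightarrow> ('m list \<Rightarrow> 'k) set" where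
  "pure_balanced K B P ms =
     generator K (tuples (space P) (length ms)) (balanced_power_relations K B P (length ms)) ms"


section \<open>Factorisation algebras\<close>

text \<open>The last clause is \<open>(a d\<^sub>\<alpha>)\<^sub>\<beta> \<otimes> b\<^sup>\<beta> c\<^sup>\<alpha> = a\<^sub>\<beta> d\<^sub>\<alpha> \<otimes> (b\<^sup>\<beta> c)\<^sup>\<alpha>\<close>.\<close>

definition factorisation ::
    "'k ring \<Rightarrow> ('k, 'a) module \<Rightarrow> ('k, 'b) module \<Rightarrow>
     (('b \<times> 'a \<Rightarrow> 'k) set \<Rightarrow> ('a \<times> 'b \<Rightarrow> 'k) set) \<Rightarrow> bool" where
  "factorisation K A B \<psi> \<longleftrightarrow>
     \<psi> \<in> linear_maps K (tensor K B A) (tensor K A B) \<and>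
     (\<forall>a\<in>carrier A. \<psi> (pure_tensor K B A \<one>\<^bsub>B\<^esub> a) = pure_tensor K A B a \<one>\<^bsub>B\<^esub>) \<and>
     (\<forall>b\<in>carrier B. \<psi> (pure_tensor K B A b \<one>\<^bsub>A\<^esub>) = pure_tensor K A B \<one>\<^bsub>A\<^esub> b) \<and>
     (\<forall>a\<in>carrier A. \<forall>d\<in>carrier A. \<forall>b\<in>carrier B. \<forall>c\<in>carrier B.
        extend_linearly K (tensor K A B)
          (\<lambda>(d', c'). extend_linearly K (tensor K A B)
             (\<lambda>(e, b'). pure_tensor K A B e (b' \<otimes>\<^bsub>B\<^esub> c'))
             (\<psi> (pure_tensor K B A b (a \<otimes>\<^bsub>A\<^esub> d'))))
          (\<psi> (pure_tensor K B A c d))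
        = extend_linearly K (tensor K A B)
          (\<lambda>(a', b'). extend_linearly K (tensor K A B)
             (\<lambda>(d', e). pure_tensor K A B (a' \<otimes>\<^bsub>A\<^esub> d') e)
             (\<psi> (pure_tensor K B A (b' \<otimes>\<^bsub>B\<^esub> c) d)))
          (\<psi> (pure_tensor K B A b a)))"

text \<open>The product is \<open>(a \<otimes> b)(c \<otimes> d) = a c\<^sub>\<alpha> \<otimes> b\<^sup>\<alpha> d\<close>.\<close>

definition factorisation_algebra ::
    "'k ring \<Rightarrow> ('k, 'a) module \<Rightarrow> ('k, 'b) module \<Rightarrow>
     (('b \<times> 'a \<Rightarrow> 'k) set \<Rightarrow> ('a \<times> 'b \<Rightarrow> 'k) set) \<Rightarrow> ('k, ('a \<times> 'b \<Rightarrow> 'k) set) module" where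
  "factorisation_algebra K A B \<psi> = (tensor K A B)
     \<lparr>mult := (\<lambda>s t.
        extend_linearly K (tensor K A B)
          (\<lambda>(a, b). extend_linearly K (tensor K A B)
             (\<lambda>(c, d). extend_linearly K (tensor K A B)
                (\<lambda>(c', b'). pure_tensor K A B (a \<otimes>\<^bsub>A\<^esub> c') (b' \<otimes>\<^bsub>B\<^esub> d))
                (\<psi> (pure_tensor K B A b c)))
             t)
          s),
      one := pure_tensor K A B \<one>\<^bsub>A\<^esub> \<one>\<^bsub>B\<^esub>\<rparr>"

definition incl_B :: "'k ring \<Rightarrow> ('k, 'a) module \<Rightarrow> ('k, 'b) module \<Rightarrow> 'b \<Rightarrow> ('a \<times> 'b \<Rightarrow> 'k) set" where
  "incl_B K A B b = pure_tensor K A B \<one>\<^bsub>A\<^esub> b"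

definition factorisation_BB ::
    "'k ring \<Rightarrow> ('k, 'a) module \<Rightarrow> ('k, 'b) module \<Rightarrow>
     (('b \<times> 'a \<Rightarrow> 'k) set \<Rightarrow> ('a \<times> 'b \<Rightarrow> 'k) set) \<Rightarrow> ('k, 'b, 'b, ('a \<times> 'b \<Rightarrow> 'k) set) bimod" where
  "factorisation_BB K A B \<psi> = restrict_left (incl_B K A B) (restrict_right (incl_B K A B)
     (regular_bimodule (factorisation_algebra K A B \<psi>)))"

text \<open>\<open>S\<^sub>\<psi> \<otimes>\<^sub>B \<dots> \<otimes>\<^sub>B S\<^sub>\<psi>\<close> (\<open>n \<ge> 1\<close> factors) as an \<open>S\<^sub>\<psi>\<close>-\<open>S\<^sub>\<psi>\<close>-bimodule.\<close>

definition S_power ::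
    "'k ring \<Rightarrow> ('k, 'a) module \<Rightarrow> ('k, 'b) module \<Rightarrow>
     (('b \<times> 'a \<Rightarrow> 'k) set \<Rightarrow> ('a \<times> 'b \<Rightarrow> 'k) set) \<Rightarrow> nat \<Rightarrow>
     ('k, ('a \<times> 'b \<Rightarrow> 'k) set, ('a \<times> 'b \<Rightarrow> 'k) set, (('a \<times> 'b \<Rightarrow> 'k) set list \<Rightarrow> 'k) set) bimod" where
  "S_power K A B \<psi> n =
     (let S = factorisation_algebra K A B \<psi>;
          P = factorisation_BB K A B \<psi>;
          T = balanced_power K B P n
      in \<lparr>space = T,
          lact = (\<lambda>s. extend_linearly K T
                    (\<lambda>ss. pure_balanced K B P ((s \<otimes>\<^bsub>S\<^esub> hd ss) # tl ss))),
          ract = (\<lambda>x s. extend_linearly K T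
                    (\<lambda>ss. pure_balanced K B P (butlast ss @ [last ss \<otimes>\<^bsub>S\<^esub> s])) x)\<rparr>)"

text \<open>\<open>move_past K A B \<psi> [a\<^sub>1, \<dots>, a\<^sub>n] b\<close> is \<open>\<Psi>\<^sub>n(b \<otimes> a\<^sub>1 \<otimes> \<dots> \<otimes> a\<^sub>n)\<close>: the first application of \<open>\<psi>\<close>
  moves \<open>b\<close> past \<open>a\<^sub>1\<close>, and the resulting \<open>B\<close>-factor is then moved past \<open>a\<^sub>2, \<dots>, a\<^sub>n\<close>.\<close>

primrec move_past ::
    "'k ring \<Rightarrow> ('k, 'a) module \<Rightarrow> ('k, 'b) module \<Rightarrow>
     (('b \<times> 'a \<Rightarrow> 'k) set \<Rightarrow> ('a \<times> 'b \<Rightarrow> 'k) set) \<Rightarrow> 'a list \<Rightarrow> 'b \<Rightarrow> ('a list \<times> 'b \<Rightarrow> 'k) set" where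
  "move_past K A B \<psi> [] = (\<lambda>b. pure_power_tensor K A B [] b)"
| "move_past K A B \<psi> (a # as) = (\<lambda>b.
     extend_linearly K (power_tensor K A B (Suc (length as)))
       (\<lambda>(a', b'). extend_linearly K (power_tensor K A B (Suc (length as)))
          (\<lambda>(as', c). pure_power_tensor K A B (a' # as') c)
          (move_past K A B \<psi> as b'))
       (\<psi> (pure_tensor K B A b a)))"

text \<open>\<open>A \<otimes> \<dots> \<otimes> A \<otimes> B\<close> (\<open>n \<ge> 1\<close> factors \<open>A\<close>) as an \<open>S\<^sub>\<psi>\<close>-\<open>S\<^sub>\<psi>\<close>-bimodule.\<close>

definition A_power_B ::
    "'k ring \<Rightarrow> ('k, 'a) module \<Rightarrow> ('k, 'b) module \<Rightarrow>
     (('b \<times> 'a \<Rightarrow> 'k) set \<Rightarrow> ('a \<times> 'b \<Rightarrow> 'k) set) \<Rightarrow> nat \<Rightarrow>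
     ('k, ('a \<times> 'b \<Rightarrow> 'k) set, ('a \<times> 'b \<Rightarrow> 'k) set, ('a list \<times> 'b \<Rightarrow> 'k) set) bimod" where
  "A_power_B K A B \<psi> n =
     (let T = power_tensor K A B n
      in \<lparr>space = T,
          lact = (\<lambda>s x.
            extend_linearly K T
              (\<lambda>(a, b). extend_linearly K T
                 (\<lambda>(as, c). extend_linearly K T
                    (\<lambda>(as', b'). pure_power_tensor K A B ((a \<otimes>\<^bsub>A\<^esub> hd as') # tl as') (b' \<otimes>\<^bsub>B\<^esub> c))
                    (move_past K A B \<psi> as b))
                 x)
              s),
          ract = (\<lambda>x s.
            extend_linearly K T
              (\<lambda>(as, b). extend_linearly K T
                 (\<lambda>(c, d). extend_linearly K T
                    (\<lambda>(c', b'). pure_power_tensor K A B (butlast as @ [last as \<otimes>\<^bsub>A\<^esub> c']) (b' \<otimes>\<^bsub>B\<^esub> d))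
                    (\<psi> (pure_tensor K B A b c)))
                 s)
              x)\<rparr>)"

text \<open>The case \<open>n = 0\<close>: \<open>k \<otimes> B\<close> as a \<open>B\<close>-\<open>B\<close>-bimodule.\<close>

definition ground_tensor_B ::
    "'k ring \<Rightarrow> ('k, 'b) module \<Rightarrow> ('k, 'b, 'b, ('k \<times> 'b \<Rightarrow> 'k) set) bimod" where
  "ground_tensor_B K B =
     (let k = ground_module K; T = tensor K k B
      in \<lparr>space = T,
          lact = (\<lambda>b. extend_linearly K T (\<lambda>(c, b'). pure_tensor K k B c (b \<otimes>\<^bsub>B\<^esub> b'))),
          ract = (\<lambda>x b. extend_linearly K T (\<lambda>(c, b'). pure_tensor K k B c (b' \<otimes>\<^bsub>B\<^esub> b)) x)\<rparr>)"

end

theory Submission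
  imports Defs
begin

text \<open>Write \<open>Q\<^sub>n\<close> for \<open>A\<^sup>\<otimes>\<^sup>n \<otimes> B\<close> with its left \<open>B\<close>-action \<open>b \<cdot> (a\<^sub>1 \<otimes> q) = (a\<^sub>1)\<^sub>\<alpha> \<otimes> b\<^sup>\<alpha> \<cdot> q\<close>. The map
  \<open>S\<^sub>\<psi> \<otimes> Q\<^sub>n \<rightarrow> Q\<^sub>n\<^sub>+\<^sub>1\<close>, \<open>(a \<otimes> b) \<otimes> q \<mapsto> a \<otimes> b \<cdot> q\<close>, is \<open>B\<close>-balanced and compatible with left multiplication
  by \<open>S\<^sub>\<psi>\<close>, since \<open>Q\<^sub>n\<close> is a \<open>B\<close>-module. Iterating it from \<open>1\<^sub>B \<in> Q\<^sub>0\<close> collapses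
  \<open>S\<^sub>\<psi> \<otimes>\<^sub>B \<dots> \<otimes>\<^sub>B S\<^sub>\<psi>\<close> onto \<open>Q\<^sub>n\<close> and intertwines both actions. It is inverse to the embedding
  \<open>a\<^sub>1 \<otimes> \<dots> \<otimes> a\<^sub>n \<otimes> b \<mapsto> (a\<^sub>1 \<otimes> 1) \<otimes>\<^sub>B \<dots> \<otimes>\<^sub>B (a\<^sub>n \<otimes> b)\<close>, which is onto because every \<open>B\<close>-component can be
  moved to the right through the balanced tensor product. The bimodule axioms of \<open>Q\<^sub>n\<close> are then
  transported from the balanced power, where they are immediate from associativity of \<open>S\<^sub>\<psi>\<close>.\<close>


section \<open>Linear maps\<close>

text \<open>Every map out of a tensor product is a Sweedler sum, evaluated by
  \<open>extend_linearly\<close> on coset representatives, so each formula owes a proof that it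
  respects the relations. The nested sums of the definitions are therefore rewritten from the inside
  out as composites of a few bilinear maps, after which identities are checked on pure tensors. The
  module axiom for Q_n and the balancing of the map S \<otimes> Q_n \<rightarrow> Q_(n+1) interlock:
  balancing at n needs the axiom at n, and the axiom at n + 1 needs balancing at n together with
  associativity of S. Commutation of the left B-action with the right S-action interlocks in the
  same way with the passage of the right action through that map. The third clause of a
  factorisation enters only through associativity of S, as the equality of the two bracketings of (1
  \<otimes> b)(c \<otimes> d)(e \<otimes> 1). Bijectivity comes from two facts, that the collapse
  undoes the embedding and that the embedding is onto; the composite in the other order is never
  computed.\<close>

lemma linear_mapsI:
  assumes "\<And>x. x \<in> carrier M \<Longrightarrow> f x \<in> carrier N"
    and "\<And>x y. x \<in> carrier M \<Longrightarrow> y \<in> carrier M \<Longrightarrow> f (x \<oplus>\<^bsub>M\<^esub> y) = f x \<oplus>\<^bsub>N\<^esub> f y"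
    and "\<And>c x. c \<in> carrier K \<Longrightarrow> x \<in> carrier M \<Longrightarrow> f (c \<odot>\<^bsub>M\<^esub> x) = c \<odot>\<^bsub>N\<^esub> f x"
  shows "f \<in> linear_maps K M N"
  using assms by (auto simp: linear_maps_def)

lemma linear_maps_closed: "f \<in> linear_maps K M N \<Longrightarrow> x \<in> carrier M \<Longrightarrow> f x \<in> carrier N"
  and linear_maps_add: "f \<in> linear_maps K M N \<Longrightarrow> x \<in> carrier M \<Longrightarrow> y \<in> carrier M \<Longrightarrow>
    f (x \<oplus>\<^bsub>M\<^esub> y) = f x \<oplus>\<^bsub>N\<^esub> f y"
  and linear_maps_smult: "f \<in> linear_maps K M N \<Longrightarrow> c \<in> carrier K \<Longrightarrow> x \<in> carrier M \<Longrightarrow>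
    f (c \<odot>\<^bsub>M\<^esub> x) = c \<odot>\<^bsub>N\<^esub> f x"
  by (auto simp: linear_maps_def)

text \<open>HOL functions are total, while \<open>linear_maps\<close> constrains them only on the
  carrier. Closure of a module under its operations lets a formula be exchanged for one that agrees
  with it there.\<close>

lemma linear_maps_cong:
  assumes "module K M" "\<And>x. x \<in> carrier M \<Longrightarrow> f x = g x"
  shows "f \<in> linear_maps K M N \<longleftrightarrow> g \<in> linear_maps K M N"
proof -
  interpret M: module K M by fact
  show ?thesis using assms(2) by (simp add: linear_maps_def Pi_def)
qed

lemma linear_maps_zero:
  assumes "module K M" "module K N" "f \<in> linear_maps K M N"
  shows "f \<zero>\<^bsub>M\<^esub> = \<zero>\<^bsub>N\<^esub>"
proof -
  interpret M: module K M by fact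
  interpret N: module K N by fact
  have "f (\<zero>\<^bsub>K\<^esub> \<odot>\<^bsub>M\<^esub> \<zero>\<^bsub>M\<^esub>) = \<zero>\<^bsub>K\<^esub> \<odot>\<^bsub>N\<^esub> f \<zero>\<^bsub>M\<^esub>"
    using assms(3) by (rule linear_maps_smult) simp_all
  then show ?thesis using linear_maps_closed[OF assms(3)] by simp
qed

lemma linear_maps_minus:
  assumes "module K M" "module K N" "f \<in> linear_maps K M N" "x \<in> carrier M" "y \<in> carrier M"
  shows "f (x \<ominus>\<^bsub>M\<^esub> y) = f x \<ominus>\<^bsub>N\<^esub> f y"
proof -
  interpret M: module K M by fact
  interpret N: module K N by fact
  note [simp] = linear_maps_closed[OF assms(3)]
  have "f (x \<ominus>\<^bsub>M\<^esub> y) \<oplus>\<^bsub>N\<^esub> f y = f (x \<ominus>\<^bsub>M\<^esub> y \<oplus>\<^bsub>M\<^esub> y)"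
    using assms by (simp add: linear_maps_add[OF assms(3)])
  also have "\<dots> = f x"
    using assms by (simp add: a_minus_def M.a_assoc M.l_neg)
  finally have "f x \<ominus>\<^bsub>N\<^esub> f y = f (x \<ominus>\<^bsub>M\<^esub> y) \<oplus>\<^bsub>N\<^esub> f y \<ominus>\<^bsub>N\<^esub> f y"
    by simp
  also have "\<dots> = f (x \<ominus>\<^bsub>M\<^esub> y)"
    using assms by (simp add: a_minus_def N.a_assoc N.r_neg)
  finally show ?thesis by simp
qed

lemma linear_maps_comp:
  assumes "f \<in> linear_maps K M N" "g \<in> linear_maps K N P"
  shows "(\<lambda>x. g (f x)) \<in> linear_maps K M P"
  using assms by (auto simp: linear_maps_def Pi_def)

lemma linear_maps_id: "(\<lambda>x. x) \<in> linear_maps K M M"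
  by (auto simp: linear_maps_def)

lemma linear_maps_const_zero:
  assumes "module K N"
  shows "(\<lambda>x. \<zero>\<^bsub>N\<^esub>) \<in> linear_maps K M N"
proof -
  interpret N: module K N by fact
  show ?thesis by (auto simp: linear_maps_def)
qed

lemma linear_maps_plus:
  assumes "module K N" "f \<in> linear_maps K M N" "g \<in> linear_maps K M N"
  shows "(\<lambda>x. f x \<oplus>\<^bsub>N\<^esub> g x) \<in> linear_maps K M N"
proof -
  interpret N: module K N by fact
  note [simp] = linear_maps_closed[OF assms(2)] linear_maps_closed[OF assms(3)]
    linear_maps_add[OF assms(2)] linear_maps_add[OF assms(3)]
    linear_maps_smult[OF assms(2)] linear_maps_smult[OF assms(3)]
  show ?thesis
    by (rule linear_mapsI) (simp_all add: N.a_ac N.smult_r_distr)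
qed

lemma linear_maps_scale:
  assumes "module K N" "f \<in> linear_maps K M N" "c \<in> carrier K"
  shows "(\<lambda>x. c \<odot>\<^bsub>N\<^esub> f x) \<in> linear_maps K M N"
proof -
  interpret N: module K N by fact
  note [simp] = linear_maps_closed[OF assms(2)] linear_maps_add[OF assms(2)] linear_maps_smult[OF assms(2)]
  show ?thesis using assms(3)
    by (intro linear_mapsI) (simp_all add: N.smult_r_distr N.R.m_comm flip: N.smult_assoc1)
qed

text \<open>Curried, with linearity asked of each section, so that either argument can be replaced
  by a linear expression through \<open>linear_maps_comp\<close>.\<close>

definition bilinear ::
    "'k ring \<Rightarrow> ('k, 'm) module \<Rightarrow> ('k, 'n) module \<Rightarrow> ('k, 'p) module \<Rightarrow> ('m \<Rightarrow> 'n \<Rightarrow> 'p) \<Rightarrow> bool" where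
  "bilinear K M N P f \<longleftrightarrow> (\<forall>x\<in>carrier M. f x \<in> linear_maps K N P) \<and>
     (\<forall>y\<in>carrier N. (\<lambda>x. f x y) \<in> linear_maps K M P)"

lemma bilinearI:
  assumes "\<And>x. x \<in> carrier M \<Longrightarrow> f x \<in> linear_maps K N P"
    and "\<And>y. y \<in> carrier N \<Longrightarrow> (\<lambda>x. f x y) \<in> linear_maps K M P"
  shows "bilinear K M N P f"
  using assms by (simp add: bilinear_def)

lemma bilinear_right: "bilinear K M N P f \<Longrightarrow> x \<in> carrier M \<Longrightarrow> f x \<in> linear_maps K N P"
  and bilinear_left: "bilinear K M N P f \<Longrightarrow> y \<in> carrier N \<Longrightarrow> (\<lambda>x. f x y) \<in> linear_maps K M P"
  by (simp_all add: bilinear_def)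

lemma bilinear_closed:
  "bilinear K M N P f \<Longrightarrow> x \<in> carrier M \<Longrightarrow> y \<in> carrier N \<Longrightarrow> f x y \<in> carrier P"
  by (auto simp: bilinear_def intro: linear_maps_closed)


section \<open>Modules given by generators and relations\<close>

lemma submodule_zero: "submodule H K M \<Longrightarrow> \<zero>\<^bsub>M\<^esub> \<in> H"
  using subgroup.one_closed[of H "add_monoid M"] by (simp add: submodule_def)

lemma submodule_span_least: "submodule H K M \<Longrightarrow> R \<subseteq> H \<Longrightarrow> submodule_span K M R \<subseteq> H"
  by (auto simp: submodule_span_def)

lemma submodule_span_contains: "R \<subseteq> submodule_span K M R"
  by (auto simp: submodule_span_def)

lemma submodule_submodule_span:
  assumes "module K M" "R \<subseteq> carrier M"
  shows "submodule (submodule_span K M R) K M"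
proof -
  interpret M: module K M by fact
  \<comment> \<open>The carrier belongs to the intersected family, which keeps the intersection
    inside it; this is where \<open>assms(2)\<close> comes in.\<close>
  have c: "submodule (carrier M) K M" by (rule M.carrier_is_submodule)
  show ?thesis
  proof (rule M.submoduleI)
    show "submodule_span K M R \<subseteq> carrier M" using c assms(2) by (rule submodule_span_least)
    show "\<zero>\<^bsub>M\<^esub> \<in> submodule_span K M R"
      by (auto simp: submodule_span_def submodule_zero)
  qed (auto simp: submodule_span_def dest: M.submoduleE)
qed

text \<open>A kernel that contains the relators contains their span, which is how a map descends to
  the quotient. Negatives are handled as multiples by -1.\<close>

lemma submodule_kernel:
  assumes "module K M" "module K N" "f \<in> linear_maps K M N"
  shows "submodule {x \<in> carrier M. f x = \<zero>\<^bsub>N\<^esub>} K M"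
proof -
  interpret M: module K M by fact
  interpret N: module K N by fact
  have neg: "f (\<ominus>\<^bsub>M\<^esub> x) = \<ominus>\<^bsub>N\<^esub> f x" if "x \<in> carrier M" for x
    using linear_maps_smult[OF assms(3), of "\<ominus>\<^bsub>K\<^esub> \<one>\<^bsub>K\<^esub>" x] that linear_maps_closed[OF assms(3)]
    by (simp add: M.smult_l_minus N.smult_l_minus)
  show ?thesis
    by (rule M.submoduleI)
      (auto simp: linear_maps_zero[OF assms] neg linear_maps_add[OF assms(3)] linear_maps_smult[OF assms(3)])
qed

lemma module_free_module:
  assumes "cring K"
  shows "module K (free_module K X)"
proof -
  interpret K: cring K by fact
  let ?C = "carrier (free_module K X)"
  \<comment> \<open>One bound serves sums, negatives and multiples: a pointwise operation that sends
    (0, 0) to 0 has support in the union of the two supports. The unary operations pass the same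
    vector twice and ignore one argument.\<close>
  have fin: "finite {x. f (u x) (v x) \<noteq> \<zero>\<^bsub>K\<^esub>}"
    if "u \<in> ?C" "v \<in> ?C" "f \<zero>\<^bsub>K\<^esub> \<zero>\<^bsub>K\<^esub> = \<zero>\<^bsub>K\<^esub>" for u v f
  proof (rule finite_subset)
    show "{x. f (u x) (v x) \<noteq> \<zero>\<^bsub>K\<^esub>} \<subseteq> {x. u x \<noteq> \<zero>\<^bsub>K\<^esub>} \<union> {x. v x \<noteq> \<zero>\<^bsub>K\<^esub>}"
      using that(3) by auto
    show "finite ({x. u x \<noteq> \<zero>\<^bsub>K\<^esub>} \<union> {x. v x \<noteq> \<zero>\<^bsub>K\<^esub>})"
      using that by (simp add: free_module_def)
  qed
  have grp: "abelian_group (free_module K X)"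
  proof (rule abelian_groupI)
    fix u assume u: "u \<in> ?C"
    show "\<exists>v\<in>?C. v \<oplus>\<^bsub>free_module K X\<^esub> u = \<zero>\<^bsub>free_module K X\<^esub>"
    proof (rule bexI[where x = "\<lambda>x. \<ominus>\<^bsub>K\<^esub> u x"])
      show "(\<lambda>x. \<ominus>\<^bsub>K\<^esub> u x) \<in> ?C"
        using u fin[OF u u, of "\<lambda>s t. \<ominus>\<^bsub>K\<^esub> s"] by (simp add: free_module_def)
    qed (use u in \<open>simp add: free_module_def K.l_neg\<close>)
  next
    fix u v assume "u \<in> ?C" "v \<in> ?C"
    then show "u \<oplus>\<^bsub>free_module K X\<^esub> v \<in> ?C"
      using fin[of u v "\<lambda>s t. s \<oplus>\<^bsub>K\<^esub> t"] by (simp add: free_module_def)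
  qed (auto simp: free_module_def K.a_ac)
  show ?thesis
  proof (rule moduleI[OF assms grp])
    fix c u assume "c \<in> carrier K" "u \<in> ?C"
    then show "c \<odot>\<^bsub>free_module K X\<^esub> u \<in> ?C"
      using fin[of u u "\<lambda>s t. c \<otimes>\<^bsub>K\<^esub> s"] by (simp add: free_module_def)
  qed (auto simp: free_module_def K.l_distr K.r_distr K.m_ac)
qed

lemma basis_vector_closed:
  assumes "cring K" "x \<in> X"
  shows "basis_vector K x \<in> carrier (free_module K X)"
proof -
  interpret K: cring K by fact
  have "finite {y. basis_vector K x y \<noteq> \<zero>\<^bsub>K\<^esub>}"
    by (rule finite_subset[of _ "{x}"]) (auto simp: basis_vector_def)
  then show ?thesis using assms(2) by (auto simp: free_module_def basis_vector_def)
qed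

lemma free_module_induct:
  assumes "cring K" "submodule H K (free_module K X)"
    and "\<And>x. x \<in> X \<Longrightarrow> basis_vector K x \<in> H"
  shows "carrier (free_module K X) \<subseteq> H"
proof -
  let ?F = "free_module K X"
  interpret K: cring K by fact
  interpret F: module K ?F by (rule module_free_module) fact
  have "u \<in> H" if "finite G" "{x. u x \<noteq> \<zero>\<^bsub>K\<^esub>} \<subseteq> G" "u \<in> carrier ?F" for G u
    using that
  proof (induction G arbitrary: u)
    case empty
    then have "u = \<zero>\<^bsub>?F\<^esub>" by (auto simp: free_module_def)
    then show ?case using submodule_zero[OF assms(2)] by simp
  next
    case (insert x G)
    let ?v = "u(x := \<zero>\<^bsub>K\<^esub>)"
    show ?case
    proof (cases "x \<in> X")
      case True
      have "finite {y. ?v y \<noteq> \<zero>\<^bsub>K\<^esub>}"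
        by (rule finite_subset[OF _ insert.hyps(1)]) (use insert.prems in auto)
      then have "?v \<in> H"
        using insert.prems by (intro insert.IH) (auto simp: free_module_def)
      moreover have "u x \<odot>\<^bsub>?F\<^esub> basis_vector K x \<in> H"
        using insert.prems assms(3)[OF True] F.submoduleE(4)[OF assms(2)]
        by (simp add: free_module_def)
      moreover have "u = ?v \<oplus>\<^bsub>?F\<^esub> (u x \<odot>\<^bsub>?F\<^esub> basis_vector K x)"
        using insert.prems by (auto simp: free_module_def basis_vector_def fun_eq_iff)
      ultimately show ?thesis
        using F.submoduleE(5)[OF assms(2)] by metis
    next
      case False
      then show ?thesis
        using insert.prems by (intro insert.IH) (auto simp: free_module_def)
    qed
  qed
  then show ?thesis by (auto simp: free_module_def)
qed

text \<open>The sum inside \<open>extend_linearly\<close>, taken at a single representative before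
  passing to cosets.\<close>

definition linear_lift :: "'k ring \<Rightarrow> ('k, 'n) module \<Rightarrow> ('x \<Rightarrow> 'n) \<Rightarrow> ('x \<Rightarrow> 'k) \<Rightarrow> 'n" where
  "linear_lift K N f u = (\<Oplus>\<^bsub>N\<^esub>x\<in>{x. u x \<noteq> \<zero>\<^bsub>K\<^esub>}. u x \<odot>\<^bsub>N\<^esub> f x)"

text \<open>The defining sum ranges over the support, which varies with the vector. Padding with
  zero terms gives u, v and u + v a common index set, as additivity requires.\<close>

lemma linear_lift_superset:
  assumes "module K N" "f \<in> X \<rightarrow> carrier N" "u \<in> carrier (free_module K X)"
    and "finite G" "{x. u x \<noteq> \<zero>\<^bsub>K\<^esub>} \<subseteq> G" "G \<subseteq> X"
  shows "linear_lift K N f u = (\<Oplus>\<^bsub>N\<^esub>x\<in>G. u x \<odot>\<^bsub>N\<^esub> f x)"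
proof -
  interpret N: module K N by fact
  show ?thesis unfolding linear_lift_def
    by (rule N.add.finprod_mono_neutral_cong_left)
      (use assms in \<open>auto simp: free_module_def Pi_def subset_eq\<close>)
qed

lemma linear_lift_linear:
  assumes "module K N" "f \<in> X \<rightarrow> carrier N"
  shows "linear_lift K N f \<in> linear_maps K (free_module K X) N"
proof -
  interpret N: module K N by fact
  let ?F = "free_module K X"
  interpret F: module K ?F by (rule module_free_module) (rule N.R.is_cring)
  show ?thesis
  proof (rule linear_mapsI)
    fix u assume u: "u \<in> carrier ?F"
    then show "linear_lift K N f u \<in> carrier N" unfolding linear_lift_def
      using assms by (intro N.finsum_closed) (auto simp: free_module_def Pi_def)
    fix v assume v: "v \<in> carrier ?F"
    let ?G = "{x. u x \<noteq> \<zero>\<^bsub>K\<^esub>} \<union> {x. v x \<noteq> \<zero>\<^bsub>K\<^esub>}"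
    have G: "finite ?G" "?G \<subseteq> X" using u v by (auto simp: free_module_def)
    have uv: "u \<oplus>\<^bsub>?F\<^esub> v = (\<lambda>x. u x \<oplus>\<^bsub>K\<^esub> v x)" by (simp add: free_module_def)
    have k: "u x \<in> carrier K" "v x \<in> carrier K" for x using u v by (auto simp: free_module_def)
    have f: "f x \<in> carrier N" if "x \<in> ?G" for x using assms(2) G that by blast
    have "linear_lift K N f (u \<oplus>\<^bsub>?F\<^esub> v) = (\<Oplus>\<^bsub>N\<^esub>x\<in>?G. (u x \<oplus>\<^bsub>K\<^esub> v x) \<odot>\<^bsub>N\<^esub> f x)"
      using G F.a_closed[OF u v] k
      by (subst linear_lift_superset[OF assms, of _ ?G]) (auto simp: uv)
    also have "\<dots> = (\<Oplus>\<^bsub>N\<^esub>x\<in>?G. u x \<odot>\<^bsub>N\<^esub> f x \<oplus>\<^bsub>N\<^esub> v x \<odot>\<^bsub>N\<^esub> f x)"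
      by (rule N.finsum_cong') (use k f in \<open>auto simp: N.smult_l_distr\<close>)
    also have "\<dots> = (\<Oplus>\<^bsub>N\<^esub>x\<in>?G. u x \<odot>\<^bsub>N\<^esub> f x) \<oplus>\<^bsub>N\<^esub> (\<Oplus>\<^bsub>N\<^esub>x\<in>?G. v x \<odot>\<^bsub>N\<^esub> f x)"
      by (rule N.finsum_addf) (use k f in auto)
    also have "\<dots> = linear_lift K N f u \<oplus>\<^bsub>N\<^esub> linear_lift K N f v"
      using linear_lift_superset[OF assms u G(1) _ G(2)] linear_lift_superset[OF assms v G(1) _ G(2)]
      by simp
    finally show "linear_lift K N f (u \<oplus>\<^bsub>?F\<^esub> v) = linear_lift K N f u \<oplus>\<^bsub>N\<^esub> linear_lift K N f v" .
  next
    fix c u assume c: "c \<in> carrier K" and u: "u \<in> carrier ?F"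
    let ?G = "{x. u x \<noteq> \<zero>\<^bsub>K\<^esub>}"
    have G: "finite ?G" "?G \<subseteq> X" using u by (auto simp: free_module_def)
    have cu: "c \<odot>\<^bsub>?F\<^esub> u = (\<lambda>x. c \<otimes>\<^bsub>K\<^esub> u x)" by (simp add: free_module_def)
    have k: "u x \<in> carrier K" for x using u by (auto simp: free_module_def)
    have f: "f x \<in> carrier N" if "x \<in> ?G" for x using assms(2) G that by blast
    have "linear_lift K N f (c \<odot>\<^bsub>?F\<^esub> u) = (\<Oplus>\<^bsub>N\<^esub>x\<in>?G. (c \<otimes>\<^bsub>K\<^esub> u x) \<odot>\<^bsub>N\<^esub> f x)"
      using F.smult_closed[OF c u] G c by (subst linear_lift_superset[OF assms, of _ ?G]) (auto simp: cu)
    also have "\<dots> = (\<Oplus>\<^bsub>N\<^esub>x\<in>?G. c \<odot>\<^bsub>N\<^esub> (u x \<odot>\<^bsub>N\<^esub> f x))"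
      by (rule N.finsum_cong') (use c k f in \<open>auto simp: N.smult_assoc1\<close>)
    also have "\<dots> = c \<odot>\<^bsub>N\<^esub> linear_lift K N f u" unfolding linear_lift_def
      by (rule N.finsum_smult_ldistr[symmetric]) (use G c k f in auto)
    finally show "linear_lift K N f (c \<odot>\<^bsub>?F\<^esub> u) = c \<odot>\<^bsub>N\<^esub> linear_lift K N f u" .
  qed
qed

lemma linear_lift_basis_vector:
  assumes "module K N" "f \<in> X \<rightarrow> carrier N" "x \<in> X"
  shows "linear_lift K N f (basis_vector K x) = f x"
proof -
  interpret N: module K N by fact
  have fx: "f x \<in> carrier N" using assms by blast
  have "linear_lift K N f (basis_vector K x) = (\<Oplus>\<^bsub>N\<^esub>y\<in>{x}. basis_vector K x y \<odot>\<^bsub>N\<^esub> f y)"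
    by (rule linear_lift_superset[OF assms(1,2) basis_vector_closed[OF N.R.is_cring assms(3)]])
      (use assms(3) in \<open>auto simp: basis_vector_def\<close>)
  also have "\<dots> = f x" using fx by (simp add: basis_vector_def)
  finally show ?thesis .
qed

text \<open>Makes \<open>extend_linearly K N f\<close> independent of the representative. Testing
  relators suffices because the kernel of the lift is a submodule.\<close>

definition compatible ::
    "'k ring \<Rightarrow> 'x set \<Rightarrow> ('x \<Rightarrow> 'k) set \<Rightarrow> ('k, 'n) module \<Rightarrow> ('x \<Rightarrow> 'n) \<Rightarrow> bool" where
  "compatible K X R N f \<longleftrightarrow> f \<in> X \<rightarrow> carrier N \<and> (\<forall>r\<in>R. linear_lift K N f r = \<zero>\<^bsub>N\<^esub>)"

text \<open>Tensor products, tensor powers and balanced powers are all instances, so module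
  structure and universal property are established once, here.\<close>

locale presentation =
  fixes K :: "'k ring" and X :: "'x set" and R :: "('x \<Rightarrow> 'k) set"
  assumes cring_K: "cring K" and relations: "R \<subseteq> carrier (free_module K X)"
begin

abbreviation "F \<equiv> free_module K X"
abbreviation "H \<equiv> submodule_span K F R"
abbreviation "T \<equiv> presented_module K X R"
abbreviation "\<gamma> \<equiv> generator K X R"

sublocale F: module K F
  by (rule module_free_module) (rule cring_K)

lemma submodule_H: "submodule H K F"
  by (rule submodule_submodule_span[OF F.module_axioms relations])

lemma abelian_subgroup_H: "abelian_subgroup H F"
  by (rule abelian_subgroupI3[OF additive_subgroupI F.abelian_group_axioms])
    (use submodule_H in \<open>simp add: submodule_def\<close>)

lemmas coset_self = abelian_subgroup.a_rcos_self[OF abelian_subgroup_H]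

lemma subset_H: "H \<subseteq> carrier F"
  using F.submoduleE(1)[OF submodule_H] .

lemma carrier_T: "carrier T = (\<lambda>u. H +>\<^bsub>F\<^esub> u) ` carrier F"
  by (auto simp: presented_module_def quotient_module_def A_RCOSETS_def')

lemma coset_add:
  "u \<in> carrier F \<Longrightarrow> v \<in> carrier F \<Longrightarrow> (H +>\<^bsub>F\<^esub> u) \<oplus>\<^bsub>T\<^esub> (H +>\<^bsub>F\<^esub> v) = H +>\<^bsub>F\<^esub> (u \<oplus>\<^bsub>F\<^esub> v)"
  by (simp add: presented_module_def quotient_module_def abelian_subgroup.a_rcos_sum[OF abelian_subgroup_H])

lemma coset_mem_iff: "v \<in> H +>\<^bsub>F\<^esub> u \<longleftrightarrow> (\<exists>h\<in>H. v = h \<oplus>\<^bsub>F\<^esub> u)"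
  unfolding a_r_coset_def' by blast

lemma coset_eqI:
  assumes "u \<in> H +>\<^bsub>F\<^esub> v" "v \<in> carrier F"
  shows "H +>\<^bsub>F\<^esub> u = H +>\<^bsub>F\<^esub> v"
  using F.a_repr_independence[OF assms] submodule_H by (simp add: submodule_def)

text \<open>\<open>quotient_module\<close> scales a coset by a union over all its representatives.
  The union collapses because another representative h + u with h in \<open>H\<close> changes the
  result only by c h, which is again in \<open>H\<close>.\<close>

lemma coset_smult:
  assumes "c \<in> carrier K" "u \<in> carrier F"
  shows "c \<odot>\<^bsub>T\<^esub> (H +>\<^bsub>F\<^esub> u) = H +>\<^bsub>F\<^esub> (c \<odot>\<^bsub>F\<^esub> u)"
proof -
  have "H +>\<^bsub>F\<^esub> (c \<odot>\<^bsub>F\<^esub> v) = H +>\<^bsub>F\<^esub> (c \<odot>\<^bsub>F\<^esub> u)" if v: "v \<in> H +>\<^bsub>F\<^esub> u" for v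
  proof -
    obtain h where h: "h \<in> H" "v = h \<oplus>\<^bsub>F\<^esub> u" using v unfolding coset_mem_iff by blast
    then have "h \<in> carrier F" using subset_H by blast
    then have "c \<odot>\<^bsub>F\<^esub> v = (c \<odot>\<^bsub>F\<^esub> h) \<oplus>\<^bsub>F\<^esub> (c \<odot>\<^bsub>F\<^esub> u)" using assms h by (simp add: F.smult_r_distr)
    moreover have "c \<odot>\<^bsub>F\<^esub> h \<in> H" using F.submoduleE(4)[OF submodule_H] assms h by simp
    ultimately have "c \<odot>\<^bsub>F\<^esub> v \<in> H +>\<^bsub>F\<^esub> (c \<odot>\<^bsub>F\<^esub> u)" unfolding coset_mem_iff by blast
    then show ?thesis using assms by (intro coset_eqI) simp_all
  qed
  then have "(\<Union>v\<in>H +>\<^bsub>F\<^esub> u. H +>\<^bsub>F\<^esub> (c \<odot>\<^bsub>F\<^esub> v)) = H +>\<^bsub>F\<^esub> (c \<odot>\<^bsub>F\<^esub> u)"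
    using coset_self[OF assms(2)] by (intro SUP_eq_const) blast+
  then show ?thesis by (simp add: presented_module_def quotient_module_def)
qed

lemma carrier_T_cases:
  assumes "s \<in> carrier T"
  obtains u where "u \<in> carrier F" "s = H +>\<^bsub>F\<^esub> u"
  using assms unfolding carrier_T by blast

lemma coset_closed: "u \<in> carrier F \<Longrightarrow> H +>\<^bsub>F\<^esub> u \<in> carrier T"
  unfolding carrier_T by blast

lemma coset_zero: "\<zero>\<^bsub>T\<^esub> = H +>\<^bsub>F\<^esub> \<zero>\<^bsub>F\<^esub>"
  by (simp add: presented_module_def quotient_module_def subset_H)

lemma abelian_group_T: "abelian_group T"
proof (rule abelian_groupI)
  fix s t assume "s \<in> carrier T" "t \<in> carrier T"
  then show "s \<oplus>\<^bsub>T\<^esub> t \<in> carrier T" "s \<oplus>\<^bsub>T\<^esub> t = t \<oplus>\<^bsub>T\<^esub> s"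
    by (auto elim!: carrier_T_cases simp: coset_add coset_closed F.a_comm)
next
  fix r s t assume "r \<in> carrier T" "s \<in> carrier T" "t \<in> carrier T"
  then show "r \<oplus>\<^bsub>T\<^esub> s \<oplus>\<^bsub>T\<^esub> t = r \<oplus>\<^bsub>T\<^esub> (s \<oplus>\<^bsub>T\<^esub> t)"
    by (elim carrier_T_cases) (simp add: coset_add F.a_assoc)
next
  fix s assume "s \<in> carrier T"
  then obtain u where u: "u \<in> carrier F" "s = H +>\<^bsub>F\<^esub> u" by (rule carrier_T_cases)
  then show "\<zero>\<^bsub>T\<^esub> \<oplus>\<^bsub>T\<^esub> s = s" by (simp add: coset_zero coset_add)
  show "\<exists>t\<in>carrier T. t \<oplus>\<^bsub>T\<^esub> s = \<zero>\<^bsub>T\<^esub>"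
    using u by (intro bexI[of _ "H +>\<^bsub>F\<^esub> (\<ominus>\<^bsub>F\<^esub> u)"]) (simp_all add: coset_zero coset_add coset_closed F.l_neg)
qed (simp add: coset_zero coset_closed)

lemma module_T: "module K T"
proof (rule moduleI[OF cring_K abelian_group_T])
  fix c s assume c: "c \<in> carrier K" and "s \<in> carrier T"
  then obtain u where u: "u \<in> carrier F" "s = H +>\<^bsub>F\<^esub> u" by (elim carrier_T_cases)
  show "c \<odot>\<^bsub>T\<^esub> s \<in> carrier T" using c u by (simp add: coset_smult coset_closed)
  show "(c \<oplus>\<^bsub>K\<^esub> d) \<odot>\<^bsub>T\<^esub> s = c \<odot>\<^bsub>T\<^esub> s \<oplus>\<^bsub>T\<^esub> d \<odot>\<^bsub>T\<^esub> s" if "d \<in> carrier K" for d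
    using c u that by (simp add: coset_smult coset_add F.smult_l_distr)
  show "(c \<otimes>\<^bsub>K\<^esub> d) \<odot>\<^bsub>T\<^esub> s = c \<odot>\<^bsub>T\<^esub> (d \<odot>\<^bsub>T\<^esub> s)" if "d \<in> carrier K" for d
    using c u that by (simp add: coset_smult F.smult_assoc1)
  show "c \<odot>\<^bsub>T\<^esub> (s \<oplus>\<^bsub>T\<^esub> t) = c \<odot>\<^bsub>T\<^esub> s \<oplus>\<^bsub>T\<^esub> c \<odot>\<^bsub>T\<^esub> t" if "t \<in> carrier T" for t
    using that c u by (elim carrier_T_cases) (simp add: coset_smult coset_add F.smult_r_distr)
next
  fix s assume "s \<in> carrier T"
  then show "\<one>\<^bsub>K\<^esub> \<odot>\<^bsub>T\<^esub> s = s" by (elim carrier_T_cases) (simp add: coset_smult)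
qed

sublocale T: module K T
  by (rule module_T)

lemma generator_eq: "\<gamma> x = H +>\<^bsub>F\<^esub> basis_vector K x"
  by (simp add: generator_def)

lemma generator_closed: "x \<in> X \<Longrightarrow> \<gamma> x \<in> carrier T"
  by (simp add: generator_eq coset_closed basis_vector_closed cring_K)

text \<open>Pulling \<open>U\<close> back along the quotient map gives a submodule of the free
  module that contains the basis vectors, to which \<open>free_module_induct\<close>
  applies.\<close>

lemma presented_subset:
  assumes "submodule U K T" "\<And>x. x \<in> X \<Longrightarrow> \<gamma> x \<in> U"
  shows "carrier T \<subseteq> U"
proof -
  let ?V = "{u \<in> carrier F. H +>\<^bsub>F\<^esub> u \<in> U}"
  note E = T.submoduleE[OF assms(1)]
  have neg: "H +>\<^bsub>F\<^esub> (\<ominus>\<^bsub>F\<^esub> u) \<in> U" if "u \<in> carrier F" "H +>\<^bsub>F\<^esub> u \<in> U" for u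
  proof -
    have "H +>\<^bsub>F\<^esub> ((\<ominus>\<^bsub>K\<^esub> \<one>\<^bsub>K\<^esub>) \<odot>\<^bsub>F\<^esub> u) \<in> U"
      using E(4)[of "\<ominus>\<^bsub>K\<^esub> \<one>\<^bsub>K\<^esub>", OF _ that(2)] that(1) by (simp add: coset_smult)
    then show ?thesis using that(1) by (simp add: F.smult_l_minus)
  qed
  have zero: "H +>\<^bsub>F\<^esub> \<zero>\<^bsub>F\<^esub> \<in> U"
    using submodule_zero[OF assms(1)] unfolding coset_zero .
  have "submodule ?V K F"
    by (rule F.submoduleI) (auto simp: zero neg E(4,5) simp flip: coset_add coset_smult)
  then have "carrier F \<subseteq> ?V"
    using assms(2) by (intro free_module_induct[OF cring_K])
      (auto simp: generator_eq basis_vector_closed cring_K)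
  then show ?thesis by (blast elim: carrier_T_cases)
qed

lemma presented_induct [consumes 1, case_names zero add smult generator]:
  assumes "t \<in> carrier T"
    and "P \<zero>\<^bsub>T\<^esub>"
    and "\<And>s t. s \<in> carrier T \<Longrightarrow> t \<in> carrier T \<Longrightarrow> P s \<Longrightarrow> P t \<Longrightarrow> P (s \<oplus>\<^bsub>T\<^esub> t)"
    and "\<And>c t. c \<in> carrier K \<Longrightarrow> t \<in> carrier T \<Longrightarrow> P t \<Longrightarrow> P (c \<odot>\<^bsub>T\<^esub> t)"
    and "\<And>x. x \<in> X \<Longrightarrow> P (\<gamma> x)"
  shows "P t"
proof -
  have neg: "P (\<ominus>\<^bsub>T\<^esub> s)" if "s \<in> carrier T" "P s" for s
    using assms(4)[of "\<ominus>\<^bsub>K\<^esub> \<one>\<^bsub>K\<^esub>" s] that by (simp add: T.smult_l_minus)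
  have "submodule {t \<in> carrier T. P t} K T"
    by (rule T.submoduleI) (auto simp: neg assms(2-4))
  then have "carrier T \<subseteq> {t \<in> carrier T. P t}"
    by (rule presented_subset) (simp add: generator_closed assms(5))
  then show ?thesis using assms(1) by blast
qed

text \<open>The uniqueness half of the universal property. Through its specialisations it carries
  nearly every identity below: show both sides linear, then compare on generators.\<close>

lemma linear_maps_eqI:
  assumes N: "module K N" and fg: "f \<in> linear_maps K T N" "g \<in> linear_maps K T N"
    and gen: "\<And>x. x \<in> X \<Longrightarrow> f (\<gamma> x) = g (\<gamma> x)" and t: "t \<in> carrier T"
  shows "f t = g t"
  using t
proof (induction rule: presented_induct)
  case zero
  show ?case by (simp add: linear_maps_zero[OF module_T N fg(1)] linear_maps_zero[OF module_T N fg(2)])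
next
  case (add s t)
  then show ?case by (simp add: linear_maps_add[OF fg(1)] linear_maps_add[OF fg(2)])
next
  case (smult c t)
  then show ?case by (simp add: linear_maps_smult[OF fg(1)] linear_maps_smult[OF fg(2)])
qed (rule gen)

context
  fixes N :: "('k, 'n) module"
  assumes module_N: "module K N"
begin

interpretation N: module K N by (rule module_N)

text \<open>The relators, hence all of \<open>H\<close>, lie in the kernel of the lift, so the lift
  is constant on a coset and \<open>the_elem\<close> is applied to a singleton.\<close>

lemma extend_linearly_coset:
  assumes "compatible K X R N f" "u \<in> carrier F"
  shows "extend_linearly K N f (H +>\<^bsub>F\<^esub> u) = linear_lift K N f u"
proof -
  have f: "f \<in> X \<rightarrow> carrier N" using assms(1) by (simp add: compatible_def)
  note lin = linear_lift_linear[OF module_N f]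
  have ker: "H \<subseteq> {u \<in> carrier F. linear_lift K N f u = \<zero>\<^bsub>N\<^esub>}"
    using assms(1) relations
    by (intro submodule_span_least submodule_kernel[OF F.module_axioms module_N lin])
      (auto simp: compatible_def)
  have zero: "h \<in> carrier F" "linear_lift K N f h = \<zero>\<^bsub>N\<^esub>" if "h \<in> H" for h
    using subsetD[OF ker that] by simp_all
  have "linear_lift K N f v = linear_lift K N f u" if v: "v \<in> H +>\<^bsub>F\<^esub> u" for v
  proof -
    obtain h where "h \<in> H" "v = h \<oplus>\<^bsub>F\<^esub> u" using v unfolding coset_mem_iff by blast
    then show ?thesis
      using zero[of h] assms(2) linear_maps_closed[OF lin] by (simp add: linear_maps_add[OF lin])
  qed
  then have "linear_lift K N f ` (H +>\<^bsub>F\<^esub> u) = (\<lambda>v. linear_lift K N f u) ` (H +>\<^bsub>F\<^esub> u)"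
    by (intro image_cong refl)
  also have "\<dots> = {linear_lift K N f u}"
    using coset_self[OF assms(2)] by (rule image_constant)
  finally have "the_elem (linear_lift K N f ` (H +>\<^bsub>F\<^esub> u)) = linear_lift K N f u"
    by simp
  then show ?thesis unfolding extend_linearly_def linear_lift_def[abs_def] .
qed

lemma extend_linearly_linear:
  assumes "compatible K X R N f"
  shows "extend_linearly K N f \<in> linear_maps K T N"
proof -
  have f: "f \<in> X \<rightarrow> carrier N" using assms by (simp add: compatible_def)
  note lin = linear_lift_linear[OF module_N f]
  show ?thesis
    by (rule linear_mapsI)
      (elim carrier_T_cases, simp add: coset_add coset_smult extend_linearly_coset[OF assms]
        linear_maps_closed[OF lin] linear_maps_add[OF lin] linear_maps_smult[OF lin])+
qed

lemma extend_linearly_generator: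
  assumes "compatible K X R N f" "x \<in> X"
  shows "extend_linearly K N f (\<gamma> x) = f x"
  using assms linear_lift_basis_vector[OF module_N, of f X x]
  by (simp add: generator_eq extend_linearly_coset basis_vector_closed cring_K compatible_def)

text \<open>In nested Sweedler sums the inner sum depends on the variables of the outer one, and the
  outer sum makes sense only if this dependence is linear. For a fixed \<open>t\<close> linear
  dependence on \<open>y\<close> is preserved by sums and multiples, so induction on
  \<open>t\<close> reduces it to the generators.\<close>

lemma extend_linearly_parameter:
  assumes Y: "module K Y"
    and resp: "\<And>y. y \<in> carrier Y \<Longrightarrow> compatible K X R N (f y)"
    and lin: "\<And>x. x \<in> X \<Longrightarrow> (\<lambda>y. f y x) \<in> linear_maps K Y N"
  shows "bilinear K Y T N (\<lambda>y. extend_linearly K N (f y))"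
proof (rule bilinearI)
  interpret Y: module K Y by fact
  note L = extend_linearly_linear[OF resp]
  show "extend_linearly K N (f y) \<in> linear_maps K T N" if "y \<in> carrier Y" for y
    using that by (rule L)
  fix t assume "t \<in> carrier T"
  then show "(\<lambda>y. extend_linearly K N (f y) t) \<in> linear_maps K Y N"
  proof (induction rule: presented_induct)
    case zero
    show ?case
      by (subst linear_maps_cong[OF Y, where g = "\<lambda>y. \<zero>\<^bsub>N\<^esub>"])
        (simp_all add: linear_maps_zero[OF module_T module_N L] linear_maps_const_zero[OF module_N])
  next
    case (add s t)
    then show ?case
      by (subst linear_maps_cong[OF Y, where g = "\<lambda>y. extend_linearly K N (f y) s \<oplus>\<^bsub>N\<^esub> extend_linearly K N (f y) t"])
        (simp_all add: linear_maps_add[OF L] linear_maps_plus[OF module_N])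
  next
    case (smult c t)
    then show ?case
      by (subst linear_maps_cong[OF Y, where g = "\<lambda>y. c \<odot>\<^bsub>N\<^esub> extend_linearly K N (f y) t"])
        (simp_all add: linear_maps_smult[OF L] linear_maps_scale[OF module_N])
  next
    case (generator x)
    then show ?case
      by (subst linear_maps_cong[OF Y, where g = "\<lambda>y. f y x"])
        (simp_all add: extend_linearly_generator[OF resp] lin)
  qed
qed

text \<open>Representatives are supported in \<open>X\<close>, so agreement on \<open>X\<close> is
  enough. This allows the raw expressions of the definitions, written with \<open>hd\<close>,
  \<open>tl\<close> or \<open>last\<close>, to be replaced before anything is known about their
  linearity.\<close>

lemma extend_linearly_cong:
  assumes "\<And>x. x \<in> X \<Longrightarrow> f x = g x" "\<And>x. x \<in> X \<Longrightarrow> g x \<in> carrier N" "t \<in> carrier T"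
  shows "extend_linearly K N f t = extend_linearly K N g t"
proof -
  have "t \<subseteq> carrier F"
    using assms(3) F.a_r_coset_subset_G[OF subset_H] by (auto simp: carrier_T)
  then have u: "u x \<in> carrier K" "u x \<noteq> \<zero>\<^bsub>K\<^esub> \<Longrightarrow> x \<in> X" if "u \<in> t" for u x
    using that unfolding free_module_def by auto
  have "linear_lift K N f u = linear_lift K N g u" if "u \<in> t" for u
    unfolding linear_lift_def using u[OF that] assms(1,2)
    by (intro N.finsum_cong') auto
  then have "linear_lift K N f ` t = linear_lift K N g ` t"
    by (intro image_cong refl)
  then show ?thesis unfolding extend_linearly_def linear_lift_def[abs_def] by (rule arg_cong)
qed

end

end


subsection \<open>Relations of multilinearity\<close>

lemma slot_relations_closed:
  assumes "cring K" "module K M" "g \<in> carrier M \<rightarrow> X"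
  shows "slot_relations K X M g \<subseteq> carrier (free_module K X)"
proof -
  interpret M: module K M by fact
  interpret F: module K "free_module K X" by (rule module_free_module) fact
  have "basis_vector K (g m) \<in> carrier (free_module K X)" if "m \<in> carrier M" for m
    using basis_vector_closed[OF assms(1), of "g m" X] assms(3) that by blast
  then show ?thesis by (auto simp: slot_relations_def)
qed

text \<open>The lift sends a slot relator to the defect of additivity or homogeneity of
  \<open>f\<close> in that slot.\<close>

lemma linear_lift_slot_relations:
  assumes "module K M" "module K N" "f \<in> X \<rightarrow> carrier N" "g \<in> carrier M \<rightarrow> X"
    and lin: "(\<lambda>m. f (g m)) \<in> linear_maps K M N" and r: "r \<in> slot_relations K X M g"
  shows "linear_lift K N f r = \<zero>\<^bsub>N\<^esub>"
proof -
  let ?F = "free_module K X"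
  interpret M: module K M by fact
  interpret N: module K N by fact
  interpret F: module K ?F by (rule module_free_module) (rule M.R.is_cring)
  have b: "basis_vector K (g m) \<in> carrier ?F" "linear_lift K N f (basis_vector K (g m)) = f (g m)"
    if "m \<in> carrier M" for m
    using basis_vector_closed[OF M.R.is_cring, of "g m" X]
      linear_lift_basis_vector[OF assms(2,3), of "g m"] assms(4) that by blast+
  note L = linear_lift_linear[OF assms(2,3)]
  note lifts = linear_maps_minus[OF F.module_axioms assms(2) L] linear_maps_add[OF L] linear_maps_smult[OF L]
  show ?thesis
    using r linear_maps_closed[OF lin]
    by (auto simp: slot_relations_def lifts b linear_maps_add[OF lin] linear_maps_smult[OF lin]
        N.r_neg a_minus_def[of N])
qed

context presentation
begin

lemma coset_eq_of_difference:
  assumes "u \<in> carrier F" "v \<in> carrier F" "u \<ominus>\<^bsub>F\<^esub> v \<in> R"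
  shows "H +>\<^bsub>F\<^esub> u = H +>\<^bsub>F\<^esub> v"
proof (rule coset_eqI)
  have "u \<ominus>\<^bsub>F\<^esub> v \<in> H" using subsetD[OF submodule_span_contains assms(3)] .
  moreover have "u = (u \<ominus>\<^bsub>F\<^esub> v) \<oplus>\<^bsub>F\<^esub> v"
    using assms(1,2) by (simp add: a_minus_def F.a_assoc F.l_neg)
  ultimately show "u \<in> H +>\<^bsub>F\<^esub> v" unfolding coset_mem_iff by blast
qed fact

lemma generator_eqI:
  assumes "x \<in> X" "y \<in> X" "basis_vector K x \<ominus>\<^bsub>F\<^esub> basis_vector K y \<in> R"
  shows "\<gamma> x = \<gamma> y"
  unfolding generator_eq using assms
  by (intro coset_eq_of_difference) (simp_all add: basis_vector_closed cring_K)

text \<open>Conversely, imposing the slot relators is what makes the generators themselves depend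
  linearly on the slot.\<close>

lemma generator_slot_linear:
  assumes "module K M" "g \<in> carrier M \<rightarrow> X" "slot_relations K X M g \<subseteq> R"
  shows "(\<lambda>m. \<gamma> (g m)) \<in> linear_maps K M T"
proof -
  interpret M: module K M by fact
  have g: "g m \<in> X" if "m \<in> carrier M" for m using assms(2) that by blast
  have b: "basis_vector K (g m) \<in> carrier F" if "m \<in> carrier M" for m
    by (rule basis_vector_closed[OF cring_K g[OF that]])
  show ?thesis
  proof (rule linear_mapsI)
    fix x y assume xy: "x \<in> carrier M" "y \<in> carrier M"
    have "\<gamma> (g (x \<oplus>\<^bsub>M\<^esub> y)) = H +>\<^bsub>F\<^esub> (basis_vector K (g x) \<oplus>\<^bsub>F\<^esub> basis_vector K (g y))"
      unfolding generator_eq using assms(3) xy b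
      by (intro coset_eq_of_difference) (auto simp: slot_relations_def)
    then show "\<gamma> (g (x \<oplus>\<^bsub>M\<^esub> y)) = \<gamma> (g x) \<oplus>\<^bsub>T\<^esub> \<gamma> (g y)"
      using xy b by (simp add: generator_eq coset_add)
  next
    fix c x assume cx: "c \<in> carrier K" "x \<in> carrier M"
    have "basis_vector K (g (c \<odot>\<^bsub>M\<^esub> x)) \<ominus>\<^bsub>F\<^esub> (c \<odot>\<^bsub>F\<^esub> basis_vector K (g x)) \<in> slot_relations K X M g"
      unfolding slot_relations_def using cx by blast
    then have "\<gamma> (g (c \<odot>\<^bsub>M\<^esub> x)) = H +>\<^bsub>F\<^esub> (c \<odot>\<^bsub>F\<^esub> basis_vector K (g x))"
      unfolding generator_eq using cx b by (intro coset_eq_of_difference subsetD[OF assms(3)]) simp_all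
    then show "\<gamma> (g (c \<odot>\<^bsub>M\<^esub> x)) = c \<odot>\<^bsub>T\<^esub> \<gamma> (g x)"
      using cx b by (simp add: generator_eq coset_smult)
  qed (simp add: generator_closed g)
qed

end


subsection \<open>Tensor products\<close>

locale tensor_product =
  fixes K :: "'k ring" and M :: "('k, 'm) module" and N :: "('k, 'n) module"
  assumes module_M: "module K M" and module_N: "module K N"
begin

interpretation M: module K M by (rule module_M)
interpretation N: module K N by (rule module_N)

abbreviation "W \<equiv> tensor K M N"
abbreviation "pure \<equiv> pure_tensor K M N"

lemma presentation: "presentation K (carrier M \<times> carrier N) (tensor_relations K M N)"
proof (rule presentation.intro)
  show "tensor_relations K M N \<subseteq> carrier (free_module K (carrier M \<times> carrier N))"
    unfolding tensor_relations_def
    by (intro Un_least UN_least slot_relations_closed[OF M.R.is_cring] module_M module_N) auto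
qed (rule M.R.is_cring)

interpretation presentation K "carrier M \<times> carrier N" "tensor_relations K M N"
  rewrites "presented_module K (carrier M \<times> carrier N) (tensor_relations K M N) = W"
    and "generator K (carrier M \<times> carrier N) (tensor_relations K M N) = (\<lambda>(m, n). pure m n)"
  by (rule presentation) (simp_all add: tensor_def pure_tensor_def fun_eq_iff)

lemma module_tensor: "module K W"
  by (rule module_T)

lemma pure_tensor_bilinear: "bilinear K M N W pure"
proof (rule bilinearI)
  fix m assume "m \<in> carrier M"
  then show "pure m \<in> linear_maps K N W"
    using generator_slot_linear[OF module_N, of "\<lambda>n. (m, n)"] by (auto simp: tensor_relations_def)
next
  fix n assume "n \<in> carrier N"
  then show "(\<lambda>m. pure m n) \<in> linear_maps K M W"
    using generator_slot_linear[OF module_M, of "\<lambda>m. (m, n)"] by (auto simp: tensor_relations_def)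
qed

lemmas pure_tensor_closed = bilinear_closed[OF pure_tensor_bilinear]

lemma tensor_induct [consumes 1, case_names zero add smult pure]:
  assumes "t \<in> carrier W"
    and "P \<zero>\<^bsub>W\<^esub>"
    and "\<And>s t. s \<in> carrier W \<Longrightarrow> t \<in> carrier W \<Longrightarrow> P s \<Longrightarrow> P t \<Longrightarrow> P (s \<oplus>\<^bsub>W\<^esub> t)"
    and "\<And>c t. c \<in> carrier K \<Longrightarrow> t \<in> carrier W \<Longrightarrow> P t \<Longrightarrow> P (c \<odot>\<^bsub>W\<^esub> t)"
    and "\<And>m n. m \<in> carrier M \<Longrightarrow> n \<in> carrier N \<Longrightarrow> P (pure m n)"
  shows "P t"
  by (rule presented_induct[OF assms(1)]) (use assms in auto)

lemma tensor_eqI: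
  assumes "module K P" "f \<in> linear_maps K W P" "g \<in> linear_maps K W P"
    and "\<And>m n. m \<in> carrier M \<Longrightarrow> n \<in> carrier N \<Longrightarrow> f (pure m n) = g (pure m n)"
    and "t \<in> carrier W"
  shows "f t = g t"
  by (rule linear_maps_eqI[OF assms(1-3) _ assms(5)]) (use assms(4) in auto)

context
  fixes P :: "('k, 'p) module"
  assumes module_P: "module K P"
begin

lemma compatible_tensor:
  assumes "bilinear K M N P f"
  shows "compatible K (carrier M \<times> carrier N) (tensor_relations K M N) P (\<lambda>(m, n). f m n)"
proof -
  have f: "(\<lambda>(m, n). f m n) \<in> carrier M \<times> carrier N \<rightarrow> carrier P"
    using bilinear_closed[OF assms] by auto
  show ?thesis
    unfolding compatible_def
  proof (intro conjI ballI f)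
    fix r assume "r \<in> tensor_relations K M N"
    then consider (left) n where "n \<in> carrier N"
        "r \<in> slot_relations K (carrier M \<times> carrier N) M (\<lambda>m. (m, n))"
      | (right) m where "m \<in> carrier M"
        "r \<in> slot_relations K (carrier M \<times> carrier N) N (\<lambda>n. (m, n))"
      unfolding tensor_relations_def by blast
    then show "linear_lift K P (\<lambda>(m, n). f m n) r = \<zero>\<^bsub>P\<^esub>"
    proof cases
      case left
      then show ?thesis using bilinear_left[OF assms left(1)]
        by (intro linear_lift_slot_relations[OF module_M module_P f _ _ left(2)]) auto
    next
      case right
      then show ?thesis using bilinear_right[OF assms right(1)]
        by (intro linear_lift_slot_relations[OF module_N module_P f _ _ right(2)]) auto
    qed
  qed
qed

lemma tensor_extend_linear:
  "bilinear K M N P f \<Longrightarrow> extend_linearly K P (\<lambda>(m, n). f m n) \<in> linear_maps K W P"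
  by (rule extend_linearly_linear[OF module_P compatible_tensor])

lemma tensor_extend_pure:
  "bilinear K M N P f \<Longrightarrow> m \<in> carrier M \<Longrightarrow> n \<in> carrier N \<Longrightarrow>
    extend_linearly K P (\<lambda>(m, n). f m n) (pure m n) = f m n"
  using extend_linearly_generator[OF module_P compatible_tensor, of f "(m, n)"] by simp

lemma tensor_extend_parameter:
  assumes "module K Y" "\<And>y. y \<in> carrier Y \<Longrightarrow> bilinear K M N P (f y)"
    and "\<And>m n. m \<in> carrier M \<Longrightarrow> n \<in> carrier N \<Longrightarrow> (\<lambda>y. f y m n) \<in> linear_maps K Y P"
  shows "bilinear K Y W P (\<lambda>y. extend_linearly K P (\<lambda>(m, n). f y m n))"
  by (rule extend_linearly_parameter[OF module_P assms(1) compatible_tensor])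
    (use assms(2,3) in auto)

lemma tensor_extend_cong:
  assumes "\<And>m n. m \<in> carrier M \<Longrightarrow> n \<in> carrier N \<Longrightarrow> f m n = g m n"
    and "\<And>m n. m \<in> carrier M \<Longrightarrow> n \<in> carrier N \<Longrightarrow> g m n \<in> carrier P" "t \<in> carrier W"
  shows "extend_linearly K P (\<lambda>(m, n). f m n) t = extend_linearly K P (\<lambda>(m, n). g m n) t"
  by (rule extend_linearly_cong[OF module_P]) (use assms in auto)

end

end


subsection \<open>Tensor powers\<close>

lemma tuples_0: "tuples M 0 = {[]}"
  by (auto simp: tuples_def)

lemma tuples_Suc: "tuples M (Suc n) = (\<lambda>(m, ms). m # ms) ` (carrier M \<times> tuples M n)"
  by (force simp: tuples_def length_Suc_conv)

lemma tuples_Cons: "m # ms \<in> tuples M (Suc n) \<longleftrightarrow> m \<in> carrier M \<and> ms \<in> tuples M n"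
  by (auto simp: tuples_def)

lemma tuples_update: "ms \<in> tuples M n \<Longrightarrow> m \<in> carrier M \<Longrightarrow> ms[i := m] \<in> tuples M n"
  by (auto simp: tuples_def dest: subsetD[OF set_update_subset_insert])

lemma tuples_length: "ms \<in> tuples M n \<Longrightarrow> length ms = n"
  by (simp add: tuples_def)

lemma tuples_nth: "ms \<in> tuples M n \<Longrightarrow> i < n \<Longrightarrow> ms ! i \<in> carrier M"
  by (auto simp: tuples_def)

text \<open>Slots are addressed by list update, as in the relators of \<open>power_tensor\<close>;
  the entry of the tuple at the updated index is a mere placeholder.\<close>

definition multilinear :: "'k ring \<Rightarrow> ('k, 'a) module \<Rightarrow> ('k, 'b) module \<Rightarrow> nat \<Rightarrow>
    ('k, 'n) module \<Rightarrow> ('a list \<Rightarrow> 'b \<Rightarrow> 'n) \<Rightarrow> bool" where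
  "multilinear K A B n N f \<longleftrightarrow>
     (\<forall>as\<in>tuples A n. \<forall>b\<in>carrier B. \<forall>i<n. (\<lambda>a. f (as[i := a]) b) \<in> linear_maps K A N) \<and>
     (\<forall>as\<in>tuples A n. f as \<in> linear_maps K B N)"

lemma multilinear_slot: "multilinear K A B n N f \<Longrightarrow> as \<in> tuples A n \<Longrightarrow> b \<in> carrier B \<Longrightarrow> i < n \<Longrightarrow>
    (\<lambda>a. f (as[i := a]) b) \<in> linear_maps K A N"
  and multilinear_last: "multilinear K A B n N f \<Longrightarrow> as \<in> tuples A n \<Longrightarrow> f as \<in> linear_maps K B N"
  by (simp_all add: multilinear_def)

lemma multilinear_closed:
  "multilinear K A B n N f \<Longrightarrow> as \<in> tuples A n \<Longrightarrow> b \<in> carrier B \<Longrightarrow> f as b \<in> carrier N"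
  using multilinear_last by (rule linear_maps_closed)

lemma multilinear_0I: "f [] \<in> linear_maps K B N \<Longrightarrow> multilinear K A B 0 N f"
  by (simp add: multilinear_def tuples_0)

text \<open>Recursive definitions on lists expose the head, so the conditions are split into slot 0
  and the slots of the tail.\<close>

lemma multilinear_SucI:
  assumes "\<And>a. a \<in> carrier A \<Longrightarrow> multilinear K A B n N (\<lambda>as. f (a # as))"
    and "\<And>as b. as \<in> tuples A n \<Longrightarrow> b \<in> carrier B \<Longrightarrow> (\<lambda>a. f (a # as) b) \<in> linear_maps K A N"
  shows "multilinear K A B (Suc n) N f"
  unfolding multilinear_def
proof (intro conjI ballI allI impI)
  fix as b i assume as: "as \<in> tuples A (Suc n)" and b: "b \<in> carrier B" and i: "i < Suc n"
  then obtain a as' where a: "as = a # as'" "a \<in> carrier A" "as' \<in> tuples A n" by (auto simp: tuples_Suc)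
  show "(\<lambda>a. f (as[i := a]) b) \<in> linear_maps K A N"
    using a assms(2)[OF a(3) b] multilinear_slot[OF assms(1)[OF a(2)] a(3) b] i by (cases i) auto
next
  fix as assume "as \<in> tuples A (Suc n)"
  then show "f as \<in> linear_maps K B N"
    using multilinear_last[OF assms(1)] by (auto simp: tuples_Suc)
qed

lemma multilinear_compose:
  assumes "multilinear K A B n N f" "g \<in> linear_maps K N P"
  shows "multilinear K A B n P (\<lambda>as b. g (f as b))"
  unfolding multilinear_def
  by (intro conjI ballI allI impI linear_maps_comp[OF multilinear_slot[OF assms(1)] assms(2)]
      linear_maps_comp[OF multilinear_last[OF assms(1)] assms(2)])

locale tensor_power =
  fixes K :: "'k ring" and A :: "('k, 'a) module" and B :: "('k, 'b) module"
  assumes module_A: "module K A" and module_B: "module K B"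
begin

interpretation A: module K A by (rule module_A)
interpretation B: module K B by (rule module_B)

abbreviation "Q \<equiv> power_tensor K A B"
abbreviation "pp \<equiv> pure_power_tensor K A B"

lemma power_presentation: "presentation K (tuples A n \<times> carrier B) (power_tensor_relations K A B n)"
proof (rule presentation.intro)
  show "power_tensor_relations K A B n \<subseteq> carrier (free_module K (tuples A n \<times> carrier B))"
    unfolding power_tensor_relations_def
    by (intro Un_least UN_least slot_relations_closed[OF A.R.is_cring] module_A module_B)
      (auto simp: tuples_update)
qed (rule A.R.is_cring)

text \<open>\<open>pure_power_tensor\<close> reads the number of factors off the list, so it matches
  the degree-n generator only for lists of length n.\<close>

lemma generator_power:
  "as \<in> tuples A n \<Longrightarrow> generator K (tuples A n \<times> carrier B) (power_tensor_relations K A B n) (as, b) = pp as b"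
  by (auto simp: pure_power_tensor_def tuples_def)

context
  fixes n :: nat
begin

interpretation presentation K "tuples A n \<times> carrier B" "power_tensor_relations K A B n"
  rewrites "presented_module K (tuples A n \<times> carrier B) (power_tensor_relations K A B n) = Q n"
  by (rule power_presentation) (simp add: power_tensor_def)

lemma module_power_tensor: "module K (Q n)"
  by (rule module_T)

lemma pure_power_multilinear: "multilinear K A B n (Q n) pp"
  unfolding multilinear_def
proof (intro conjI ballI allI impI)
  fix as b i assume as: "as \<in> tuples A n" and b: "b \<in> carrier B" and i: "i < n"
  have "(\<lambda>a. \<gamma> (as[i := a], b)) \<in> linear_maps K A (Q n)"
    by (rule generator_slot_linear[OF module_A])
      (use as b i in \<open>auto simp: tuples_update power_tensor_relations_def\<close>)
  then show "(\<lambda>a. pp (as[i := a]) b) \<in> linear_maps K A (Q n)"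
    by (subst linear_maps_cong[OF module_A, where g = "\<lambda>a. \<gamma> (as[i := a], b)"])
      (use as in \<open>simp_all add: generator_power tuples_update\<close>)
next
  fix as assume as: "as \<in> tuples A n"
  have "(\<lambda>b. \<gamma> (as, b)) \<in> linear_maps K B (Q n)"
    by (rule generator_slot_linear[OF module_B])
      (use as in \<open>auto simp: tuples_update power_tensor_relations_def\<close>)
  then show "pp as \<in> linear_maps K B (Q n)"
    by (simp add: generator_power[OF as])
qed

lemmas pure_power_closed = multilinear_closed[OF pure_power_multilinear]

lemma power_eqI:
  assumes "module K N" "f \<in> linear_maps K (Q n) N" "g \<in> linear_maps K (Q n) N"
    and "\<And>as b. as \<in> tuples A n \<Longrightarrow> b \<in> carrier B \<Longrightarrow> f (pp as b) = g (pp as b)"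
    and "q \<in> carrier (Q n)"
  shows "f q = g q"
  by (rule linear_maps_eqI[OF assms(1-3) _ assms(5)]) (use assms(4) in \<open>auto simp: generator_power\<close>)

context
  fixes N :: "('k, 'n) module"
  assumes module_N: "module K N"
begin

lemma compatible_power:
  assumes "multilinear K A B n N f"
  shows "compatible K (tuples A n \<times> carrier B) (power_tensor_relations K A B n) N (\<lambda>(as, b). f as b)"
proof -
  have f: "(\<lambda>(as, b). f as b) \<in> tuples A n \<times> carrier B \<rightarrow> carrier N"
    using multilinear_closed[OF assms] by auto
  show ?thesis
    unfolding compatible_def
  proof (intro conjI ballI f)
    fix r assume "r \<in> power_tensor_relations K A B n"
    then consider (slot) as b i where "as \<in> tuples A n" "b \<in> carrier B" "i < n"
        "r \<in> slot_relations K (tuples A n \<times> carrier B) A (\<lambda>a. (as[i := a], b))"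
      | (last) as where "as \<in> tuples A n"
        "r \<in> slot_relations K (tuples A n \<times> carrier B) B (\<lambda>b. (as, b))"
      unfolding power_tensor_relations_def by blast
    then show "linear_lift K N (\<lambda>(as, b). f as b) r = \<zero>\<^bsub>N\<^esub>"
    proof cases
      case slot
      then show ?thesis using multilinear_slot[OF assms slot(1-3)]
        by (intro linear_lift_slot_relations[OF module_A module_N f _ _ slot(4)]) (auto simp: tuples_update)
    next
      case last
      then show ?thesis using multilinear_last[OF assms last(1)]
        by (intro linear_lift_slot_relations[OF module_B module_N f _ _ last(2)]) auto
    qed
  qed
qed

lemma power_extend_linear:
  "multilinear K A B n N f \<Longrightarrow> extend_linearly K N (\<lambda>(as, b). f as b) \<in> linear_maps K (Q n) N"
  by (rule extend_linearly_linear[OF module_N compatible_power])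

lemma power_extend_pure:
  "multilinear K A B n N f \<Longrightarrow> as \<in> tuples A n \<Longrightarrow> b \<in> carrier B \<Longrightarrow>
    extend_linearly K N (\<lambda>(as, b). f as b) (pp as b) = f as b"
  using extend_linearly_generator[OF module_N compatible_power, of f "(as, b)"]
  by (simp add: generator_power)

lemma power_extend_parameter:
  assumes "module K Y" "\<And>y. y \<in> carrier Y \<Longrightarrow> multilinear K A B n N (f y)"
    and "\<And>as b. as \<in> tuples A n \<Longrightarrow> b \<in> carrier B \<Longrightarrow> (\<lambda>y. f y as b) \<in> linear_maps K Y N"
  shows "bilinear K Y (Q n) N (\<lambda>y. extend_linearly K N (\<lambda>(as, b). f y as b))"
  by (rule extend_linearly_parameter[OF module_N assms(1) compatible_power])
    (use assms(2,3) in auto)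

lemma power_extend_cong:
  assumes "\<And>as b. as \<in> tuples A n \<Longrightarrow> b \<in> carrier B \<Longrightarrow> f as b = g as b"
    and "\<And>as b. as \<in> tuples A n \<Longrightarrow> b \<in> carrier B \<Longrightarrow> g as b \<in> carrier N" "t \<in> carrier (Q n)"
  shows "extend_linearly K N (\<lambda>(as, b). f as b) t = extend_linearly K N (\<lambda>(as, b). g as b) t"
  by (rule extend_linearly_cong[OF module_N]) (use assms in auto)

end

end

end


subsection \<open>Balanced powers\<close>

text \<open>Membership of the values in the carrier is a clause of its own because for n = 0 there
  is no slot whose linearity could imply it.\<close>

definition balanced_multilinear :: "'k ring \<Rightarrow> ('k, 'b) module \<Rightarrow> ('k, 'b, 'b, 'm) bimod \<Rightarrow> nat \<Rightarrow>
    ('k, 'n) module \<Rightarrow> ('m list \<Rightarrow> 'n) \<Rightarrow> bool" where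
  "balanced_multilinear K B P n N f \<longleftrightarrow>
     f \<in> tuples (space P) n \<rightarrow> carrier N \<and>
     (\<forall>ms\<in>tuples (space P) n. \<forall>i<n. (\<lambda>m. f (ms[i := m])) \<in> linear_maps K (space P) N) \<and>
     (\<forall>ms\<in>tuples (space P) n. \<forall>i p b q. Suc i < n \<longrightarrow> p \<in> carrier (space P) \<longrightarrow> b \<in> carrier B \<longrightarrow>
        q \<in> carrier (space P) \<longrightarrow> f (ms[i := ract P p b, Suc i := q]) = f (ms[i := p, Suc i := lact P b q]))"

lemma balanced_multilinear_slot:
    "balanced_multilinear K B P n N f \<Longrightarrow> ms \<in> tuples (space P) n \<Longrightarrow> i < n \<Longrightarrow>
     (\<lambda>m. f (ms[i := m])) \<in> linear_maps K (space P) N"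
  and balanced_multilinear_swap:
    "balanced_multilinear K B P n N f \<Longrightarrow> ms \<in> tuples (space P) n \<Longrightarrow> Suc i < n \<Longrightarrow>
     p \<in> carrier (space P) \<Longrightarrow> b \<in> carrier B \<Longrightarrow> q \<in> carrier (space P) \<Longrightarrow>
     f (ms[i := ract P p b, Suc i := q]) = f (ms[i := p, Suc i := lact P b q])"
  and balanced_multilinear_closed:
    "balanced_multilinear K B P n N f \<Longrightarrow> ms \<in> tuples (space P) n \<Longrightarrow> f ms \<in> carrier N"
  by (auto simp: balanced_multilinear_def)

text \<open>Closure of the two actions places the balancing relators in the free module, which is
  what \<open>presentation\<close> asks for.\<close>

locale balanced =
  fixes K :: "'k ring" and B :: "('k, 'b) module" and P :: "('k, 'b, 'b, 'm) bimod"
  assumes module_space: "module K (space P)"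
    and lact_closed: "b \<in> carrier B \<Longrightarrow> p \<in> carrier (space P) \<Longrightarrow> lact P b p \<in> carrier (space P)"
    and ract_closed: "b \<in> carrier B \<Longrightarrow> p \<in> carrier (space P) \<Longrightarrow> ract P p b \<in> carrier (space P)"
begin

interpretation M: module K "space P" by (rule module_space)

abbreviation "BP \<equiv> balanced_power K B P"
abbreviation "pb \<equiv> pure_balanced K B P"

lemma balanced_presentation:
  "presentation K (tuples (space P) n) (balanced_power_relations K B P n)"
proof (rule presentation.intro)
  interpret F: module K "free_module K (tuples (space P) n)"
    by (rule module_free_module) (rule M.R.is_cring)
  have "(\<Union>ms\<in>tuples (space P) n. \<Union>i\<in>{..<n}. slot_relations K (tuples (space P) n) (space P) (\<lambda>m. ms[i := m]))
      \<subseteq> carrier (free_module K (tuples (space P) n))"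
    by (intro UN_least slot_relations_closed[OF M.R.is_cring] module_space) (auto simp: tuples_update)
  then show "balanced_power_relations K B P n \<subseteq> carrier (free_module K (tuples (space P) n))"
    unfolding balanced_power_relations_def
    by (auto intro!: F.minus_closed basis_vector_closed[OF M.R.is_cring] tuples_update lact_closed ract_closed)
qed (rule M.R.is_cring)

lemma generator_balanced:
  "ms \<in> tuples (space P) n \<Longrightarrow> generator K (tuples (space P) n) (balanced_power_relations K B P n) ms = pb ms"
  by (auto simp: pure_balanced_def tuples_def)

context
  fixes n :: nat
begin

interpretation presentation K "tuples (space P) n" "balanced_power_relations K B P n"
  rewrites "presented_module K (tuples (space P) n) (balanced_power_relations K B P n) = BP n"
  by (rule balanced_presentation) (simp add: balanced_power_def)

lemma module_balanced_power: "module K (BP n)"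
  by (rule module_T)

lemma pure_balanced_multilinear: "balanced_multilinear K B P n (BP n) pb"
  unfolding balanced_multilinear_def
proof (intro conjI ballI allI impI)
  show "pb \<in> tuples (space P) n \<rightarrow> carrier (BP n)"
    using generator_closed by (auto simp: generator_balanced)
next
  fix ms i assume ms: "ms \<in> tuples (space P) n" and i: "i < n"
  have "(\<lambda>m. \<gamma> (ms[i := m])) \<in> linear_maps K (space P) (BP n)"
    by (rule generator_slot_linear[OF module_space])
      (use ms i in \<open>auto simp: tuples_update balanced_power_relations_def\<close>)
  then show "(\<lambda>m. pb (ms[i := m])) \<in> linear_maps K (space P) (BP n)"
    by (subst linear_maps_cong[OF module_space, where g = "\<lambda>m. \<gamma> (ms[i := m])"])
      (use ms in \<open>simp_all add: generator_balanced tuples_update\<close>)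
next
  fix ms i p b q
  assume h: "ms \<in> tuples (space P) n" "Suc i < n" "p \<in> carrier (space P)" "b \<in> carrier B"
    "q \<in> carrier (space P)"
  have "\<gamma> (ms[i := ract P p b, Suc i := q]) = \<gamma> (ms[i := p, Suc i := lact P b q])"
    using h by (intro generator_eqI tuples_update lact_closed ract_closed)
      (auto simp: balanced_power_relations_def)
  then show "pb (ms[i := ract P p b, Suc i := q]) = pb (ms[i := p, Suc i := lact P b q])"
    using h by (simp add: generator_balanced tuples_update lact_closed ract_closed)
qed

lemma balanced_eqI:
  assumes "module K N" "f \<in> linear_maps K (BP n) N" "g \<in> linear_maps K (BP n) N"
    and "\<And>ms. ms \<in> tuples (space P) n \<Longrightarrow> f (pb ms) = g (pb ms)"
    and "t \<in> carrier (BP n)"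
  shows "f t = g t"
  by (rule linear_maps_eqI[OF assms(1-3) _ assms(5)]) (use assms(4) in \<open>auto simp: generator_balanced\<close>)

lemma balanced_subset:
  assumes "submodule U K (BP n)" "\<And>ms. ms \<in> tuples (space P) n \<Longrightarrow> pb ms \<in> U"
  shows "carrier (BP n) \<subseteq> U"
  using assms by (intro presented_subset) (auto simp: generator_balanced)

context
  fixes N :: "('k, 'n) module"
  assumes module_N: "module K N"
begin

lemma compatible_balanced:
  assumes "balanced_multilinear K B P n N f"
  shows "compatible K (tuples (space P) n) (balanced_power_relations K B P n) N f"
proof -
  interpret N: module K N by (rule module_N)
  have f: "f \<in> tuples (space P) n \<rightarrow> carrier N"
    using assms by (simp add: balanced_multilinear_def)
  note L = linear_lift_linear[OF module_N f]
  have diff: "linear_lift K N f (basis_vector K ms \<ominus>\<^bsub>F\<^esub> basis_vector K ms') = \<zero>\<^bsub>N\<^esub>"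
    if "ms \<in> tuples (space P) n" "ms' \<in> tuples (space P) n" "f ms = f ms'" for ms ms'
    using that balanced_multilinear_closed[OF assms that(2)]
    by (simp add: linear_maps_minus[OF F.module_axioms module_N L] basis_vector_closed[OF cring_K]
        linear_lift_basis_vector[OF module_N f] a_minus_def[of N] N.r_neg)
  show ?thesis
    unfolding compatible_def
  proof (intro conjI ballI f)
    fix r assume "r \<in> balanced_power_relations K B P n"
    then consider (slot) ms i where "ms \<in> tuples (space P) n" "i < n"
        "r \<in> slot_relations K (tuples (space P) n) (space P) (\<lambda>m. ms[i := m])"
      | (swap) ms i p b q where "ms \<in> tuples (space P) n" "Suc i < n" "p \<in> carrier (space P)"
        "b \<in> carrier B" "q \<in> carrier (space P)"
        "r = basis_vector K (ms[i := ract P p b, Suc i := q])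
          \<ominus>\<^bsub>F\<^esub> basis_vector K (ms[i := p, Suc i := lact P b q])"
      unfolding balanced_power_relations_def by blast
    then show "linear_lift K N f r = \<zero>\<^bsub>N\<^esub>"
    proof cases
      case slot
      then show ?thesis using balanced_multilinear_slot[OF assms slot(1,2)]
        by (intro linear_lift_slot_relations[OF module_space module_N f _ _ slot(3)]) (auto simp: tuples_update)
    next
      case swap
      then show ?thesis using balanced_multilinear_swap[OF assms swap(1-5)] unfolding swap(6)
        by (intro diff) (simp_all add: tuples_update lact_closed ract_closed)
    qed
  qed
qed

lemma balanced_extend_linear:
  "balanced_multilinear K B P n N f \<Longrightarrow> extend_linearly K N f \<in> linear_maps K (BP n) N"
  by (rule extend_linearly_linear[OF module_N compatible_balanced])

lemma balanced_extend_pure: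
  "balanced_multilinear K B P n N f \<Longrightarrow> ms \<in> tuples (space P) n \<Longrightarrow> extend_linearly K N f (pb ms) = f ms"
  using extend_linearly_generator[OF module_N compatible_balanced, of f ms]
  by (simp add: generator_balanced)

lemma balanced_extend_parameter:
  assumes "module K Y" "\<And>y. y \<in> carrier Y \<Longrightarrow> balanced_multilinear K B P n N (f y)"
    and "\<And>ms. ms \<in> tuples (space P) n \<Longrightarrow> (\<lambda>y. f y ms) \<in> linear_maps K Y N"
  shows "bilinear K Y (BP n) N (\<lambda>y. extend_linearly K N (f y))"
  by (rule extend_linearly_parameter[OF module_N assms(1) compatible_balanced])
    (use assms(2,3) in auto)

lemma balanced_extend_cong:
  assumes "\<And>ms. ms \<in> tuples (space P) n \<Longrightarrow> f ms = g ms"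
    and "\<And>ms. ms \<in> tuples (space P) n \<Longrightarrow> g ms \<in> carrier N" "t \<in> carrier (BP n)"
  shows "extend_linearly K N f t = extend_linearly K N g t"
  by (rule extend_linearly_cong[OF module_N]) (use assms in auto)

end

end

end


section \<open>Calculus of bilinear maps\<close>

lemma bilinear_compose:
  assumes "bilinear K M N P f" "g \<in> linear_maps K P R"
  shows "bilinear K M N R (\<lambda>x y. g (f x y))"
  by (rule bilinearI)
    (rule linear_maps_comp[OF bilinear_right[OF assms(1)] assms(2)], assumption,
     rule linear_maps_comp[OF bilinear_left[OF assms(1)] assms(2)], assumption)

lemma bilinear_flip: "bilinear K M N P f \<Longrightarrow> bilinear K N M P (\<lambda>y x. f x y)"
  by (simp add: bilinear_def)

lemma bilinear_comp_left:
  assumes "bilinear K M N P f" "g \<in> linear_maps K M' M"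
  shows "bilinear K M' N P (\<lambda>x y. f (g x) y)"
proof (rule bilinearI)
  fix x assume "x \<in> carrier M'"
  then show "f (g x) \<in> linear_maps K N P"
    using bilinear_right[OF assms(1)] linear_maps_closed[OF assms(2)] by blast
next
  fix y assume "y \<in> carrier N"
  show "(\<lambda>x. f (g x) y) \<in> linear_maps K M' P"
    by (rule linear_maps_comp[OF assms(2) bilinear_left[OF assms(1)]]) fact
qed

lemma bilinear_comp_right:
  assumes "bilinear K M N P f" "g \<in> linear_maps K N' N"
  shows "bilinear K M N' P (\<lambda>x y. f x (g y))"
  using bilinear_flip[OF bilinear_comp_left[OF bilinear_flip[OF assms(1)] assms(2)]] .

lemma bilinear_cong:
  assumes "module K M" "module K N" "\<And>x y. x \<in> carrier M \<Longrightarrow> y \<in> carrier N \<Longrightarrow> f x y = g x y"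
    and "bilinear K M N P g"
  shows "bilinear K M N P f"
proof (rule bilinearI)
  fix x assume x: "x \<in> carrier M"
  show "f x \<in> linear_maps K N P"
    by (subst linear_maps_cong[OF assms(2), where g = "g x"])
      (use assms(3) x bilinear_right[OF assms(4)] in auto)
next
  fix y assume y: "y \<in> carrier N"
  show "(\<lambda>x. f x y) \<in> linear_maps K M P"
    by (subst linear_maps_cong[OF assms(1), where g = "\<lambda>x. g x y"])
      (use assms(3) y bilinear_left[OF assms(4)] in auto)
qed

lemma assoc_algebra_mult_bilinear:
  assumes "assoc_algebra K A"
  shows "bilinear K A A A (mult A)"
proof -
  interpret ring A using assms by (simp add: assoc_algebra_def)
  show ?thesis
    using assms unfolding assoc_algebra_def
    by (intro bilinearI linear_mapsI) (simp_all add: l_distr r_distr)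
qed


section \<open>The factorisation algebra\<close>

locale factorisation_setup =
  fixes K :: "'k ring" and A :: "('k, 'a) module" and B :: "('k, 'b) module"
    and \<psi> :: "('b \<times> 'a \<Rightarrow> 'k) set \<Rightarrow> ('a \<times> 'b \<Rightarrow> 'k) set"
  assumes algebra_A: "assoc_algebra K A" and algebra_B: "assoc_algebra K B"
    and factorisation: "factorisation K A B \<psi>"
begin

lemma module_A: "module K A" and module_B: "module K B"
  using algebra_A algebra_B by (simp_all add: assoc_algebra_def)

sublocale A: ring A using algebra_A by (simp add: assoc_algebra_def)
sublocale B: ring B using algebra_B by (simp add: assoc_algebra_def)
sublocale AB: tensor_product K A B by (rule tensor_product.intro[OF module_A module_B])
sublocale BA: tensor_product K B A by (rule tensor_product.intro[OF module_B module_A])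
sublocale Q: tensor_power K A B by (rule tensor_power.intro[OF module_A module_B])

lemmas multA = assoc_algebra_mult_bilinear[OF algebra_A]
lemmas multB = assoc_algebra_mult_bilinear[OF algebra_B]

abbreviation "V \<equiv> tensor K A B"
abbreviation "p \<equiv> pure_tensor K A B"
abbreviation "S \<equiv> factorisation_algebra K A B \<psi>"

lemmas module_V = AB.module_tensor
lemmas p_closed = AB.pure_tensor_closed

text \<open>In these terms the product of \<open>p a b\<close> and \<open>p c d\<close> in S is
  \<open>left_A a (right_B d (exchange b c))\<close>, so Sweedler indices give way to composition of
  linear maps. \<open>left_A\<close> and \<open>right_B\<close> are the outer A- and B-module
  structures of \<open>V\<close>.\<close>

definition "exchange b a = \<psi> (pure_tensor K B A b a)"
definition "left_A a = extend_linearly K V (\<lambda>(a', b). p (a \<otimes>\<^bsub>A\<^esub> a') b)"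
definition "right_B d = extend_linearly K V (\<lambda>(a, b). p a (b \<otimes>\<^bsub>B\<^esub> d))"

lemma exchange_bilinear: "bilinear K B A V exchange"
  unfolding exchange_def using factorisation
  by (intro bilinear_compose[OF BA.pure_tensor_bilinear]) (simp add: factorisation_def)

lemma exchange_one: "a \<in> carrier A \<Longrightarrow> exchange \<one>\<^bsub>B\<^esub> a = p a \<one>\<^bsub>B\<^esub>" "b \<in> carrier B \<Longrightarrow> exchange b \<one>\<^bsub>A\<^esub> = p \<one>\<^bsub>A\<^esub> b"
  using factorisation by (simp_all add: factorisation_def exchange_def)

lemma left_A_aux: "a \<in> carrier A \<Longrightarrow> bilinear K A B V (\<lambda>a' b. p (a \<otimes>\<^bsub>A\<^esub> a') b)"
  by (rule bilinear_comp_left[OF AB.pure_tensor_bilinear bilinear_right[OF multA]])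

lemma right_B_aux: "d \<in> carrier B \<Longrightarrow> bilinear K A B V (\<lambda>a b. p a (b \<otimes>\<^bsub>B\<^esub> d))"
  by (rule bilinear_comp_right[OF AB.pure_tensor_bilinear bilinear_left[OF multB]])

lemma left_A_bilinear: "bilinear K A V V left_A"
  unfolding left_A_def
proof (rule AB.tensor_extend_parameter[OF module_V module_A left_A_aux])
  fix a' b assume "a' \<in> carrier A" "b \<in> carrier B"
  then show "(\<lambda>a. p (a \<otimes>\<^bsub>A\<^esub> a') b) \<in> linear_maps K A V"
    by (intro linear_maps_comp[OF bilinear_left[OF multA] bilinear_left[OF AB.pure_tensor_bilinear]])
qed

lemma right_B_bilinear: "bilinear K B V V right_B"
  unfolding right_B_def
proof (rule AB.tensor_extend_parameter[OF module_V module_B right_B_aux])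
  fix a b assume "a \<in> carrier A" "b \<in> carrier B"
  then show "(\<lambda>d. p a (b \<otimes>\<^bsub>B\<^esub> d)) \<in> linear_maps K B V"
    by (intro linear_maps_comp[OF bilinear_right[OF multB] bilinear_right[OF AB.pure_tensor_bilinear]])
qed

lemma left_A_pure: "a \<in> carrier A \<Longrightarrow> a' \<in> carrier A \<Longrightarrow> b \<in> carrier B \<Longrightarrow> left_A a (p a' b) = p (a \<otimes>\<^bsub>A\<^esub> a') b"
  unfolding left_A_def by (rule AB.tensor_extend_pure[OF module_V left_A_aux])

lemma right_B_pure: "d \<in> carrier B \<Longrightarrow> a \<in> carrier A \<Longrightarrow> b \<in> carrier B \<Longrightarrow> right_B d (p a b) = p a (b \<otimes>\<^bsub>B\<^esub> d)"
  unfolding right_B_def by (rule AB.tensor_extend_pure[OF module_V right_B_aux])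

lemmas exchange_closed = bilinear_closed[OF exchange_bilinear]
lemmas left_A_closed = bilinear_closed[OF left_A_bilinear]
lemmas right_B_closed = bilinear_closed[OF right_B_bilinear]
lemmas left_A_linear = bilinear_right[OF left_A_bilinear]
lemmas right_B_linear = bilinear_right[OF right_B_bilinear]
lemmas factor_closed = p_closed exchange_closed left_A_closed right_B_closed

lemma left_A_one: "s \<in> carrier V \<Longrightarrow> left_A \<one>\<^bsub>A\<^esub> s = s"
  by (rule AB.tensor_eqI[OF module_V left_A_linear linear_maps_id]) (simp_all add: left_A_pure)

lemma right_B_one: "s \<in> carrier V \<Longrightarrow> right_B \<one>\<^bsub>B\<^esub> s = s"
  by (rule AB.tensor_eqI[OF module_V right_B_linear linear_maps_id]) (simp_all add: right_B_pure)

lemma left_A_right_B: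
  assumes "a \<in> carrier A" "d \<in> carrier B" "s \<in> carrier V"
  shows "left_A a (right_B d s) = right_B d (left_A a s)"
  by (rule AB.tensor_eqI[OF module_V linear_maps_comp[OF right_B_linear left_A_linear]
        linear_maps_comp[OF left_A_linear right_B_linear]])
    (use assms in \<open>simp_all add: left_A_pure right_B_pure\<close>)

lemma left_A_left_A:
  assumes "a \<in> carrier A" "a' \<in> carrier A" "s \<in> carrier V"
  shows "left_A a (left_A a' s) = left_A (a \<otimes>\<^bsub>A\<^esub> a') s"
  by (rule AB.tensor_eqI[OF module_V linear_maps_comp[OF left_A_linear left_A_linear] left_A_linear])
    (use assms in \<open>simp_all add: left_A_pure A.m_assoc\<close>)

lemma right_B_right_B:
  assumes "d \<in> carrier B" "d' \<in> carrier B" "s \<in> carrier V"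
  shows "right_B d (right_B d' s) = right_B (d' \<otimes>\<^bsub>B\<^esub> d) s"
  by (rule AB.tensor_eqI[OF module_V linear_maps_comp[OF right_B_linear right_B_linear] right_B_linear])
    (use assms in \<open>simp_all add: right_B_pure B.m_assoc\<close>)

text \<open>The inner sums on the two sides of the third clause are precisely the bodies of
  \<open>right_B\<close> and \<open>left_A\<close>.\<close>

lemma factorisation_axiom:
  assumes "a \<in> carrier A" "d \<in> carrier A" "b \<in> carrier B" "c \<in> carrier B"
  shows "extend_linearly K V (\<lambda>(d', c'). right_B c' (exchange b (a \<otimes>\<^bsub>A\<^esub> d'))) (exchange c d) =
    extend_linearly K V (\<lambda>(a', b'). left_A a' (exchange (b' \<otimes>\<^bsub>B\<^esub> c) d)) (exchange b a)"
  using factorisation assms unfolding factorisation_def exchange_def right_B_def left_A_def by blast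

lemma carrier_S: "carrier S = carrier V" and add_S: "add S = add V"
  and smult_S: "smult S = smult V" and zero_S: "zero S = zero V"
  and one_S: "\<one>\<^bsub>S\<^esub> = p \<one>\<^bsub>A\<^esub> \<one>\<^bsub>B\<^esub>"
  by (simp_all add: factorisation_algebra_def)

lemma linear_maps_S: "linear_maps K S N = linear_maps K V N" "linear_maps K N S = linear_maps K N V"
  by (simp_all add: linear_maps_def carrier_S add_S smult_S)

lemma bilinear_S: "bilinear K S N P = bilinear K V N P" "bilinear K N S P = bilinear K N V P"
  "bilinear K N P S = bilinear K N P V"
  by (simp_all add: bilinear_def linear_maps_S carrier_S fun_eq_iff)

lemma inner_bilinear:
  assumes "a \<in> carrier A" "b \<in> carrier B"
  shows "bilinear K A B V (\<lambda>c d. left_A a (right_B d (exchange b c)))"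
  by (rule bilinear_compose[OF bilinear_comp_left[OF bilinear_flip[OF right_B_bilinear] bilinear_right[OF exchange_bilinear]] left_A_linear])
    (use assms in auto)

text \<open>The three nested sums are simplified from the inside out. Each level takes its own
  congruence step, because the simplified inner value is known only for arguments in the
  carriers.\<close>

lemma mult_S_eq:
  assumes "s \<in> carrier V" "t \<in> carrier V"
  shows "s \<otimes>\<^bsub>S\<^esub> t = extend_linearly K V (\<lambda>(a, b).
    extend_linearly K V (\<lambda>(c, d). left_A a (right_B d (exchange b c))) t) s"
proof -
  have inner: "extend_linearly K V (\<lambda>(c', b'). p (a \<otimes>\<^bsub>A\<^esub> c') (b' \<otimes>\<^bsub>B\<^esub> d)) x = left_A a (right_B d x)"
    if "a \<in> carrier A" "d \<in> carrier B" "x \<in> carrier V" for a d x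
  proof -
    have bil: "bilinear K A B V (\<lambda>c' b'. p (a \<otimes>\<^bsub>A\<^esub> c') (b' \<otimes>\<^bsub>B\<^esub> d))"
      by (rule bilinear_comp_right[OF left_A_aux bilinear_left[OF multB]]) (use that in auto)
    show ?thesis
      by (rule AB.tensor_eqI[OF module_V AB.tensor_extend_linear[OF module_V bil]
            linear_maps_comp[OF right_B_linear left_A_linear]])
        (use that in \<open>simp_all add: AB.tensor_extend_pure[OF module_V bil] left_A_pure right_B_pure\<close>)
  qed
  have middle: "extend_linearly K V (\<lambda>(c, d). extend_linearly K V
      (\<lambda>(c', b'). p (a \<otimes>\<^bsub>A\<^esub> c') (b' \<otimes>\<^bsub>B\<^esub> d)) (exchange b c)) t =
    extend_linearly K V (\<lambda>(c, d). left_A a (right_B d (exchange b c))) t"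
    if "a \<in> carrier A" "b \<in> carrier B" for a b
    by (rule AB.tensor_extend_cong[OF module_V]) (use that assms in \<open>simp_all add: inner factor_closed\<close>)
  have cl: "extend_linearly K V (\<lambda>(c, d). left_A a (right_B d (exchange b c))) t \<in> carrier V"
    if "a \<in> carrier A" "b \<in> carrier B" for a b
    using linear_maps_closed[OF AB.tensor_extend_linear[OF module_V inner_bilinear[OF that]] assms(2)] .
  show ?thesis
    unfolding factorisation_algebra_def
    using AB.tensor_extend_cong[OF module_V middle[unfolded exchange_def] cl[unfolded exchange_def] assms(1)]
    by (simp add: exchange_def)
qed

text \<open>For each of the two linearity claims one of a, b is frozen and the other plays the
  parameter in \<open>AB.tensor_extend_parameter\<close>.\<close>

lemma outer_bilinear:
  assumes "t \<in> carrier V"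
  shows "bilinear K A B V (\<lambda>a b. extend_linearly K V (\<lambda>(c, d). left_A a (right_B d (exchange b c))) t)"
proof (rule bilinearI)
  fix a assume a: "a \<in> carrier A"
  have "bilinear K B V V (\<lambda>b. extend_linearly K V (\<lambda>(c, d). left_A a (right_B d (exchange b c))))"
    by (rule AB.tensor_extend_parameter[OF module_V module_B inner_bilinear[OF a]])
      (use a in \<open>auto intro!: linear_maps_comp[OF linear_maps_comp[OF bilinear_left[OF exchange_bilinear] right_B_linear] left_A_linear]\<close>)
  then show "(\<lambda>b. extend_linearly K V (\<lambda>(c, d). left_A a (right_B d (exchange b c))) t) \<in> linear_maps K B V"
    using assms by (rule bilinear_left)
next
  fix b assume b: "b \<in> carrier B"
  have "bilinear K A V V (\<lambda>a. extend_linearly K V (\<lambda>(c, d). left_A a (right_B d (exchange b c))))"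
    by (rule AB.tensor_extend_parameter[OF module_V module_A inner_bilinear])
      (use b in \<open>auto intro!: bilinear_left[OF left_A_bilinear] factor_closed\<close>)
  then show "(\<lambda>a. extend_linearly K V (\<lambda>(c, d). left_A a (right_B d (exchange b c))) t) \<in> linear_maps K A V"
    using assms by (rule bilinear_left)
qed

lemma mult_S_bilinear: "bilinear K V V V (mult S)"
proof (rule bilinear_cong[OF module_V module_V mult_S_eq])
  have "bilinear K V V V (\<lambda>t s. extend_linearly K V (\<lambda>(a, b).
      extend_linearly K V (\<lambda>(c, d). left_A a (right_B d (exchange b c))) t) s)"
    by (rule AB.tensor_extend_parameter[OF module_V module_V outer_bilinear])
      (auto intro: AB.tensor_extend_linear[OF module_V inner_bilinear])
  then show "bilinear K V V V (\<lambda>s t. extend_linearly K V (\<lambda>(a, b).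
      extend_linearly K V (\<lambda>(c, d). left_A a (right_B d (exchange b c))) t) s)"
    by (rule bilinear_flip)
qed

lemmas mult_closed = bilinear_closed[OF mult_S_bilinear]
lemmas mult_left = bilinear_left[OF mult_S_bilinear]
lemmas mult_right = bilinear_right[OF mult_S_bilinear]

lemma mult_pure:
  assumes "a \<in> carrier A" "b \<in> carrier B" "c \<in> carrier A" "d \<in> carrier B"
  shows "p a b \<otimes>\<^bsub>S\<^esub> p c d = left_A a (right_B d (exchange b c))"
  using assms
  by (simp add: mult_S_eq p_closed AB.tensor_extend_pure[OF module_V outer_bilinear]
      AB.tensor_extend_pure[OF module_V inner_bilinear])

text \<open>\<open>left_A a\<close> is left multiplication by a \<otimes> 1, and
  \<open>right_B d\<close> is right multiplication by 1 \<otimes> d. This lemma and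
  \<open>mult_right_B\<close> are the easy cases of associativity; they strip the outer factors and
  leave \<open>mult_assoc_base\<close>.\<close>

lemma left_A_mult:
  assumes "a \<in> carrier A" "s \<in> carrier V" "t \<in> carrier V"
  shows "left_A a s \<otimes>\<^bsub>S\<^esub> t = left_A a (s \<otimes>\<^bsub>S\<^esub> t)"
proof (rule AB.tensor_eqI[OF module_V linear_maps_comp[OF left_A_linear mult_left]
      linear_maps_comp[OF mult_left left_A_linear], of a t t a s])
  fix a' b assume a': "a' \<in> carrier A" "b \<in> carrier B"
  show "left_A a (p a' b) \<otimes>\<^bsub>S\<^esub> t = left_A a (p a' b \<otimes>\<^bsub>S\<^esub> t)"
    by (rule AB.tensor_eqI[OF module_V mult_right linear_maps_comp[OF mult_right left_A_linear]])
      (use assms a' in \<open>simp_all add: left_A_pure mult_pure factor_closed left_A_left_A\<close>)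
qed (use assms in auto)

lemma mult_right_B:
  assumes "d \<in> carrier B" "s \<in> carrier V" "t \<in> carrier V"
  shows "s \<otimes>\<^bsub>S\<^esub> right_B d t = right_B d (s \<otimes>\<^bsub>S\<^esub> t)"
proof (rule AB.tensor_eqI[OF module_V mult_left linear_maps_comp[OF mult_left right_B_linear], of "right_B d t" t d s])
  fix a b assume a: "a \<in> carrier A" "b \<in> carrier B"
  show "p a b \<otimes>\<^bsub>S\<^esub> right_B d t = right_B d (p a b \<otimes>\<^bsub>S\<^esub> t)"
    by (rule AB.tensor_eqI[OF module_V linear_maps_comp[OF right_B_linear mult_right]
          linear_maps_comp[OF mult_right right_B_linear]])
      (use assms a in \<open>simp_all add: right_B_pure mult_pure factor_closed right_B_right_B flip: left_A_right_B\<close>)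
qed (use assms in \<open>auto simp: factor_closed\<close>)

lemma mult_one_left: "s \<in> carrier V \<Longrightarrow> p \<one>\<^bsub>A\<^esub> \<one>\<^bsub>B\<^esub> \<otimes>\<^bsub>S\<^esub> s = s"
  by (rule AB.tensor_eqI[OF module_V mult_right linear_maps_id])
    (simp_all add: factor_closed mult_pure exchange_one left_A_one right_B_pure)

lemma mult_one_right: "s \<in> carrier V \<Longrightarrow> s \<otimes>\<^bsub>S\<^esub> p \<one>\<^bsub>A\<^esub> \<one>\<^bsub>B\<^esub> = s"
  by (rule AB.tensor_eqI[OF module_V mult_left linear_maps_id])
    (simp_all add: factor_closed mult_pure exchange_one right_B_one left_A_pure)

text \<open>The core of associativity: the two bracketings of (1 \<otimes> b)(c \<otimes> d)(e
  \<otimes> 1). The left one expands into a sum over \<psi>(b \<otimes> c), the right one into a sum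
  over \<psi>(d \<otimes> e), and these are the two sides of
  \<open>factorisation_axiom\<close>.\<close>

lemma mult_assoc_base:
  assumes "b \<in> carrier B" "c \<in> carrier A" "d \<in> carrier B" "e \<in> carrier A"
  shows "right_B d (exchange b c) \<otimes>\<^bsub>S\<^esub> p e \<one>\<^bsub>B\<^esub> = p \<one>\<^bsub>A\<^esub> b \<otimes>\<^bsub>S\<^esub> left_A c (exchange d e)"
proof -
  have bil1: "bilinear K A B V (\<lambda>a' b'. left_A a' (exchange (b' \<otimes>\<^bsub>B\<^esub> d) e))"
    by (rule bilinear_comp_right[OF left_A_bilinear linear_maps_comp[OF bilinear_left[OF multB]
          bilinear_left[OF exchange_bilinear]]]) (use assms in auto)
  have bil2: "bilinear K A B V (\<lambda>d' c'. right_B c' (exchange b (c \<otimes>\<^bsub>A\<^esub> d')))"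
    by (rule bilinear_comp_left[OF bilinear_flip[OF right_B_bilinear] linear_maps_comp[OF
            bilinear_right[OF multA] bilinear_right[OF exchange_bilinear]]]) (use assms in auto)
  have "right_B d x \<otimes>\<^bsub>S\<^esub> p e \<one>\<^bsub>B\<^esub> = extend_linearly K V (\<lambda>(a', b'). left_A a' (exchange (b' \<otimes>\<^bsub>B\<^esub> d) e)) x"
    if "x \<in> carrier V" for x
    by (rule AB.tensor_eqI[OF module_V linear_maps_comp[OF right_B_linear mult_left]
          AB.tensor_extend_linear[OF module_V bil1]])
      (use assms that in \<open>simp_all add: factor_closed right_B_pure mult_pure right_B_one AB.tensor_extend_pure[OF module_V bil1]\<close>)
  moreover have "p \<one>\<^bsub>A\<^esub> b \<otimes>\<^bsub>S\<^esub> left_A c x = extend_linearly K V (\<lambda>(d', c'). right_B c' (exchange b (c \<otimes>\<^bsub>A\<^esub> d'))) x"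
    if "x \<in> carrier V" for x
    by (rule AB.tensor_eqI[OF module_V linear_maps_comp[OF left_A_linear mult_right]
          AB.tensor_extend_linear[OF module_V bil2]])
      (use assms that in \<open>simp_all add: factor_closed left_A_pure mult_pure left_A_one AB.tensor_extend_pure[OF module_V bil2]\<close>)
  ultimately show ?thesis using assms by (simp add: factor_closed factorisation_axiom)
qed

lemma mult_assoc_pure:
  assumes "a \<in> carrier A" "b \<in> carrier B" "c \<in> carrier A" "d \<in> carrier B" "e \<in> carrier A" "f \<in> carrier B"
  shows "p a b \<otimes>\<^bsub>S\<^esub> p c d \<otimes>\<^bsub>S\<^esub> p e f = p a b \<otimes>\<^bsub>S\<^esub> (p c d \<otimes>\<^bsub>S\<^esub> p e f)"
proof -
  have ef: "p e f = right_B f (p e \<one>\<^bsub>B\<^esub>)" and ab: "p a b = left_A a (p \<one>\<^bsub>A\<^esub> b)"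
    using assms by (simp_all add: right_B_pure left_A_pure)
  have "p a b \<otimes>\<^bsub>S\<^esub> p c d \<otimes>\<^bsub>S\<^esub> p e f = left_A a (right_B f (right_B d (exchange b c) \<otimes>\<^bsub>S\<^esub> p e \<one>\<^bsub>B\<^esub>))"
    using assms by (simp add: mult_pure factor_closed left_A_mult) (simp add: ef mult_right_B factor_closed)
  also have "\<dots> = left_A a (right_B f (p \<one>\<^bsub>A\<^esub> b \<otimes>\<^bsub>S\<^esub> left_A c (exchange d e)))"
    using assms by (simp add: mult_assoc_base)
  also have "\<dots> = p a b \<otimes>\<^bsub>S\<^esub> (p c d \<otimes>\<^bsub>S\<^esub> p e f)"
    using assms by (simp add: ab left_A_mult factor_closed mult_closed mult_right_B left_A_right_B mult_pure)
  finally show ?thesis .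
qed

lemma mult_assoc:
  assumes "s \<in> carrier V" "t \<in> carrier V" "u \<in> carrier V"
  shows "s \<otimes>\<^bsub>S\<^esub> t \<otimes>\<^bsub>S\<^esub> u = s \<otimes>\<^bsub>S\<^esub> (t \<otimes>\<^bsub>S\<^esub> u)"
proof (rule AB.tensor_eqI[OF module_V linear_maps_comp[OF mult_left mult_left] mult_left, of t u "t \<otimes>\<^bsub>S\<^esub> u" s])
  fix a b assume ab: "a \<in> carrier A" "b \<in> carrier B"
  show "p a b \<otimes>\<^bsub>S\<^esub> t \<otimes>\<^bsub>S\<^esub> u = p a b \<otimes>\<^bsub>S\<^esub> (t \<otimes>\<^bsub>S\<^esub> u)"
  proof (rule AB.tensor_eqI[OF module_V linear_maps_comp[OF mult_right mult_left]
        linear_maps_comp[OF mult_left mult_right], of "p a b" u u "p a b" t])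
    fix c d assume cd: "c \<in> carrier A" "d \<in> carrier B"
    show "p a b \<otimes>\<^bsub>S\<^esub> p c d \<otimes>\<^bsub>S\<^esub> u = p a b \<otimes>\<^bsub>S\<^esub> (p c d \<otimes>\<^bsub>S\<^esub> u)"
      by (rule AB.tensor_eqI[OF module_V mult_right linear_maps_comp[OF mult_right mult_right]])
        (use assms ab cd in \<open>simp_all add: factor_closed mult_closed mult_assoc_pure\<close>)
  qed (use assms ab in \<open>simp_all add: factor_closed\<close>)
qed (use assms in \<open>simp_all add: mult_closed\<close>)

lemma module_S: "module K S"
proof -
  interpret V: module K V by (rule module_V)
  have "abelian_group S"
    by (rule abelian_groupI)
      (simp_all add: carrier_S add_S zero_S V.a_ac V.add.l_inv_ex)
  then show ?thesis
    by (intro moduleI V.R.is_cring)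
      (simp_all add: carrier_S add_S smult_S V.smult_l_distr V.smult_r_distr V.smult_assoc1)
qed

lemma algebra_S: "assoc_algebra K S"
proof -
  interpret S: module K S by (rule module_S)
  have "monoid S"
    by (rule monoidI)
      (simp_all add: carrier_S one_S mult_closed p_closed mult_one_left mult_one_right mult_assoc)
  then have "ring S"
    using linear_maps_add[OF mult_left] linear_maps_add[OF mult_right] S.abelian_group_axioms
    by (intro ringI) (simp_all add: carrier_S add_S)
  then show ?thesis
    unfolding assoc_algebra_def carrier_S smult_S
    using module_S linear_maps_smult[OF mult_left] linear_maps_smult[OF mult_right] by blast
qed

abbreviation "\<iota> \<equiv> incl_B K A B"

lemma incl_eq: "\<iota> = p \<one>\<^bsub>A\<^esub>"
  by (simp add: incl_B_def fun_eq_iff)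

lemma incl_linear: "\<iota> \<in> linear_maps K B V"
  unfolding incl_eq by (rule bilinear_right[OF AB.pure_tensor_bilinear]) simp

lemmas incl_closed = linear_maps_closed[OF incl_linear]

text \<open>Rests on the unit clause \<psi>(b \<otimes> 1) = 1 \<otimes> b. It turns the right
  B-action on S into the simpler operator \<open>right_B\<close>.\<close>

lemma mult_incl: "s \<in> carrier V \<Longrightarrow> d \<in> carrier B \<Longrightarrow> s \<otimes>\<^bsub>S\<^esub> \<iota> d = right_B d s"
  by (rule AB.tensor_eqI[OF module_V mult_left right_B_linear])
    (simp_all add: incl_closed, simp add: incl_eq mult_pure exchange_one right_B_pure left_A_pure)

lemma incl_mult: "b \<in> carrier B \<Longrightarrow> b' \<in> carrier B \<Longrightarrow> \<iota> (b \<otimes>\<^bsub>B\<^esub> b') = \<iota> b \<otimes>\<^bsub>S\<^esub> \<iota> b'"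
  using mult_incl[of "\<iota> b" b'] by (simp add: incl_closed) (simp add: incl_eq right_B_pure)

lemma incl_exchange: "b \<in> carrier B \<Longrightarrow> a \<in> carrier A \<Longrightarrow> \<iota> b \<otimes>\<^bsub>S\<^esub> p a \<one>\<^bsub>B\<^esub> = exchange b a"
  by (simp add: incl_eq mult_pure left_A_one right_B_one factor_closed)

lemma incl_pure: "b \<in> carrier B \<Longrightarrow> c \<in> carrier A \<Longrightarrow> d \<in> carrier B \<Longrightarrow> \<iota> b \<otimes>\<^bsub>S\<^esub> p c d = right_B d (exchange b c)"
  by (simp add: incl_eq mult_pure left_A_one factor_closed)

end


section \<open>Substitution into multilinear maps\<close>

lemma multilinear_comp_last:
  assumes "multilinear K A B n N f" "g \<in> linear_maps K B B"
  shows "multilinear K A B n N (\<lambda>as b. f as (g b))"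
  unfolding multilinear_def
proof (intro conjI ballI allI impI)
  fix as b i assume "as \<in> tuples A n" "b \<in> carrier B" "i < n"
  then show "(\<lambda>a. f (as[i := a]) (g b)) \<in> linear_maps K A N"
    using multilinear_slot[OF assms(1)] linear_maps_closed[OF assms(2)] by blast
next
  fix as assume "as \<in> tuples A n"
  then show "(\<lambda>b. f as (g b)) \<in> linear_maps K B N"
    by (rule linear_maps_comp[OF assms(2) multilinear_last[OF assms(1)]])
qed

lemma multilinear_Cons:
  assumes "multilinear K A B (Suc n) N f" "a \<in> carrier A"
  shows "multilinear K A B n N (\<lambda>as. f (a # as))"
  unfolding multilinear_def
proof (intro conjI ballI allI impI)
  fix as b i assume "as \<in> tuples A n" "b \<in> carrier B" "i < n"
  then show "(\<lambda>a'. f (a # as[i := a']) b) \<in> linear_maps K A N"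
    using multilinear_slot[OF assms(1), of "a # as" b "Suc i"] assms(2) by (simp add: tuples_Cons)
next
  fix as assume "as \<in> tuples A n"
  then show "f (a # as) \<in> linear_maps K B N"
    using multilinear_last[OF assms(1), of "a # as"] assms(2) by (simp add: tuples_Cons)
qed

lemma multilinear_hd:
  assumes "module K A" "multilinear K A B (Suc n) N f" "as \<in> tuples A n" "b \<in> carrier B"
  shows "(\<lambda>a. f (a # as) b) \<in> linear_maps K A N"
proof -
  interpret A: module K A by fact
  show ?thesis
    \<comment> \<open>A head is required before slot 0 can be overwritten; zero is an arbitrary
      choice.\<close>
    using multilinear_slot[OF assms(2), of "\<zero>\<^bsub>A\<^esub> # as" b 0] assms(3,4) by (simp add: tuples_Cons)
qed

lemma multilinear_update:
  assumes f: "multilinear K A B n N f" and g: "g \<in> linear_maps K A A" and j: "j < n"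
  shows "multilinear K A B n N (\<lambda>as. f (as[j := g (as ! j)]))"
  unfolding multilinear_def
proof (intro conjI ballI allI impI)
  fix as b i assume as: "as \<in> tuples A n" and b: "b \<in> carrier B" and i: "i < n"
  note len = tuples_length[OF as]
  show "(\<lambda>a. f (as[i := a, j := g (as[i := a] ! j)]) b) \<in> linear_maps K A N"
  \<comment> \<open>In slot j the second update overwrites the first and leaves f after g. In any
    other slot the updates commute, and the entry at j is a constant.\<close>
  proof (cases "i = j")
    case True
    then show ?thesis
      using linear_maps_comp[OF g multilinear_slot[OF f as b i]] len i by simp
  next
    case False
    then show ?thesis
      using multilinear_slot[OF f tuples_update[OF as] b i, of "g (as ! j)" j]
        linear_maps_closed[OF g tuples_nth[OF as j]] by (simp add: list_update_swap)
  qed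
next
  fix as assume as: "as \<in> tuples A n"
  then show "f (as[j := g (as ! j)]) \<in> linear_maps K B N"
    by (intro multilinear_last[OF f] tuples_update linear_maps_closed[OF g] tuples_nth[OF as j])
qed

section \<open>Concatenation and the left B-action on tensor powers\<close>

context factorisation_setup
begin

abbreviation "Q \<equiv> power_tensor K A B"
abbreviation "pp \<equiv> pure_power_tensor K A B"

lemmas module_Q = Q.module_power_tensor
lemmas pp_closed = Q.pure_power_closed
lemmas pp_multi = Q.pure_power_multilinear

text \<open>\<open>prepend\<close> is the inner sum in the recursion of \<open>move_past\<close>.
  Together with \<open>power_right_B\<close> it allows induction on the number of factors without
  handling lists.\<close>

definition "prepend m a = extend_linearly K (Q (Suc m)) (\<lambda>(as, c). pp (a # as) c)"
definition "power_right_B m d = extend_linearly K (Q m) (\<lambda>(as, c). pp as (c \<otimes>\<^bsub>B\<^esub> d))"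
definition "B_action m b = extend_linearly K (Q m) (\<lambda>(as, c). power_right_B m c (move_past K A B \<psi> as b))"
text \<open>The map S \<otimes> Q_m \<rightarrow> Q_(m+1) of the overview, with q kept as a
  parameter of the sum over s.\<close>

definition "tensor_cons m s q = extend_linearly K (Q (Suc m)) (\<lambda>(a, b). prepend m a (B_action m b q)) s"

lemma prepend_aux: "a \<in> carrier A \<Longrightarrow> multilinear K A B m (Q (Suc m)) (\<lambda>as. pp (a # as))"
  by (rule multilinear_Cons[OF pp_multi])

lemma prepend_bilinear: "bilinear K A (Q m) (Q (Suc m)) (prepend m)"
  unfolding prepend_def
  by (rule Q.power_extend_parameter[OF module_Q module_A prepend_aux multilinear_hd[OF module_A pp_multi]])

lemma prepend_pure: "a \<in> carrier A \<Longrightarrow> as \<in> tuples A m \<Longrightarrow> c \<in> carrier B \<Longrightarrow> prepend m a (pp as c) = pp (a # as) c"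
  unfolding prepend_def by (rule Q.power_extend_pure[OF module_Q prepend_aux])

lemma power_right_B_aux: "d \<in> carrier B \<Longrightarrow> multilinear K A B m (Q m) (\<lambda>as c. pp as (c \<otimes>\<^bsub>B\<^esub> d))"
  by (rule multilinear_comp_last[OF pp_multi bilinear_left[OF multB]])

lemma power_right_B_bilinear: "bilinear K B (Q m) (Q m) (power_right_B m)"
  unfolding power_right_B_def
proof (rule Q.power_extend_parameter[OF module_Q module_B power_right_B_aux])
  fix as c assume "as \<in> tuples A m" "c \<in> carrier B"
  then show "(\<lambda>d. pp as (c \<otimes>\<^bsub>B\<^esub> d)) \<in> linear_maps K B (Q m)"
    by (intro linear_maps_comp[OF bilinear_right[OF multB] multilinear_last[OF pp_multi]])
qed

lemma power_right_B_pure: "d \<in> carrier B \<Longrightarrow> as \<in> tuples A m \<Longrightarrow> c \<in> carrier B \<Longrightarrow> power_right_B m d (pp as c) = pp as (c \<otimes>\<^bsub>B\<^esub> d)"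
  unfolding power_right_B_def by (rule Q.power_extend_pure[OF module_Q power_right_B_aux])

lemmas prepend_linear = bilinear_right[OF prepend_bilinear]
lemmas power_right_B_linear = bilinear_right[OF power_right_B_bilinear]

text \<open>Each pure tensor with a nonempty list is a \<open>prepend\<close> of a shorter one. The
  comparison is stated for arbitrary \<open>q\<close> in the lower power, so that induction
  hypotheses apply to it directly.\<close>

lemma Q_Suc_eqI:
  assumes "module K N" "f \<in> linear_maps K (Q (Suc m)) N" "g \<in> linear_maps K (Q (Suc m)) N"
    and "\<And>a q. a \<in> carrier A \<Longrightarrow> q \<in> carrier (Q m) \<Longrightarrow> f (prepend m a q) = g (prepend m a q)"
    and "x \<in> carrier (Q (Suc m))"
  shows "f x = g x"
proof (rule Q.power_eqI[OF assms(1-3) _ assms(5)])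
  fix as b assume "as \<in> tuples A (Suc m)" and b: "b \<in> carrier B"
  then obtain a as' where as: "as = a # as'" "a \<in> carrier A" "as' \<in> tuples A m"
    by (auto simp: tuples_Suc)
  then show "f (pp as b) = g (pp as b)"
    using assms(4)[OF as(2) pp_closed[OF as(3) b]] b by (simp add: prepend_pure)
qed

lemma power_right_B_prepend:
  assumes "a \<in> carrier A" "d \<in> carrier B" "q \<in> carrier (Q m)"
  shows "power_right_B (Suc m) d (prepend m a q) = prepend m a (power_right_B m d q)"
  by (rule Q.power_eqI[OF module_Q linear_maps_comp[OF prepend_linear power_right_B_linear]
        linear_maps_comp[OF power_right_B_linear prepend_linear]])
    (use assms in \<open>simp_all add: prepend_pure power_right_B_pure tuples_Cons\<close>)

lemma move_past_Cons:
  "move_past K A B \<psi> (a # as) b =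
    extend_linearly K (Q (Suc (length as))) (\<lambda>(a', b'). prepend (length as) a' (move_past K A B \<psi> as b')) (exchange b a)"
  by (simp add: prepend_def exchange_def)

lemma move_past_aux:
  assumes "multilinear K A B m (Q m) (move_past K A B \<psi>)" "as \<in> tuples A m"
  shows "bilinear K A B (Q (Suc m)) (\<lambda>a' b'. prepend m a' (move_past K A B \<psi> as b'))"
  by (rule bilinear_comp_right[OF prepend_bilinear multilinear_last[OF assms]])

text \<open>The head enters only through \<open>exchange b a\<close>, which settles its slot at
  once, and likewise the slot of b. A tail entry sits under the sum over \<psi>(b \<otimes> a), so
  there the linear dependence on a parameter is needed.\<close>

lemma move_past_multilinear: "multilinear K A B m (Q m) (move_past K A B \<psi>)"
proof (induction m)
  case 0
  show ?case
    using multilinear_last[OF pp_multi[of 0]] by (intro multilinear_0I) (simp add: tuples_0)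
next
  case (Suc m)
  note bil = move_past_aux[OF Suc]
  note lin = AB.tensor_extend_linear[OF module_Q bil]
  show ?case
  proof (rule multilinear_SucI)
    fix a assume a: "a \<in> carrier A"
    show "multilinear K A B m (Q (Suc m)) (\<lambda>as. move_past K A B \<psi> (a # as))"
      unfolding multilinear_def
    proof (intro conjI ballI allI impI)
      fix as b i assume as: "as \<in> tuples A m" and b: "b \<in> carrier B" and i: "i < m"
      have "bilinear K A V (Q (Suc m)) (\<lambda>x. extend_linearly K (Q (Suc m))
          (\<lambda>(a', b'). prepend m a' (move_past K A B \<psi> (as[i := x]) b')))"
      proof (rule AB.tensor_extend_parameter[OF module_Q module_A bil[OF tuples_update[OF as]]])
        fix a' b' assume "a' \<in> carrier A" "b' \<in> carrier B"
        then show "(\<lambda>x. prepend m a' (move_past K A B \<psi> (as[i := x]) b')) \<in> linear_maps K A (Q (Suc m))"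
          by (intro linear_maps_comp[OF multilinear_slot[OF Suc as _ i] prepend_linear])
      qed
      from bilinear_left[OF this exchange_closed[OF b a]]
      show "(\<lambda>x. move_past K A B \<psi> (a # as[i := x]) b) \<in> linear_maps K A (Q (Suc m))"
        using tuples_length[OF as] unfolding move_past_Cons by simp
    next
      fix as assume as: "as \<in> tuples A m"
      have "move_past K A B \<psi> (a # as) = (\<lambda>b. extend_linearly K (Q (Suc m))
          (\<lambda>(a', b'). prepend m a' (move_past K A B \<psi> as b')) (exchange b a))"
        unfolding tuples_length[OF as, symmetric] by (intro ext) (rule move_past_Cons)
      then show "move_past K A B \<psi> (a # as) \<in> linear_maps K B (Q (Suc m))"
        using linear_maps_comp[OF bilinear_left[OF exchange_bilinear a] lin[OF as]] by simp
    qed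
  next
    fix as b assume as: "as \<in> tuples A m" and b: "b \<in> carrier B"
    show "(\<lambda>a. move_past K A B \<psi> (a # as) b) \<in> linear_maps K A (Q (Suc m))"
      using linear_maps_comp[OF bilinear_right[OF exchange_bilinear b] lin[OF as]] tuples_length[OF as]
      unfolding move_past_Cons by simp
  qed
qed

lemmas move_past_closed = multilinear_closed[OF move_past_multilinear]

lemma B_action_aux:
  assumes "b \<in> carrier B"
  shows "multilinear K A B m (Q m) (\<lambda>as c. power_right_B m c (move_past K A B \<psi> as b))"
  unfolding multilinear_def
proof (intro conjI ballI allI impI)
  fix as c i assume "as \<in> tuples A m" "c \<in> carrier B" "i < m"
  then show "(\<lambda>a. power_right_B m c (move_past K A B \<psi> (as[i := a]) b)) \<in> linear_maps K A (Q m)"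
    using assms by (intro linear_maps_comp[OF multilinear_slot[OF move_past_multilinear] power_right_B_linear])
next
  fix as assume "as \<in> tuples A m"
  then show "(\<lambda>c. power_right_B m c (move_past K A B \<psi> as b)) \<in> linear_maps K B (Q m)"
    by (intro bilinear_left[OF power_right_B_bilinear] move_past_closed assms)
qed

lemma B_action_bilinear: "bilinear K B (Q m) (Q m) (B_action m)"
  unfolding B_action_def
proof (rule Q.power_extend_parameter[OF module_Q module_B B_action_aux])
  fix as c assume "as \<in> tuples A m" "c \<in> carrier B"
  then show "(\<lambda>b. power_right_B m c (move_past K A B \<psi> as b)) \<in> linear_maps K B (Q m)"
    by (intro linear_maps_comp[OF multilinear_last[OF move_past_multilinear] power_right_B_linear])
qed

lemma B_action_pure: "b \<in> carrier B \<Longrightarrow> as \<in> tuples A m \<Longrightarrow> c \<in> carrier B \<Longrightarrow>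
    B_action m b (pp as c) = power_right_B m c (move_past K A B \<psi> as b)"
  unfolding B_action_def by (rule Q.power_extend_pure[OF module_Q B_action_aux])

lemmas B_action_linear = bilinear_right[OF B_action_bilinear]
lemmas B_action_closed = bilinear_closed[OF B_action_bilinear]

lemma tensor_cons_aux: "q \<in> carrier (Q m) \<Longrightarrow> bilinear K A B (Q (Suc m)) (\<lambda>a b. prepend m a (B_action m b q))"
  by (rule bilinear_comp_right[OF prepend_bilinear bilinear_left[OF B_action_bilinear]])

lemma tensor_cons_bilinear: "bilinear K V (Q m) (Q (Suc m)) (tensor_cons m)"
  unfolding tensor_cons_def[abs_def]
proof (rule bilinear_flip, rule AB.tensor_extend_parameter[OF module_Q module_Q tensor_cons_aux])
  fix a b assume "a \<in> carrier A" "b \<in> carrier B"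
  then show "(\<lambda>q. prepend m a (B_action m b q)) \<in> linear_maps K (Q m) (Q (Suc m))"
    by (intro linear_maps_comp[OF B_action_linear prepend_linear])
qed

lemma tensor_cons_pure: "q \<in> carrier (Q m) \<Longrightarrow> a \<in> carrier A \<Longrightarrow> b \<in> carrier B \<Longrightarrow>
    tensor_cons m (p a b) q = prepend m a (B_action m b q)"
  unfolding tensor_cons_def[abs_def] by (rule AB.tensor_extend_pure[OF module_Q tensor_cons_aux])

lemmas tensor_cons_left = bilinear_left[OF tensor_cons_bilinear]
lemmas tensor_cons_right = bilinear_right[OF tensor_cons_bilinear]
lemmas tensor_cons_closed = bilinear_closed[OF tensor_cons_bilinear]

text \<open>Moving b past the first factor yields \<psi>(b \<otimes> a), whose B-part then acts on
  q. Together with \<open>B_action_0\<close> this is the recursion that the inductions below use in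
  place of \<open>move_past\<close>.\<close>

lemma B_action_prepend:
  assumes "b \<in> carrier B" "a \<in> carrier A" "q \<in> carrier (Q m)"
  shows "B_action (Suc m) b (prepend m a q) = tensor_cons m (exchange b a) q"
proof (rule Q.power_eqI[OF module_Q linear_maps_comp[OF prepend_linear B_action_linear] tensor_cons_right, of a b "exchange b a" m q])
  fix as c assume as: "as \<in> tuples A m" and c: "c \<in> carrier B"
  note bil = move_past_aux[OF move_past_multilinear as]
  have "power_right_B (Suc m) c (extend_linearly K (Q (Suc m)) (\<lambda>(a', b'). prepend m a' (move_past K A B \<psi> as b')) x) =
      tensor_cons m x (pp as c)" if "x \<in> carrier V" for x
    by (rule AB.tensor_eqI[OF module_Q linear_maps_comp[OF AB.tensor_extend_linear[OF module_Q bil] power_right_B_linear] tensor_cons_left])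
      (use as c that in \<open>simp_all add: AB.tensor_extend_pure[OF module_Q bil] pp_closed tensor_cons_pure B_action_pure
        power_right_B_prepend move_past_closed\<close>)
  then show "B_action (Suc m) b (prepend m a (pp as c)) = tensor_cons m (exchange b a) (pp as c)"
    using assms as c tuples_length[OF as]
    by (simp add: prepend_pure B_action_pure tuples_Cons move_past_Cons exchange_closed del: move_past.simps)
qed (use assms in \<open>simp_all add: exchange_closed\<close>)

lemma B_action_0: "b \<in> carrier B \<Longrightarrow> c \<in> carrier B \<Longrightarrow> B_action 0 b (pp [] c) = pp [] (b \<otimes>\<^bsub>B\<^esub> c)"
  by (simp add: B_action_pure power_right_B_pure tuples_0)

lemma B_action_one: "q \<in> carrier (Q m) \<Longrightarrow> B_action m \<one>\<^bsub>B\<^esub> q = q"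
proof (induction m arbitrary: q)
  case 0
  show ?case
    by (rule Q.power_eqI[OF module_Q B_action_linear linear_maps_id _ 0]) (auto simp: tuples_0 B_action_0)
next
  case (Suc m)
  show ?case
    by (rule Q_Suc_eqI[OF module_Q B_action_linear linear_maps_id _ Suc.prems])
      (simp_all add: B_action_prepend exchange_one tensor_cons_pure Suc.IH)
qed

text \<open>This is the balancing property. Associativity of the B-action at level m is a hypothesis
  because it is proved by an induction whose step uses this lemma; afterwards the hypothesis is
  discharged in \<open>tensor_cons_B_action\<close>.\<close>

lemma tensor_cons_right_B:
  assumes B_action: "\<And>b c q. b \<in> carrier B \<Longrightarrow> c \<in> carrier B \<Longrightarrow> q \<in> carrier (Q m) \<Longrightarrow>
      B_action m b (B_action m c q) = B_action m (b \<otimes>\<^bsub>B\<^esub> c) q"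
    and "s \<in> carrier V" "c \<in> carrier B" "q \<in> carrier (Q m)"
  shows "tensor_cons m (right_B c s) q = tensor_cons m s (B_action m c q)"
  by (rule AB.tensor_eqI[OF module_Q linear_maps_comp[OF right_B_linear tensor_cons_left] tensor_cons_left])
    (use assms(2-) in \<open>simp_all add: right_B_pure tensor_cons_pure B_action B_action_closed\<close>)

text \<open>For s = a \<otimes> c, moving b past a gives \<psi>(b \<otimes> a) paired with c q.
  Balancing carries c back into the first factor, where it completes the product of 1 \<otimes> b
  and s.\<close>

lemma B_action_tensor_cons_aux:
  assumes B_action: "\<And>b c q. b \<in> carrier B \<Longrightarrow> c \<in> carrier B \<Longrightarrow> q \<in> carrier (Q m) \<Longrightarrow>
      B_action m b (B_action m c q) = B_action m (b \<otimes>\<^bsub>B\<^esub> c) q"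
    and "s \<in> carrier V" "b \<in> carrier B" "q \<in> carrier (Q m)"
  shows "B_action (Suc m) b (tensor_cons m s q) = tensor_cons m (\<iota> b \<otimes>\<^bsub>S\<^esub> s) q"
  by (rule AB.tensor_eqI[OF module_Q linear_maps_comp[OF tensor_cons_left B_action_linear]
        linear_maps_comp[OF mult_right tensor_cons_left]])
    (use assms(2-) in \<open>simp_all add: tensor_cons_pure B_action_prepend B_action_closed incl_pure tensor_cons_right_B[OF B_action] exchange_closed incl_closed\<close>)

text \<open>On a \<otimes> q the action of c produces \<psi>(c \<otimes> a) paired with q, and b
  then multiplies this first factor inside S. The claim is thereby reduced to an identity in S,
  independent of q.\<close>

lemma B_action_B_action:
  "b \<in> carrier B \<Longrightarrow> c \<in> carrier B \<Longrightarrow> q \<in> carrier (Q m) \<Longrightarrow> B_action m b (B_action m c q) = B_action m (b \<otimes>\<^bsub>B\<^esub> c) q"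
proof (induction m arbitrary: b c q)
  case 0
  show ?case
    by (rule Q.power_eqI[OF module_Q linear_maps_comp[OF B_action_linear B_action_linear] B_action_linear _ 0(3)])
      (use 0 in \<open>auto simp: tuples_0 B_action_0 B.m_assoc\<close>)
next
  case (Suc m)
  show ?case
  proof (rule Q_Suc_eqI[OF module_Q linear_maps_comp[OF B_action_linear B_action_linear] B_action_linear _ Suc.prems(3)])
    fix a q assume a: "a \<in> carrier A" and q: "q \<in> carrier (Q m)"
    \<comment> \<open>Associativity of S for 1 \<otimes> b, 1 \<otimes> c and a \<otimes> 1, since
      \<open>exchange c a\<close> is the product of the last two.\<close>
    have "\<iota> b \<otimes>\<^bsub>S\<^esub> exchange c a = exchange (b \<otimes>\<^bsub>B\<^esub> c) a"
      using Suc.prems(1,2) a by (simp add: incl_mult mult_assoc incl_closed p_closed flip: incl_exchange)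
    then show "B_action (Suc m) b (B_action (Suc m) c (prepend m a q)) = B_action (Suc m) (b \<otimes>\<^bsub>B\<^esub> c) (prepend m a q)"
      using Suc.prems(1,2) a q by (simp add: B_action_prepend B_action_tensor_cons_aux[OF Suc.IH] exchange_closed)
  qed (use Suc.prems in simp_all)
qed

lemmas tensor_cons_B_action = tensor_cons_right_B[OF B_action_B_action, symmetric]
lemmas B_action_tensor_cons = B_action_tensor_cons_aux[OF B_action_B_action]


subsection \<open>The actions on the tensor powers\<close>

text \<open>Written by updates at index 0 and, in \<open>last_mult\<close>, at the last index m, so
  that \<open>multilinear_update\<close> applies; \<open>Suc_tuple_hd\<close> and
  \<open>Suc_tuple_last\<close> translate from the list operations of
  \<open>A_power_B\<close>.\<close>

definition "power_left_A m a = extend_linearly K (Q (Suc m)) (\<lambda>(as, b). pp (as[0 := a \<otimes>\<^bsub>A\<^esub> as ! 0]) b)"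
definition "last_mult m as = extend_linearly K (Q (Suc m)) (\<lambda>(c, b). pp (as[m := as ! m \<otimes>\<^bsub>A\<^esub> c]) b)"

lemma power_left_A_aux: "a \<in> carrier A \<Longrightarrow> multilinear K A B (Suc m) (Q (Suc m)) (\<lambda>as. pp (as[0 := a \<otimes>\<^bsub>A\<^esub> as ! 0]))"
  by (rule multilinear_update[OF pp_multi bilinear_right[OF multA]]) auto

lemma power_left_A_bilinear: "bilinear K A (Q (Suc m)) (Q (Suc m)) (power_left_A m)"
  unfolding power_left_A_def
proof (rule Q.power_extend_parameter[OF module_Q module_A power_left_A_aux])
  fix as b assume as: "as \<in> tuples A (Suc m)" "b \<in> carrier B"
  then show "(\<lambda>a. pp (as[0 := a \<otimes>\<^bsub>A\<^esub> as ! 0]) b) \<in> linear_maps K A (Q (Suc m))"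
    using tuples_nth[OF as(1), of 0]
    by (intro linear_maps_comp[OF bilinear_left[OF multA] multilinear_slot[OF pp_multi]]) auto
qed

lemmas power_left_A_linear = bilinear_right[OF power_left_A_bilinear]

lemma power_left_A_pure: "a \<in> carrier A \<Longrightarrow> as \<in> tuples A (Suc m) \<Longrightarrow> b \<in> carrier B \<Longrightarrow>
    power_left_A m a (pp as b) = pp (as[0 := a \<otimes>\<^bsub>A\<^esub> as ! 0]) b"
  unfolding power_left_A_def by (rule Q.power_extend_pure[OF module_Q power_left_A_aux])

lemma power_left_A_prepend:
  assumes "a \<in> carrier A" "a' \<in> carrier A" "q \<in> carrier (Q m)"
  shows "power_left_A m a (prepend m a' q) = prepend m (a \<otimes>\<^bsub>A\<^esub> a') q"
  by (rule Q.power_eqI[OF module_Q linear_maps_comp[OF prepend_linear power_left_A_linear] prepend_linear])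
    (use assms in \<open>simp_all add: prepend_pure power_left_A_pure tuples_Cons\<close>)

lemma power_left_A_tensor_cons:
  assumes "a \<in> carrier A" "s \<in> carrier V" "q \<in> carrier (Q m)"
  shows "power_left_A m a (tensor_cons m s q) = tensor_cons m (left_A a s) q"
  by (rule AB.tensor_eqI[OF module_Q linear_maps_comp[OF tensor_cons_left power_left_A_linear]
        linear_maps_comp[OF left_A_linear tensor_cons_left]])
    (use assms in \<open>simp_all add: tensor_cons_pure power_left_A_prepend B_action_closed left_A_pure\<close>)

lemma lact_aux: "x \<in> carrier (Q (Suc m)) \<Longrightarrow> bilinear K A B (Q (Suc m)) (\<lambda>a b. power_left_A m a (B_action (Suc m) b x))"
  by (rule bilinear_comp_right[OF power_left_A_bilinear bilinear_left[OF B_action_bilinear]])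

definition "S_left m s x = extend_linearly K (Q (Suc m)) (\<lambda>(a, b). power_left_A m a (B_action (Suc m) b x)) s"

lemma S_left_bilinear: "bilinear K V (Q (Suc m)) (Q (Suc m)) (S_left m)"
  unfolding S_left_def[abs_def]
proof (rule bilinear_flip, rule AB.tensor_extend_parameter[OF module_Q module_Q lact_aux])
  fix a b assume "a \<in> carrier A" "b \<in> carrier B"
  then show "(\<lambda>x. power_left_A m a (B_action (Suc m) b x)) \<in> linear_maps K (Q (Suc m)) (Q (Suc m))"
    by (intro linear_maps_comp[OF B_action_linear power_left_A_linear])
qed

lemma Suc_tuple_hd: "as \<in> tuples A (Suc m) \<Longrightarrow> (a \<otimes>\<^bsub>A\<^esub> hd as) # tl as = as[0 := a \<otimes>\<^bsub>A\<^esub> as ! 0]"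
  by (auto simp: tuples_Suc)

lemma Suc_tuple_last: "length as = Suc m \<Longrightarrow> butlast as @ [f (last as)] = as[m := f (as ! m)]"
  by (cases as rule: rev_cases) auto

text \<open>The innermost sum is \<open>power_left_A\<close> after \<open>power_right_B\<close>;
  feeding it \<Psi>(b \<otimes> as) and summing over x then gives \<open>power_left_A\<close> after
  \<open>B_action\<close>.\<close>

lemma lact_eq:
  assumes s: "s \<in> carrier V" and x: "x \<in> carrier (Q (Suc m))"
  shows "lact (A_power_B K A B \<psi> (Suc m)) s x = S_left m s x"
proof -
  have inner: "extend_linearly K (Q (Suc m)) (\<lambda>(as', b'). pp ((a \<otimes>\<^bsub>A\<^esub> hd as') # tl as') (b' \<otimes>\<^bsub>B\<^esub> c)) y =
      power_left_A m a (power_right_B (Suc m) c y)"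
    if "a \<in> carrier A" "c \<in> carrier B" "y \<in> carrier (Q (Suc m))" for a c y
  proof -
    note mul = multilinear_comp_last[OF power_left_A_aux bilinear_left[OF multB], OF that(1,2)]
    have "extend_linearly K (Q (Suc m)) (\<lambda>(as', b'). pp ((a \<otimes>\<^bsub>A\<^esub> hd as') # tl as') (b' \<otimes>\<^bsub>B\<^esub> c)) y =
      extend_linearly K (Q (Suc m)) (\<lambda>(as', b'). pp (as'[0 := a \<otimes>\<^bsub>A\<^esub> as' ! 0]) (b' \<otimes>\<^bsub>B\<^esub> c)) y"
      by (rule Q.power_extend_cong[OF module_Q _ multilinear_closed[OF mul] that(3)]) (simp add: Suc_tuple_hd)
    also have "\<dots> = power_left_A m a (power_right_B (Suc m) c y)"
      by (rule Q.power_eqI[OF module_Q Q.power_extend_linear[OF module_Q mul]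
            linear_maps_comp[OF power_right_B_linear power_left_A_linear]])
        (use that in \<open>simp_all add: Q.power_extend_pure[OF module_Q mul] power_right_B_pure power_left_A_pure\<close>)
    finally show ?thesis .
  qed
  have middle: "extend_linearly K (Q (Suc m)) (\<lambda>(as, c). extend_linearly K (Q (Suc m))
      (\<lambda>(as', b'). pp ((a \<otimes>\<^bsub>A\<^esub> hd as') # tl as') (b' \<otimes>\<^bsub>B\<^esub> c)) (move_past K A B \<psi> as b)) x =
      power_left_A m a (B_action (Suc m) b x)"
    if "a \<in> carrier A" "b \<in> carrier B" for a b
  proof -
    note mul = multilinear_compose[OF B_action_aux[OF that(2)] power_left_A_linear[OF that(1)]]
    have "extend_linearly K (Q (Suc m)) (\<lambda>(as, c). extend_linearly K (Q (Suc m))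
      (\<lambda>(as', b'). pp ((a \<otimes>\<^bsub>A\<^esub> hd as') # tl as') (b' \<otimes>\<^bsub>B\<^esub> c)) (move_past K A B \<psi> as b)) x =
      extend_linearly K (Q (Suc m)) (\<lambda>(as, c). power_left_A m a (power_right_B (Suc m) c (move_past K A B \<psi> as b))) x"
      by (rule Q.power_extend_cong[OF module_Q _ multilinear_closed[OF mul] x])
        (use that in \<open>simp add: inner move_past_closed\<close>)
    also have "\<dots> = power_left_A m a (B_action (Suc m) b x)"
      by (rule Q.power_eqI[OF module_Q Q.power_extend_linear[OF module_Q mul]
            linear_maps_comp[OF B_action_linear power_left_A_linear] _ x])
        (use that in \<open>simp_all add: Q.power_extend_pure[OF module_Q mul] B_action_pure\<close>)
    finally show ?thesis .
  qed
  show ?thesis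
    unfolding S_left_def A_power_B_def Let_def bimod.select_convs
    by (rule AB.tensor_extend_cong[OF module_Q _ _ s])
      (use middle bilinear_closed[OF lact_aux[OF x]] in blast)+
qed

lemma S_left_pure: "a \<in> carrier A \<Longrightarrow> b \<in> carrier B \<Longrightarrow> x \<in> carrier (Q (Suc m)) \<Longrightarrow>
    S_left m (p a b) x = power_left_A m a (B_action (Suc m) b x)"
  unfolding S_left_def by (rule AB.tensor_extend_pure[OF module_Q lact_aux])

lemma S_left_tensor_cons:
  assumes "s \<in> carrier V" "t \<in> carrier V" "q \<in> carrier (Q m)"
  shows "S_left m s (tensor_cons m t q) = tensor_cons m (s \<otimes>\<^bsub>S\<^esub> t) q"
proof (rule AB.tensor_eqI[OF module_Q bilinear_left[OF S_left_bilinear]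
      linear_maps_comp[OF mult_left tensor_cons_left] _ assms(1)])
  fix a b assume ab: "a \<in> carrier A" "b \<in> carrier B"
  \<comment> \<open>Factors p a b as (a \<otimes> 1)(1 \<otimes> b), matching the two stages in
    which \<open>S_left\<close> acts.\<close>
  have "left_A a (\<iota> b \<otimes>\<^bsub>S\<^esub> t) = p a b \<otimes>\<^bsub>S\<^esub> t"
    using ab assms by (simp add: incl_closed left_A_pure incl_eq factor_closed flip: left_A_mult)
  then show "S_left m (p a b) (tensor_cons m t q) = tensor_cons m (p a b \<otimes>\<^bsub>S\<^esub> t) q"
    using ab assms
    by (simp add: S_left_pure tensor_cons_closed B_action_tensor_cons power_left_A_tensor_cons mult_closed incl_closed)
qed (use assms tensor_cons_closed in simp_all)

section \<open>The right action on tensor powers\<close>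

lemma last_mult_aux:
  assumes as: "as \<in> tuples A (Suc m)"
  shows "bilinear K A B (Q (Suc m)) (\<lambda>c b. pp (as[m := as ! m \<otimes>\<^bsub>A\<^esub> c]) b)"
proof (rule bilinearI)
  have m: "as ! m \<in> carrier A" using tuples_nth[OF as] by simp
  fix c assume "c \<in> carrier A"
  then show "pp (as[m := as ! m \<otimes>\<^bsub>A\<^esub> c]) \<in> linear_maps K B (Q (Suc m))"
    using m by (intro multilinear_last[OF pp_multi] tuples_update[OF as]) simp
next
  have m: "as ! m \<in> carrier A" using tuples_nth[OF as] by simp
  fix b assume "b \<in> carrier B"
  then show "(\<lambda>c. pp (as[m := as ! m \<otimes>\<^bsub>A\<^esub> c]) b) \<in> linear_maps K A (Q (Suc m))"
    by (intro linear_maps_comp[OF bilinear_right[OF multA m] multilinear_slot[OF pp_multi as]]) simp_all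
qed

lemma last_mult_linear: "as \<in> tuples A (Suc m) \<Longrightarrow> last_mult m as \<in> linear_maps K V (Q (Suc m))"
  unfolding last_mult_def by (rule AB.tensor_extend_linear[OF module_Q last_mult_aux])


lemma last_mult_pure: "as \<in> tuples A (Suc m) \<Longrightarrow> c \<in> carrier A \<Longrightarrow> b \<in> carrier B \<Longrightarrow>
    last_mult m as (p c b) = pp (as[m := as ! m \<otimes>\<^bsub>A\<^esub> c]) b"
  unfolding last_mult_def by (rule AB.tensor_extend_pure[OF module_Q last_mult_aux])

lemma last_mult_slot:
  assumes as: "as \<in> tuples A (Suc m)" and i: "i < Suc m" and s: "s \<in> carrier V"
  shows "(\<lambda>a. last_mult m (as[i := a]) s) \<in> linear_maps K A (Q (Suc m))"
proof -
  have "bilinear K A V (Q (Suc m)) (\<lambda>a. last_mult m (as[i := a]))"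
    unfolding last_mult_def
  proof (rule AB.tensor_extend_parameter[OF module_Q module_A last_mult_aux[OF tuples_update[OF as]]])
    fix c b assume c: "c \<in> carrier A" and b: "b \<in> carrier B"
    show "(\<lambda>a. pp (as[i := a, m := as[i := a] ! m \<otimes>\<^bsub>A\<^esub> c]) b) \<in> linear_maps K A (Q (Suc m))"
      by (rule multilinear_slot[OF multilinear_update[OF pp_multi bilinear_left[OF multA c]] as b i]) simp
  qed
  then show ?thesis using s by (rule bilinear_left)
qed

lemma ract_aux:
  assumes "s \<in> carrier V"
  shows "multilinear K A B (Suc m) (Q (Suc m)) (\<lambda>as b. last_mult m as (\<iota> b \<otimes>\<^bsub>S\<^esub> s))"
  unfolding multilinear_def
proof (intro conjI ballI allI impI)
  fix as b i assume "as \<in> tuples A (Suc m)" "b \<in> carrier B" "i < Suc m"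
  then show "(\<lambda>a. last_mult m (as[i := a]) (\<iota> b \<otimes>\<^bsub>S\<^esub> s)) \<in> linear_maps K A (Q (Suc m))"
    by (intro last_mult_slot mult_closed incl_closed assms)
next
  fix as assume as: "as \<in> tuples A (Suc m)"
  show "(\<lambda>b. last_mult m as (\<iota> b \<otimes>\<^bsub>S\<^esub> s)) \<in> linear_maps K B (Q (Suc m))"
    by (rule linear_maps_comp[OF linear_maps_comp[OF incl_linear mult_left[OF assms]] last_mult_linear[OF as]])
qed

text \<open>The sums over s = c \<otimes> d and over \<psi>(b \<otimes> c) in the right action
  together form the product of 1 \<otimes> b and s in S; what remains is to multiply its A-part into
  the last factor.\<close>

definition "S_right m s = extend_linearly K (Q (Suc m)) (\<lambda>(as, b). last_mult m as (\<iota> b \<otimes>\<^bsub>S\<^esub> s))"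

lemma S_right_linear: "s \<in> carrier V \<Longrightarrow> S_right m s \<in> linear_maps K (Q (Suc m)) (Q (Suc m))"
  unfolding S_right_def by (rule Q.power_extend_linear[OF module_Q ract_aux])

lemmas S_right_closed = linear_maps_closed[OF S_right_linear]

lemma S_right_pure: "s \<in> carrier V \<Longrightarrow> as \<in> tuples A (Suc m) \<Longrightarrow> b \<in> carrier B \<Longrightarrow>
    S_right m s (pp as b) = last_mult m as (\<iota> b \<otimes>\<^bsub>S\<^esub> s)"
  unfolding S_right_def by (rule Q.power_extend_pure[OF module_Q ract_aux])

lemma ract_eq:
  assumes s: "s \<in> carrier V" and x: "x \<in> carrier (Q (Suc m))"
  shows "ract (A_power_B K A B \<psi> (Suc m)) x s = S_right m s x"
proof -
  have inner: "extend_linearly K (Q (Suc m)) (\<lambda>(c', b'). pp (butlast as @ [last as \<otimes>\<^bsub>A\<^esub> c']) (b' \<otimes>\<^bsub>B\<^esub> d)) y =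
      last_mult m as (right_B d y)"
    if "as \<in> tuples A (Suc m)" "d \<in> carrier B" "y \<in> carrier V" for as d y
  proof -
    note bil = bilinear_comp_right[OF last_mult_aux bilinear_left[OF multB], OF that(1,2)]
    show ?thesis
      unfolding Suc_tuple_last[OF tuples_length[OF that(1)], of "\<lambda>a. a \<otimes>\<^bsub>A\<^esub> _"]
      by (rule AB.tensor_eqI[OF module_Q AB.tensor_extend_linear[OF module_Q bil]
            linear_maps_comp[OF right_B_linear last_mult_linear]])
        (use that in \<open>simp_all add: AB.tensor_extend_pure[OF module_Q bil] right_B_pure last_mult_pure\<close>)
  qed
  have middle: "extend_linearly K (Q (Suc m)) (\<lambda>(c, d). extend_linearly K (Q (Suc m))
      (\<lambda>(c', b'). pp (butlast as @ [last as \<otimes>\<^bsub>A\<^esub> c']) (b' \<otimes>\<^bsub>B\<^esub> d)) (exchange b c)) s = last_mult m as (\<iota> b \<otimes>\<^bsub>S\<^esub> s)"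
    if as: "as \<in> tuples A (Suc m)" and b: "b \<in> carrier B" for as b
  proof -
    have bil: "bilinear K A B (Q (Suc m)) (\<lambda>c d. last_mult m as (right_B d (exchange b c)))"
      by (rule bilinear_compose[OF bilinear_comp_left[OF bilinear_flip[OF right_B_bilinear]
              bilinear_right[OF exchange_bilinear b]] last_mult_linear[OF as]])
    have "extend_linearly K (Q (Suc m)) (\<lambda>(c, d). extend_linearly K (Q (Suc m))
      (\<lambda>(c', b'). pp (butlast as @ [last as \<otimes>\<^bsub>A\<^esub> c']) (b' \<otimes>\<^bsub>B\<^esub> d)) (exchange b c)) s =
      extend_linearly K (Q (Suc m)) (\<lambda>(c, d). last_mult m as (right_B d (exchange b c))) s"
      by (rule AB.tensor_extend_cong[OF module_Q _ bilinear_closed[OF bil] s])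
        (use as b in \<open>simp add: inner exchange_closed\<close>)
    also have "\<dots> = last_mult m as (\<iota> b \<otimes>\<^bsub>S\<^esub> s)"
      by (rule AB.tensor_eqI[OF module_Q AB.tensor_extend_linear[OF module_Q bil]
            linear_maps_comp[OF mult_right last_mult_linear] _ s])
        (use as b in \<open>simp_all add: AB.tensor_extend_pure[OF module_Q bil] incl_pure incl_closed\<close>)
    finally show ?thesis .
  qed
  show ?thesis
    unfolding S_right_def A_power_B_def Let_def bimod.select_convs exchange_def[symmetric]
    by (rule Q.power_extend_cong[OF module_Q _ _ x])
      (use middle multilinear_closed[OF ract_aux[OF s]] in blast)+
qed

text \<open>The right action touches only the last A-factor and the B-factor, so a new first factor
  is left alone once the tail has at least one factor A, hence \<open>Suc m\<close>.\<close>

lemma S_right_prepend: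
  assumes "s \<in> carrier V" "a \<in> carrier A" "q \<in> carrier (Q (Suc m))"
  shows "S_right (Suc m) s (prepend (Suc m) a q) = prepend (Suc m) a (S_right m s q)"
proof (rule Q.power_eqI[OF module_Q linear_maps_comp[OF prepend_linear S_right_linear]
      linear_maps_comp[OF S_right_linear prepend_linear] _ assms(3)])
  fix as b assume as: "as \<in> tuples A (Suc m)" and b: "b \<in> carrier B"
  have "last_mult (Suc m) (a # as) x = prepend (Suc m) a (last_mult m as x)" if "x \<in> carrier V" for x
    by (rule AB.tensor_eqI[OF module_Q last_mult_linear linear_maps_comp[OF last_mult_linear prepend_linear]])
      (use as assms that tuples_nth[OF as, of m] in
        \<open>simp_all add: last_mult_pure prepend_pure tuples_Cons tuples_update\<close>)
  then show "S_right (Suc m) s (prepend (Suc m) a (pp as b)) = prepend (Suc m) a (S_right m s (pp as b))"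
    using as b assms by (simp add: prepend_pure S_right_pure tuples_Cons mult_closed incl_closed)
qed (use assms in simp_all)

abbreviation "e \<equiv> pp [] \<one>\<^bsub>B\<^esub>"

lemma e_closed: "e \<in> carrier (Q 0)"
  by (simp add: pp_closed tuples_0)

text \<open>Generators of Q_1 come from pure elements of S, which transfers questions about Q_1 to
  the algebra S and supplies the base cases below.\<close>

lemma tensor_cons_e: "a \<in> carrier A \<Longrightarrow> b \<in> carrier B \<Longrightarrow> tensor_cons 0 (p a b) e = pp [a] b"
  by (simp add: tensor_cons_pure e_closed B_action_0 prepend_pure tuples_0)

lemma S_right_e:
  assumes "s \<in> carrier V" "t \<in> carrier V"
  shows "S_right 0 t (tensor_cons 0 s e) = tensor_cons 0 (s \<otimes>\<^bsub>S\<^esub> t) e"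
proof (rule AB.tensor_eqI[OF module_Q linear_maps_comp[OF tensor_cons_left S_right_linear]
      linear_maps_comp[OF mult_left tensor_cons_left] _ assms(1)])
  fix a b assume ab: "a \<in> carrier A" "b \<in> carrier B"
  have a: "[a] \<in> tuples A (Suc 0)" using ab by (simp add: tuples_def)
  have "last_mult 0 [a] x = tensor_cons 0 (left_A a x) e" if "x \<in> carrier V" for x
    by (rule AB.tensor_eqI[OF module_Q last_mult_linear linear_maps_comp[OF left_A_linear tensor_cons_left]])
      (use ab a that in \<open>simp_all add: last_mult_pure left_A_pure tensor_cons_e e_closed\<close>)
  moreover have "left_A a (\<iota> b \<otimes>\<^bsub>S\<^esub> t) = p a b \<otimes>\<^bsub>S\<^esub> t"
    using ab assms by (simp add: incl_closed left_A_pure incl_eq factor_closed flip: left_A_mult)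
  ultimately show "S_right 0 t (tensor_cons 0 (p a b) e) = tensor_cons 0 (p a b \<otimes>\<^bsub>S\<^esub> t) e"
    using ab assms a by (simp add: tensor_cons_e S_right_pure mult_closed incl_closed)
qed (use assms e_closed in simp_all)

text \<open>On Q_1 this is associativity of S. In the step b acts on a \<otimes> q through \<psi>(b
  \<otimes> a) paired with q, and the right action has to reach q through that pairing.\<close>

lemma B_action_S_right:
  "b \<in> carrier B \<Longrightarrow> s \<in> carrier V \<Longrightarrow> q \<in> carrier (Q (Suc m)) \<Longrightarrow>
    B_action (Suc m) b (S_right m s q) = S_right m s (B_action (Suc m) b q)"
proof (induction m arbitrary: b q)
  case 0
  show ?case
  proof (rule Q.power_eqI[OF module_Q linear_maps_comp[OF S_right_linear B_action_linear]
        linear_maps_comp[OF B_action_linear S_right_linear] _ 0(3)])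
    fix as c assume as: "as \<in> tuples A (Suc 0)" and c: "c \<in> carrier B"
    then obtain a where a: "as = [a]" "a \<in> carrier A" by (auto simp: tuples_Suc tuples_0)
    show "B_action (Suc 0) b (S_right 0 s (pp as c)) = S_right 0 s (B_action (Suc 0) b (pp as c))"
      using 0(1,2) a c
      by (simp add: S_right_e B_action_tensor_cons mult_closed incl_closed p_closed e_closed mult_assoc flip: tensor_cons_e)
  qed (use 0 in simp_all)
next
  case (Suc m)
  \<comment> \<open>The statement of \<open>S_right_tensor_cons\<close> at level m, obtained from
    the induction hypothesis; it holds without restriction once the induction is complete.\<close>
  have *: "S_right (Suc m) s (tensor_cons (Suc m) t q) = tensor_cons (Suc m) t (S_right m s q)"
    if "t \<in> carrier V" "q \<in> carrier (Q (Suc m))" for t q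
    by (rule AB.tensor_eqI[OF module_Q linear_maps_comp[OF tensor_cons_left S_right_linear] tensor_cons_left])
      (use Suc that in \<open>simp_all add: tensor_cons_pure S_right_prepend B_action_closed S_right_closed Suc.IH\<close>)
  show ?case
    by (rule Q_Suc_eqI[OF module_Q linear_maps_comp[OF S_right_linear B_action_linear]
          linear_maps_comp[OF B_action_linear S_right_linear] _ Suc.prems(3)])
      (use Suc.prems in \<open>simp_all add: S_right_prepend B_action_prepend S_right_closed * exchange_closed\<close>)
qed

lemma S_right_tensor_cons:
  assumes "s \<in> carrier V" "t \<in> carrier V" "q \<in> carrier (Q (Suc m))"
  shows "S_right (Suc m) s (tensor_cons (Suc m) t q) = tensor_cons (Suc m) t (S_right m s q)"
  by (rule AB.tensor_eqI[OF module_Q linear_maps_comp[OF tensor_cons_left S_right_linear] tensor_cons_left])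
    (use assms in \<open>simp_all add: tensor_cons_pure S_right_prepend B_action_closed S_right_closed B_action_S_right\<close>)

end


lemma submodule_image:
  assumes "module K M" "module K N" "f \<in> linear_maps K M N"
  shows "submodule (f ` carrier M) K N"
proof -
  interpret M: module K M by fact
  interpret N: module K N by fact
  have neg: "\<ominus>\<^bsub>N\<^esub> f x \<in> f ` carrier M" if x: "x \<in> carrier M" for x
  proof (rule image_eqI)
    have "f (\<ominus>\<^bsub>M\<^esub> x) = f ((\<ominus>\<^bsub>K\<^esub> \<one>\<^bsub>K\<^esub>) \<odot>\<^bsub>M\<^esub> x)" using x by (simp add: M.smult_l_minus)
    also have "\<dots> = \<ominus>\<^bsub>N\<^esub> f x"
      using x linear_maps_closed[OF assms(3)] by (simp add: linear_maps_smult[OF assms(3)] N.smult_l_minus)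
    finally show "\<ominus>\<^bsub>N\<^esub> f x = f (\<ominus>\<^bsub>M\<^esub> x)" by simp
  qed (use x in simp)
  show ?thesis
  proof (rule N.submoduleI)
    show "\<zero>\<^bsub>N\<^esub> \<in> f ` carrier M"
      using linear_maps_zero[OF assms] M.zero_closed by (metis image_eqI)
  qed (auto simp: neg linear_maps_closed[OF assms(3)] simp flip: linear_maps_add[OF assms(3)] linear_maps_smult[OF assms(3)])
qed


subsection \<open>Transport and restriction of bimodules\<close>

lemma bimoduleD:
  assumes "bimodule K X Y P"
  shows "assoc_algebra K X" "assoc_algebra K Y" "module K (space P)"
    and "bilinear K X (space P) (space P) (lact P)" "bilinear K (space P) Y (space P) (ract P)"
    and "m \<in> carrier (space P) \<Longrightarrow> lact P \<one>\<^bsub>X\<^esub> m = m" "m \<in> carrier (space P) \<Longrightarrow> ract P m \<one>\<^bsub>Y\<^esub> = m"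
    and "x \<in> carrier X \<Longrightarrow> x' \<in> carrier X \<Longrightarrow> m \<in> carrier (space P) \<Longrightarrow>
      lact P (x \<otimes>\<^bsub>X\<^esub> x') m = lact P x (lact P x' m)"
    and "y \<in> carrier Y \<Longrightarrow> y' \<in> carrier Y \<Longrightarrow> m \<in> carrier (space P) \<Longrightarrow>
      ract P m (y \<otimes>\<^bsub>Y\<^esub> y') = ract P (ract P m y) y'"
    and "x \<in> carrier X \<Longrightarrow> y \<in> carrier Y \<Longrightarrow> m \<in> carrier (space P) \<Longrightarrow>
      ract P (lact P x m) y = lact P x (ract P m y)"
  using assms by (simp_all add: bimodule_def bilinear_def)

lemma bimoduleI:
  assumes "assoc_algebra K X" "assoc_algebra K Y" "module K (space P)"
    and "bilinear K X (space P) (space P) (lact P)" "bilinear K (space P) Y (space P) (ract P)"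
    and "\<And>m. m \<in> carrier (space P) \<Longrightarrow> lact P \<one>\<^bsub>X\<^esub> m = m" "\<And>m. m \<in> carrier (space P) \<Longrightarrow> ract P m \<one>\<^bsub>Y\<^esub> = m"
    and "\<And>x x' m. x \<in> carrier X \<Longrightarrow> x' \<in> carrier X \<Longrightarrow> m \<in> carrier (space P) \<Longrightarrow>
      lact P (x \<otimes>\<^bsub>X\<^esub> x') m = lact P x (lact P x' m)"
    and "\<And>y y' m. y \<in> carrier Y \<Longrightarrow> y' \<in> carrier Y \<Longrightarrow> m \<in> carrier (space P) \<Longrightarrow>
      ract P m (y \<otimes>\<^bsub>Y\<^esub> y') = ract P (ract P m y) y'"
    and "\<And>x y m. x \<in> carrier X \<Longrightarrow> y \<in> carrier Y \<Longrightarrow> m \<in> carrier (space P) \<Longrightarrow>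
      ract P (lact P x m) y = lact P x (ract P m y)"
  shows "bimodule K X Y P"
  using assms by (simp add: bimodule_def bilinear_def)

text \<open>Surjectivity suffices: every argument in Q is an image, and an axiom at images is the
  image of the axiom in P. Only the underlying module of Q has to be known beforehand.\<close>

lemma bimodule_transport:
  assumes P: "bimodule K X Y P" and Q: "module K (space Q)"
    and phi: "\<phi> \<in> linear_maps K (space P) (space Q)" "\<phi> ` carrier (space P) = carrier (space Q)"
    and l: "\<And>x m. x \<in> carrier X \<Longrightarrow> m \<in> carrier (space P) \<Longrightarrow> \<phi> (lact P x m) = lact Q x (\<phi> m)"
    and r: "\<And>y m. y \<in> carrier Y \<Longrightarrow> m \<in> carrier (space P) \<Longrightarrow> \<phi> (ract P m y) = ract Q (\<phi> m) y"
  shows "bimodule K X Y Q"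
proof -
  note P = bimoduleD[OF P]
  interpret X: ring X using P(1) by (simp add: assoc_algebra_def)
  interpret Y: ring Y using P(2) by (simp add: assoc_algebra_def)
  interpret MP: module K "space P" by (rule P(3))
  note lc = bilinear_closed[OF P(4)] and rc = bilinear_closed[OF P(5)]
  have ex: "\<exists>m\<in>carrier (space P). q = \<phi> m" if "q \<in> carrier (space Q)" for q
    using phi(2) that by auto
  note phi_simps = linear_maps_closed[OF phi(1)] linear_maps_add[OF phi(1), symmetric]
    linear_maps_smult[OF phi(1), symmetric]
  show ?thesis
  proof (rule bimoduleI[OF P(1,2) Q])
    show "bilinear K X (space Q) (space Q) (lact Q)"
    proof (rule bilinearI)
      fix x assume x: "x \<in> carrier X"
      show "lact Q x \<in> linear_maps K (space Q) (space Q)"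
        using x by (intro linear_mapsI)
          (auto dest!: ex simp: phi_simps lc linear_maps_add[OF bilinear_right[OF P(4)]]
            linear_maps_smult[OF bilinear_right[OF P(4)]] simp flip: l)
    next
      fix q assume "q \<in> carrier (space Q)"
      then obtain m where m: "m \<in> carrier (space P)" "q = \<phi> m" using ex by blast
      show "(\<lambda>x. lact Q x q) \<in> linear_maps K X (space Q)"
        by (subst linear_maps_cong[where g = "\<lambda>x. \<phi> (lact P x m)"])
          (use P(1) m in \<open>simp_all add: assoc_algebra_def l linear_maps_comp[OF bilinear_left[OF P(4)] phi(1)]\<close>)
    qed
    show "bilinear K (space Q) Y (space Q) (ract Q)"
    proof (rule bilinearI)
      fix y assume y: "y \<in> carrier Y"
      show "(\<lambda>m. ract Q m y) \<in> linear_maps K (space Q) (space Q)"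
        using y by (intro linear_mapsI)
          (auto dest!: ex simp: phi_simps rc linear_maps_add[OF bilinear_left[OF P(5)]]
            linear_maps_smult[OF bilinear_left[OF P(5)]] simp flip: r)
    next
      fix q assume "q \<in> carrier (space Q)"
      then obtain m where m: "m \<in> carrier (space P)" "q = \<phi> m" using ex by blast
      show "ract Q q \<in> linear_maps K Y (space Q)"
        by (subst linear_maps_cong[where g = "\<lambda>y. \<phi> (ract P m y)"])
          (use P(2) m in \<open>simp_all add: assoc_algebra_def r linear_maps_comp[OF bilinear_right[OF P(5)] phi(1)]\<close>)
    qed
  qed (auto dest!: ex simp: lc rc P(6-10) simp flip: l r)
qed

lemma isomorphic_bimodulesI:
  assumes P: "bimodule K X Y P" and Q: "module K (space Q)"
    and phi: "\<phi> \<in> linear_maps K (space P) (space Q)"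
      "bij_betw \<phi> (carrier (space P)) (carrier (space Q))"
    and l: "\<And>x m. x \<in> carrier X \<Longrightarrow> m \<in> carrier (space P) \<Longrightarrow> \<phi> (lact P x m) = lact Q x (\<phi> m)"
    and r: "\<And>y m. y \<in> carrier Y \<Longrightarrow> m \<in> carrier (space P) \<Longrightarrow> \<phi> (ract P m y) = ract Q (\<phi> m) y"
  shows "isomorphic_bimodules K X Y P Q"
  unfolding isomorphic_bimodules_def
  using bimodule_transport[OF P Q phi(1) bij_betw_imp_surj_on[OF phi(2)] l r] P phi l r by blast

lemma bimodule_restrict_left:
  assumes P: "bimodule K X Y P" and Z: "assoc_algebra K Z" and h: "h \<in> linear_maps K Z X"
    and one: "h \<one>\<^bsub>Z\<^esub> = \<one>\<^bsub>X\<^esub>"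
    and mult: "\<And>z z'. z \<in> carrier Z \<Longrightarrow> z' \<in> carrier Z \<Longrightarrow> h (z \<otimes>\<^bsub>Z\<^esub> z') = h z \<otimes>\<^bsub>X\<^esub> h z'"
  shows "bimodule K Z Y (restrict_left h P)"
  using bilinear_comp_left[OF bimoduleD(4)[OF P] h] bimoduleD[OF P] Z one mult linear_maps_closed[OF h]
  by (intro bimoduleI) (simp_all add: restrict_left_def)

lemma bimodule_restrict_right:
  assumes P: "bimodule K X Y P" and Z: "assoc_algebra K Z" and h: "h \<in> linear_maps K Z Y"
    and one: "h \<one>\<^bsub>Z\<^esub> = \<one>\<^bsub>Y\<^esub>"
    and mult: "\<And>z z'. z \<in> carrier Z \<Longrightarrow> z' \<in> carrier Z \<Longrightarrow> h (z \<otimes>\<^bsub>Z\<^esub> z') = h z \<otimes>\<^bsub>Y\<^esub> h z'"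
  shows "bimodule K X Z (restrict_right h P)"
  using bilinear_comp_right[OF bimoduleD(5)[OF P] h] bimoduleD[OF P] Z one mult linear_maps_closed[OF h]
  by (intro bimoduleI) (simp_all add: restrict_right_def)

lemma isomorphic_restrict_left:
  assumes iso: "isomorphic_bimodules K X Y P Q" and Z: "assoc_algebra K Z" and h: "h \<in> linear_maps K Z X"
    and one: "h \<one>\<^bsub>Z\<^esub> = \<one>\<^bsub>X\<^esub>"
    and mult: "\<And>z z'. z \<in> carrier Z \<Longrightarrow> z' \<in> carrier Z \<Longrightarrow> h (z \<otimes>\<^bsub>Z\<^esub> z') = h z \<otimes>\<^bsub>X\<^esub> h z'"
  shows "isomorphic_bimodules K Z Y (restrict_left h P) (restrict_left h Q)"
proof -
  have "bimodule K Z Y (restrict_left h P)" "bimodule K Z Y (restrict_left h Q)"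
    using iso by (auto simp: isomorphic_bimodules_def intro!: bimodule_restrict_left[OF _ Z h one mult])
  then show ?thesis
    using iso linear_maps_closed[OF h] by (auto simp: isomorphic_bimodules_def restrict_left_def)
qed

lemma isomorphic_restrict_right:
  assumes iso: "isomorphic_bimodules K X Y P Q" and Z: "assoc_algebra K Z" and h: "h \<in> linear_maps K Z Y"
    and one: "h \<one>\<^bsub>Z\<^esub> = \<one>\<^bsub>Y\<^esub>"
    and mult: "\<And>z z'. z \<in> carrier Z \<Longrightarrow> z' \<in> carrier Z \<Longrightarrow> h (z \<otimes>\<^bsub>Z\<^esub> z') = h z \<otimes>\<^bsub>Y\<^esub> h z'"
  shows "isomorphic_bimodules K X Z (restrict_right h P) (restrict_right h Q)"
proof -
  have "bimodule K X Z (restrict_right h P)" "bimodule K X Z (restrict_right h Q)"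
    using iso by (auto simp: isomorphic_bimodules_def intro!: bimodule_restrict_right[OF _ Z h one mult])
  then show ?thesis
    using iso linear_maps_closed[OF h] by (auto simp: isomorphic_bimodules_def restrict_right_def)
qed

lemma bimodule_regular:
  assumes "assoc_algebra K X"
  shows "bimodule K X X (regular_bimodule X)"
proof -
  interpret ring X using assms by (simp add: assoc_algebra_def)
  show ?thesis
    using assms assoc_algebra_mult_bilinear[OF assms]
    by (intro bimoduleI) (simp_all add: regular_bimodule_def m_assoc assoc_algebra_def)
qed

text \<open>The map h must commute with the left B-action only if slot j has a left neighbour, and
  with the right one only if it has a right neighbour. Hence left multiplication by S is allowed in
  the first slot and right multiplication in the last.\<close>

lemma (in balanced) balanced_multilinear_update:
  assumes f: "balanced_multilinear K B P n N f" and h: "h \<in> linear_maps K (space P) (space P)" and j: "j < n"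
    and left: "\<And>b q. 0 < j \<Longrightarrow> b \<in> carrier B \<Longrightarrow> q \<in> carrier (space P) \<Longrightarrow> h (lact P b q) = lact P b (h q)"
    and right: "\<And>b q. Suc j < n \<Longrightarrow> b \<in> carrier B \<Longrightarrow> q \<in> carrier (space P) \<Longrightarrow> h (ract P q b) = ract P (h q) b"
  shows "balanced_multilinear K B P n N (\<lambda>ms. f (ms[j := h (ms ! j)]))"
proof -
  note hc = linear_maps_closed[OF h]
  have upd: "ms[j := h (ms ! j)] \<in> tuples (space P) n" if "ms \<in> tuples (space P) n" for ms
    using that by (intro tuples_update hc tuples_nth[OF that j])
  show ?thesis
    unfolding balanced_multilinear_def
  proof (intro conjI ballI allI impI)
    show "(\<lambda>ms. f (ms[j := h (ms ! j)])) \<in> tuples (space P) n \<rightarrow> carrier N"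
      using balanced_multilinear_closed[OF f] upd by blast
  next
    fix ms i assume ms: "ms \<in> tuples (space P) n" and i: "i < n"
    show "(\<lambda>m. f (ms[i := m, j := h (ms[i := m] ! j)])) \<in> linear_maps K (space P) N"
    proof (cases "i = j")
      case True
      then show ?thesis
        using linear_maps_comp[OF h balanced_multilinear_slot[OF f ms i]] tuples_length[OF ms] i by simp
    next
      case False
      then show ?thesis
        using balanced_multilinear_slot[OF f upd[OF ms] i] by (simp add: list_update_swap)
    qed
  next
    fix ms i u b q
    assume ms: "ms \<in> tuples (space P) n" and i: "Suc i < n" and u: "u \<in> carrier (space P)"
      and b: "b \<in> carrier B" and q: "q \<in> carrier (space P)"
    note len = tuples_length[OF ms]
    \<comment> \<open>The modified slot is the left partner of the balancing relation, its right
      partner, or neither; in the last case the updates commute.\<close>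
    consider "j = i" | "j = Suc i" | "j \<noteq> i" "j \<noteq> Suc i" by blast
    then show "f (ms[i := ract P u b, Suc i := q, j := h (ms[i := ract P u b, Suc i := q] ! j)]) =
      f (ms[i := u, Suc i := lact P b q, j := h (ms[i := u, Suc i := lact P b q] ! j)])"
    proof cases
      case 1
      then show ?thesis
        using balanced_multilinear_swap[OF f ms i hc[OF u] b q] right b u i len
        by (simp add: list_update_swap)
    next
      case 2
      then show ?thesis
        using balanced_multilinear_swap[OF f ms i u b hc[OF q]] left b q i len by simp
    next
      case 3
      then show ?thesis
        using balanced_multilinear_swap[OF f upd[OF ms] i u b q] by (simp add: list_update_swap)
    qed
  qed
qed


subsection \<open>The balanced powers of the factorisation algebra\<close>

context factorisation_setup
begin

abbreviation "PB \<equiv> factorisation_BB K A B \<psi>"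
abbreviation "BP \<equiv> balanced_power K B PB"
abbreviation "pb \<equiv> pure_balanced K B PB"

lemma space_PB: "space PB = S" and lact_PB: "lact PB b s = \<iota> b \<otimes>\<^bsub>S\<^esub> s" and ract_PB: "ract PB s b = s \<otimes>\<^bsub>S\<^esub> \<iota> b"
  by (simp_all add: factorisation_BB_def restrict_left_def restrict_right_def regular_bimodule_def)

lemma tuples_PB: "tuples (space PB) n = tuples V n"
  by (simp add: tuples_def space_PB carrier_S)

lemma carrier_PB: "carrier (space PB) = carrier V"
  by (simp add: space_PB carrier_S)

lemma linear_maps_PB: "linear_maps K (space PB) N = linear_maps K V N" "linear_maps K N (space PB) = linear_maps K N V"
  by (simp_all add: space_PB linear_maps_S)

sublocale PB: balanced K B PB
  by (rule balanced.intro) (simp_all add: carrier_PB lact_PB ract_PB mult_closed incl_closed, simp add: space_PB module_S)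

lemmas module_BP = PB.module_balanced_power
lemmas pb_slot = balanced_multilinear_slot[OF PB.pure_balanced_multilinear, unfolded tuples_PB linear_maps_PB]
lemmas pb_swap = balanced_multilinear_swap[OF PB.pure_balanced_multilinear,
    unfolded tuples_PB carrier_PB lact_PB ract_PB]
lemmas BP_eqI = PB.balanced_eqI[unfolded tuples_PB]
lemmas BP_extend_pure = PB.balanced_extend_pure[unfolded tuples_PB]

lemma balanced_left_aux:
  assumes "s \<in> carrier V"
  shows "balanced_multilinear K B PB (Suc m) (BP (Suc m)) (\<lambda>ss. pb (ss[0 := s \<otimes>\<^bsub>S\<^esub> ss ! 0]))"
  by (rule PB.balanced_multilinear_update[OF PB.pure_balanced_multilinear])
    (use assms in \<open>simp_all add: carrier_PB linear_maps_PB ract_PB mult_right mult_assoc incl_closed\<close>)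

lemma balanced_right_aux:
  assumes "s \<in> carrier V"
  shows "balanced_multilinear K B PB (Suc m) (BP (Suc m)) (\<lambda>ss. pb (ss[m := ss ! m \<otimes>\<^bsub>S\<^esub> s]))"
  by (rule PB.balanced_multilinear_update[OF PB.pure_balanced_multilinear, where h = "\<lambda>t. t \<otimes>\<^bsub>S\<^esub> s"])
    (use assms in \<open>simp_all add: carrier_PB linear_maps_PB lact_PB mult_left mult_assoc incl_closed\<close>)

definition "balanced_left m s = extend_linearly K (BP (Suc m)) (\<lambda>ss. pb (ss[0 := s \<otimes>\<^bsub>S\<^esub> ss ! 0]))"
definition "balanced_right m s = extend_linearly K (BP (Suc m)) (\<lambda>ss. pb (ss[m := ss ! m \<otimes>\<^bsub>S\<^esub> s]))"

lemma balanced_left_bilinear: "bilinear K V (BP (Suc m)) (BP (Suc m)) (balanced_left m)"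
  unfolding balanced_left_def
proof (rule PB.balanced_extend_parameter[OF module_BP module_V balanced_left_aux])
  fix ss assume "ss \<in> tuples (space PB) (Suc m)"
  then have ss: "ss \<in> tuples V (Suc m)" by (simp add: tuples_PB)
  show "(\<lambda>s. pb (ss[0 := s \<otimes>\<^bsub>S\<^esub> ss ! 0])) \<in> linear_maps K V (BP (Suc m))"
    by (rule linear_maps_comp[OF mult_left[OF tuples_nth[OF ss]] pb_slot[OF ss]]) simp_all
qed

lemma balanced_right_bilinear: "bilinear K V (BP (Suc m)) (BP (Suc m)) (balanced_right m)"
  unfolding balanced_right_def
proof (rule PB.balanced_extend_parameter[OF module_BP module_V balanced_right_aux])
  fix ss assume "ss \<in> tuples (space PB) (Suc m)"
  then have ss: "ss \<in> tuples V (Suc m)" by (simp add: tuples_PB)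
  show "(\<lambda>s. pb (ss[m := ss ! m \<otimes>\<^bsub>S\<^esub> s])) \<in> linear_maps K V (BP (Suc m))"
    by (rule linear_maps_comp[OF mult_right[OF tuples_nth[OF ss]] pb_slot[OF ss]]) simp_all
qed

lemma balanced_left_pure: "s \<in> carrier V \<Longrightarrow> ss \<in> tuples V (Suc m) \<Longrightarrow> balanced_left m s (pb ss) = pb (ss[0 := s \<otimes>\<^bsub>S\<^esub> ss ! 0])"
  unfolding balanced_left_def by (rule BP_extend_pure[OF module_BP balanced_left_aux])

lemma balanced_right_pure: "s \<in> carrier V \<Longrightarrow> ss \<in> tuples V (Suc m) \<Longrightarrow> balanced_right m s (pb ss) = pb (ss[m := ss ! m \<otimes>\<^bsub>S\<^esub> s])"
  unfolding balanced_right_def by (rule BP_extend_pure[OF module_BP balanced_right_aux])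

lemmas balanced_left_linear = bilinear_right[OF balanced_left_bilinear]
lemmas balanced_right_linear = bilinear_right[OF balanced_right_bilinear]
lemmas balanced_left_closed = bilinear_closed[OF balanced_left_bilinear]
lemmas balanced_right_closed = bilinear_closed[OF balanced_right_bilinear]

lemma space_S_power: "space (S_power K A B \<psi> n) = BP n"
  by (simp add: S_power_def Let_def)

lemma lact_S_power:
  assumes "s \<in> carrier V" "x \<in> carrier (BP (Suc m))"
  shows "lact (S_power K A B \<psi> (Suc m)) s x = balanced_left m s x"
  unfolding S_power_def balanced_left_def Let_def bimod.select_convs
proof (rule PB.balanced_extend_cong[OF module_BP _ _ assms(2)])
  fix ss assume "ss \<in> tuples (space PB) (Suc m)"
  then show "pb (s \<otimes>\<^bsub>S\<^esub> hd ss # tl ss) = pb (ss[0 := s \<otimes>\<^bsub>S\<^esub> ss ! 0])"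
    and "pb (ss[0 := s \<otimes>\<^bsub>S\<^esub> ss ! 0]) \<in> carrier (BP (Suc m))"
    using balanced_multilinear_closed[OF balanced_left_aux[OF assms(1)]] by (auto simp: tuples_Suc)
qed

lemma ract_S_power:
  assumes "s \<in> carrier V" "x \<in> carrier (BP (Suc m))"
  shows "ract (S_power K A B \<psi> (Suc m)) x s = balanced_right m s x"
  unfolding S_power_def balanced_right_def Let_def bimod.select_convs
proof (rule PB.balanced_extend_cong[OF module_BP _ _ assms(2)])
  fix ss assume ss: "ss \<in> tuples (space PB) (Suc m)"
  show "pb (butlast ss @ [last ss \<otimes>\<^bsub>S\<^esub> s]) = pb (ss[m := ss ! m \<otimes>\<^bsub>S\<^esub> s])"
    using Suc_tuple_last[OF tuples_length[OF ss], of "\<lambda>t. t \<otimes>\<^bsub>S\<^esub> s"] by simp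
  show "pb (ss[m := ss ! m \<otimes>\<^bsub>S\<^esub> s]) \<in> carrier (BP (Suc m))"
    using balanced_multilinear_closed[OF balanced_right_aux[OF assms(1)] ss] .
qed

lemma tuple_mult_left: "s \<in> carrier V \<Longrightarrow> ss \<in> tuples V (Suc m) \<Longrightarrow> ss[0 := s \<otimes>\<^bsub>S\<^esub> ss ! 0] \<in> tuples V (Suc m)"
  using tuples_nth[of ss V "Suc m" 0] by (intro tuples_update mult_closed) auto

lemma tuple_mult_right: "s \<in> carrier V \<Longrightarrow> ss \<in> tuples V (Suc m) \<Longrightarrow> ss[m := ss ! m \<otimes>\<^bsub>S\<^esub> s] \<in> tuples V (Suc m)"
  using tuples_nth[of ss V "Suc m" m] by (intro tuples_update mult_closed) auto

lemma bimodule_S_power: "bimodule K S S (S_power K A B \<psi> (Suc m))" (is "bimodule K S S ?P")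
proof (rule bimoduleI[OF algebra_S algebra_S])
  show "module K (space ?P)" by (simp add: space_S_power module_BP)
  show "bilinear K S (space ?P) (space ?P) (lact ?P)"
    unfolding space_S_power bilinear_S
    by (rule bilinear_cong[OF module_V module_BP _ balanced_left_bilinear]) (rule lact_S_power)
  show "bilinear K (space ?P) S (space ?P) (ract ?P)"
    unfolding space_S_power bilinear_S
    by (rule bilinear_cong[OF module_BP module_V _ bilinear_flip[OF balanced_right_bilinear]]) (rule ract_S_power)
next
  fix x assume "x \<in> carrier (space ?P)"
  then have x: "x \<in> carrier (BP (Suc m))" by (simp add: space_S_power)
  have one: "\<one>\<^bsub>S\<^esub> \<in> carrier V" by (simp add: one_S p_closed)
  have "balanced_left m \<one>\<^bsub>S\<^esub> x = x"
    by (rule BP_eqI[OF module_BP balanced_left_linear[OF one] linear_maps_id _ x])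
      (simp add: balanced_left_pure one tuples_nth, simp add: one_S mult_one_left tuples_nth)
  then show "lact ?P \<one>\<^bsub>S\<^esub> x = x" by (simp add: lact_S_power one x)
  have "balanced_right m \<one>\<^bsub>S\<^esub> x = x"
    by (rule BP_eqI[OF module_BP balanced_right_linear[OF one] linear_maps_id _ x])
      (simp add: balanced_right_pure one tuples_nth, simp add: one_S mult_one_right tuples_nth)
  then show "ract ?P x \<one>\<^bsub>S\<^esub> = x" by (simp add: ract_S_power one x)
next
  fix s t x assume "s \<in> carrier S" "t \<in> carrier S" "x \<in> carrier (space ?P)"
  then have st: "s \<in> carrier V" "t \<in> carrier V" and x: "x \<in> carrier (BP (Suc m))"
    by (simp_all add: space_S_power carrier_S)
  note st_closed = mult_closed[OF st]
  have "balanced_left m (s \<otimes>\<^bsub>S\<^esub> t) x = balanced_left m s (balanced_left m t x)"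
    by (rule BP_eqI[OF module_BP balanced_left_linear[OF st_closed]
          linear_maps_comp[OF balanced_left_linear[OF st(2)] balanced_left_linear[OF st(1)]] _ x])
      (simp add: balanced_left_pure st st_closed tuple_mult_left tuples_nth tuples_length mult_assoc)
  then show "lact ?P (s \<otimes>\<^bsub>S\<^esub> t) x = lact ?P s (lact ?P t x)"
    by (simp add: lact_S_power st st_closed x balanced_left_closed)
  have "balanced_right m (s \<otimes>\<^bsub>S\<^esub> t) x = balanced_right m t (balanced_right m s x)"
    by (rule BP_eqI[OF module_BP balanced_right_linear[OF st_closed]
          linear_maps_comp[OF balanced_right_linear[OF st(1)] balanced_right_linear[OF st(2)]] _ x])
      (simp add: balanced_right_pure st st_closed tuple_mult_right tuples_nth tuples_length mult_assoc)
  then show "ract ?P x (s \<otimes>\<^bsub>S\<^esub> t) = ract ?P (ract ?P x s) t"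
    by (simp add: ract_S_power st st_closed x balanced_right_closed)
  have "balanced_right m t (balanced_left m s x) = balanced_left m s (balanced_right m t x)"
  proof (rule BP_eqI[OF module_BP linear_maps_comp[OF balanced_left_linear[OF st(1)] balanced_right_linear[OF st(2)]]
        linear_maps_comp[OF balanced_right_linear[OF st(2)] balanced_left_linear[OF st(1)]] _ x])
    fix ss assume ss: "ss \<in> tuples V (Suc m)"
    show "balanced_right m t (balanced_left m s (pb ss)) = balanced_left m s (balanced_right m t (pb ss))"
      using ss st tuples_length[OF ss] tuples_nth[OF ss, of 0]
      \<comment> \<open>With a single factor both actions hit the same slot and associativity of S
        is needed; otherwise the slots are distinct and the updates commute.\<close>
      by (cases "m = 0")
        (simp_all add: balanced_left_pure balanced_right_pure tuple_mult_left tuple_mult_right mult_assoc list_update_swap)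
  qed
  then show "ract ?P (lact ?P s x) t = lact ?P s (ract ?P x t)"
    by (simp add: lact_S_power ract_S_power st x balanced_left_closed balanced_right_closed)
qed


subsection \<open>The isomorphism\<close>

primrec collapse_list where
  "collapse_list [] = e"
| "collapse_list (s # ss) = tensor_cons (length ss) s (collapse_list ss)"

lemma collapse_list_closed: "ss \<in> tuples V n \<Longrightarrow> collapse_list ss \<in> carrier (Q n)"
proof (induction ss arbitrary: n)
  case Nil
  then show ?case using e_closed by (simp add: tuples_def)
next
  case (Cons s ss)
  then obtain m where "n = Suc m" "s \<in> carrier V" "ss \<in> tuples V m" by (auto simp: tuples_def)
  then show ?case using Cons.IH[of m] by (simp add: tensor_cons_closed tuples_length)
qed

lemma collapse_list_slot: "ss \<in> tuples V n \<Longrightarrow> i < n \<Longrightarrow> (\<lambda>s. collapse_list (ss[i := s])) \<in> linear_maps K V (Q n)"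
proof (induction ss arbitrary: n i)
  case Nil
  then show ?case by (simp add: tuples_def)
next
  case (Cons s ss)
  then obtain m where m: "n = Suc m" and s: "s \<in> carrier V" and ss: "ss \<in> tuples V m"
    by (auto simp: tuples_def)
  show ?case
  proof (cases i)
    case 0
    then show ?thesis
      using tensor_cons_left[OF collapse_list_closed[OF ss]] by (simp add: m tuples_length[OF ss])
  next
    case (Suc i')
    then have "i' < m" using Cons.prems m by simp
    from linear_maps_comp[OF Cons.IH[OF ss this] tensor_cons_right[OF s]] show ?thesis
      by (simp add: m Suc tuples_length[OF ss])
  qed
qed

text \<open>For i = 0, balancing moves b from the first factor onto the collapsed tail, where
  \<open>B_action_tensor_cons\<close> absorbs it into the next factor. Larger i reduce to the
  tail.\<close>

lemma collapse_list_swap: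
  assumes "s \<in> carrier V" "b \<in> carrier B" "t \<in> carrier V"
  shows "ss \<in> tuples V n \<Longrightarrow> Suc i < n \<Longrightarrow>
    collapse_list (ss[i := s \<otimes>\<^bsub>S\<^esub> \<iota> b, Suc i := t]) = collapse_list (ss[i := s, Suc i := \<iota> b \<otimes>\<^bsub>S\<^esub> t])"
proof (induction ss arbitrary: n i)
  case Nil
  then show ?case by (simp add: tuples_def)
next
  case (Cons r ss)
  then obtain m where m: "n = Suc m" and ss: "ss \<in> tuples V m" by (auto simp: tuples_def)
  show ?case
  proof (cases i)
    case 0
    then obtain k where k: "m = Suc k" using Cons.prems m by (cases m) auto
    then obtain r' ss' where ss': "ss = r' # ss'" "ss' \<in> tuples V k" using ss by (auto simp: tuples_Suc)
    show ?thesis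
      using assms collapse_list_closed[OF ss'(2)] tuples_length[OF ss'(2)]
      by (simp add: 0 ss'(1) mult_incl tensor_cons_closed B_action_tensor_cons flip: tensor_cons_B_action)
  next
    case (Suc i')
    then show ?thesis using Cons.IH[OF ss, of i'] Cons.prems m by simp
  qed
qed

lemma collapse_list_balanced: "balanced_multilinear K B PB n (Q n) collapse_list"
  unfolding balanced_multilinear_def tuples_PB carrier_PB linear_maps_PB lact_PB ract_PB
  by (intro conjI ballI allI impI collapse_list_slot collapse_list_swap) (auto intro: collapse_list_closed)

definition "collapse n = extend_linearly K (Q n) collapse_list"

lemma collapse_linear: "collapse n \<in> linear_maps K (BP n) (Q n)"
  unfolding collapse_def by (rule PB.balanced_extend_linear[OF module_Q collapse_list_balanced])

lemma collapse_pure: "ss \<in> tuples V n \<Longrightarrow> collapse n (pb ss) = collapse_list ss"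
  unfolding collapse_def by (rule BP_extend_pure[OF module_Q collapse_list_balanced])

lemma collapse_left:
  assumes s: "s \<in> carrier V" and x: "x \<in> carrier (BP (Suc m))"
  shows "collapse (Suc m) (balanced_left m s x) = S_left m s (collapse (Suc m) x)"
proof (rule BP_eqI[OF module_Q linear_maps_comp[OF balanced_left_linear[OF s] collapse_linear]
      linear_maps_comp[OF collapse_linear bilinear_right[OF S_left_bilinear s]] _ x])
  fix ss assume ss: "ss \<in> tuples V (Suc m)"
  then obtain t ss' where t: "ss = t # ss'" "t \<in> carrier V" "ss' \<in> tuples V m" by (auto simp: tuples_Suc)
  show "collapse (Suc m) (balanced_left m s (pb ss)) = S_left m s (collapse (Suc m) (pb ss))"
    using s ss tuple_mult_left[OF s ss] collapse_list_closed[OF t(3)] tuples_length[OF t(3)] t(2)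
    by (simp add: balanced_left_pure collapse_pure) (simp add: t(1) S_left_tensor_cons)
qed

text \<open>The right factor is pulled out of the innermost pairing by \<open>S_right_e\<close> and
  then passes outwards through each \<open>tensor_cons\<close>.\<close>

lemma collapse_list_right:
  "ss \<in> tuples V (Suc m) \<Longrightarrow> s \<in> carrier V \<Longrightarrow> collapse_list (ss[m := ss ! m \<otimes>\<^bsub>S\<^esub> s]) = S_right m s (collapse_list ss)"
proof (induction m arbitrary: ss)
  case 0
  then show ?case by (auto simp: tuples_Suc tuples_0 S_right_e)
next
  case (Suc m)
  then obtain t ss' where t: "ss = t # ss'" "t \<in> carrier V" "ss' \<in> tuples V (Suc m)"
    by (subst (asm) tuples_Suc) auto
  then show ?case
    using Suc.IH[OF t(3) Suc.prems(2)] tuples_length[OF t(3)] collapse_list_closed[OF t(3)] Suc.prems(2)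
    by (simp add: S_right_tensor_cons)
qed

lemma collapse_right:
  assumes s: "s \<in> carrier V" and x: "x \<in> carrier (BP (Suc m))"
  shows "collapse (Suc m) (balanced_right m s x) = S_right m s (collapse (Suc m) x)"
  by (rule BP_eqI[OF module_Q linear_maps_comp[OF balanced_right_linear[OF s] collapse_linear]
        linear_maps_comp[OF collapse_linear S_right_linear[OF s]] _ x])
    (use s in \<open>simp add: balanced_right_pure collapse_pure tuple_mult_right collapse_list_right\<close>)

definition "spread_list m as b = (map (\<lambda>a. p a \<one>\<^bsub>B\<^esub>) as)[m := p (as ! m) b]"
definition "spread m = extend_linearly K (BP (Suc m)) (\<lambda>(as, b). pb (spread_list m as b))"

lemma map_tuple: "as \<in> tuples A n \<Longrightarrow> map (\<lambda>a. p a \<one>\<^bsub>B\<^esub>) as \<in> tuples V n"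
  by (auto simp: tuples_def p_closed)

lemma spread_list_tuple: "as \<in> tuples A (Suc m) \<Longrightarrow> b \<in> carrier B \<Longrightarrow> spread_list m as b \<in> tuples V (Suc m)"
  unfolding spread_list_def by (intro tuples_update map_tuple p_closed tuples_nth[OF _ lessI]) simp_all

lemma spread_multilinear: "multilinear K A B (Suc m) (BP (Suc m)) (\<lambda>as b. pb (spread_list m as b))"
  unfolding multilinear_def
proof (intro conjI ballI allI impI)
  fix as b i assume as: "as \<in> tuples A (Suc m)" and b: "b \<in> carrier B" and i: "i < Suc m"
  note len = tuples_length[OF as]
  have am: "as ! m \<in> carrier A" using tuples_nth[OF as] by simp
  show "(\<lambda>a. pb (spread_list m (as[i := a]) b)) \<in> linear_maps K A (BP (Suc m))"
  proof (cases "i = m")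
    \<comment> \<open>In the last slot the new entry also appears in the mapped list, but the final
      update overwrites it there.\<close>
    case True
    then show ?thesis
      using linear_maps_comp[OF bilinear_left[OF AB.pure_tensor_bilinear b] pb_slot[OF map_tuple[OF as], of m]] len
      by (simp add: spread_list_def map_update)
  next
    case False
    then show ?thesis
      using linear_maps_comp[OF bilinear_left[OF AB.pure_tensor_bilinear B.one_closed] pb_slot[OF spread_list_tuple[OF as b] i]]
      by (simp add: spread_list_def map_update list_update_swap)
  qed
next
  fix as assume as: "as \<in> tuples A (Suc m)"
  have am: "as ! m \<in> carrier A" using tuples_nth[OF as] by simp
  show "(\<lambda>b. pb (spread_list m as b)) \<in> linear_maps K B (BP (Suc m))"
    unfolding spread_list_def
    by (rule linear_maps_comp[OF bilinear_right[OF AB.pure_tensor_bilinear am] pb_slot[OF map_tuple[OF as]]]) simp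
qed

lemma spread_linear: "spread m \<in> linear_maps K (Q (Suc m)) (BP (Suc m))"
  unfolding spread_def by (rule Q.power_extend_linear[OF module_BP spread_multilinear])

lemma spread_pure: "as \<in> tuples A (Suc m) \<Longrightarrow> b \<in> carrier B \<Longrightarrow> spread m (pp as b) = pb (spread_list m as b)"
  unfolding spread_def by (rule Q.power_extend_pure[OF module_BP spread_multilinear])

text \<open>Each entry before the last is a \<otimes> 1, and 1 acts trivially on the collapsed tail,
  so only prepending of a is left.\<close>

lemma collapse_list_spread_list: "as \<in> tuples A (Suc m) \<Longrightarrow> b \<in> carrier B \<Longrightarrow> collapse_list (spread_list m as b) = pp as b"
proof (induction m arbitrary: as)
  case 0
  then show ?case by (auto simp: tuples_Suc tuples_0 spread_list_def tensor_cons_e)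
next
  case (Suc m)
  then obtain a as' where a: "as = a # as'" "a \<in> carrier A" "as' \<in> tuples A (Suc m)"
    by (subst (asm) tuples_Suc) auto
  have "spread_list (Suc m) as b = p a \<one>\<^bsub>B\<^esub> # spread_list m as' b"
    by (simp add: a(1) spread_list_def)
  moreover have "length (spread_list m as' b) = Suc m"
    using tuples_length[OF a(3)] by (simp add: spread_list_def)
  ultimately show ?case
    using Suc.IH[OF a(3) Suc.prems(2)] a Suc.prems(2)
    by (simp add: tensor_cons_pure pp_closed B_action_one prepend_pure)
qed

lemma collapse_spread: "q \<in> carrier (Q (Suc m)) \<Longrightarrow> collapse (Suc m) (spread m q) = q"
  by (rule Q.power_eqI[OF module_Q linear_maps_comp[OF spread_linear collapse_linear] linear_maps_id])
    (simp_all add: spread_pure collapse_pure spread_list_tuple collapse_list_spread_list)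

text \<open>Lets one slot of a balanced tensor be treated as if its entry were pure, although a
  general element of S is a sum.\<close>

lemma linear_image_in_submodule:
  assumes "module K N" "f \<in> linear_maps K V N" "submodule U K N"
    and "\<And>a b. a \<in> carrier A \<Longrightarrow> b \<in> carrier B \<Longrightarrow> f (p a b) \<in> U" "s \<in> carrier V"
  shows "f s \<in> U"
proof -
  interpret N: module K N by fact
  note E = N.submoduleE[OF assms(3)]
  show ?thesis using assms(5)
    by (induction rule: AB.tensor_induct)
      (simp_all add: linear_maps_zero[OF module_V assms(1,2)] submodule_zero[OF assms(3)] E(4,5) assms(4)
        linear_maps_add[OF assms(2)] linear_maps_smult[OF assms(2)])
qed

text \<open>The \<open>B\<close>-components are moved to the right one slot at a time, through
  \<open>(a \<otimes> b) \<otimes>\<^sub>B t = (a \<otimes> 1) \<otimes>\<^sub>B b t\<close>.\<close>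

lemma pb_in_range_spread:
  assumes "i \<le> m" "ss \<in> tuples V (Suc m)" "\<forall>j<i. \<exists>a\<in>carrier A. ss ! j = p a \<one>\<^bsub>B\<^esub>"
  shows "pb ss \<in> spread m ` carrier (Q (Suc m))" (is "_ \<in> ?U")
  \<comment> \<open>Downward induction on the length i of the prefix already in A \<otimes> 1: the
    base is i = m, where only the last slot is unrestricted.\<close>
  using assms
proof (induction i arbitrary: ss rule: inc_induct)
  case base
  note ss = base(1)
  note len = tuples_length[OF ss]
  \<comment> \<open>The A-components of all slots but the last, from which the preimage under
    \<open>spread\<close> is assembled.\<close>
  obtain g where g: "\<forall>j<m. g j \<in> carrier A \<and> ss ! j = p (g j) \<one>\<^bsub>B\<^esub>" using base(2) by metis
  have "pb (ss[m := s]) \<in> ?U" if "s \<in> carrier V" for s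
  proof (rule linear_image_in_submodule[OF module_BP pb_slot[OF ss] submodule_image[OF module_Q module_BP spread_linear] _ that])
    fix a b assume ab: "a \<in> carrier A" "b \<in> carrier B"
    let ?as = "map g [0..<m] @ [a]"
    have as: "?as \<in> tuples A (Suc m)" using g ab by (auto simp: tuples_def)
    have "spread_list m ?as b = ss[m := p a b]"
      using len g by (intro nth_equalityI) (auto simp: spread_list_def nth_append nth_list_update less_Suc_eq)
    then show "pb (ss[m := p a b]) \<in> ?U"
      using spread_pure[OF as ab(2)] pp_closed[OF as ab(2)] by (metis image_eqI)
  qed simp
  from this[OF tuples_nth[OF ss, of m]] show ?case by simp
next
  case (step i)
  note ss = step.prems(1)
  note len = tuples_length[OF ss]
  have i: "i < Suc m" "Suc i < Suc m" using step.hyps by simp_all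
  have next_slot: "ss ! Suc i \<in> carrier V" using tuples_nth[OF ss i(2)] .
  have "pb (ss[i := s]) \<in> ?U" if "s \<in> carrier V" for s
  proof (rule linear_image_in_submodule[OF module_BP pb_slot[OF ss i(1)] submodule_image[OF module_Q module_BP spread_linear] _ that])
    fix a b assume ab: "a \<in> carrier A" "b \<in> carrier B"
    let ?ss = "ss[i := p a \<one>\<^bsub>B\<^esub>, Suc i := \<iota> b \<otimes>\<^bsub>S\<^esub> ss ! Suc i]"
    have "p a b = p a \<one>\<^bsub>B\<^esub> \<otimes>\<^bsub>S\<^esub> \<iota> b" using ab by (simp add: mult_incl p_closed right_B_pure)
    then have "pb (ss[i := p a b]) = pb ?ss"
      using pb_swap[OF ss i(2) p_closed[OF ab(1) B.one_closed] ab(2) next_slot] by (simp add: list_update_swap)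
    also have "\<dots> \<in> ?U"
    proof (rule step.IH)
      show "?ss \<in> tuples V (Suc m)"
        using ss ab next_slot by (intro tuples_update) (simp_all add: p_closed mult_closed incl_closed)
      show "\<forall>j<Suc i. \<exists>a\<in>carrier A. ?ss ! j = p a \<one>\<^bsub>B\<^esub>"
        using step.prems(2) ab len i by (auto simp: less_Suc_eq)
    qed
    finally show "pb (ss[i := p a b]) \<in> ?U" .
  qed
  from this[OF tuples_nth[OF ss i(1)]] show ?case by simp
qed

lemma spread_surj: "spread m ` carrier (Q (Suc m)) = carrier (BP (Suc m))"
proof
  show "spread m ` carrier (Q (Suc m)) \<subseteq> carrier (BP (Suc m))"
    using linear_maps_closed[OF spread_linear] by blast
  show "carrier (BP (Suc m)) \<subseteq> spread m ` carrier (Q (Suc m))"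
    by (rule PB.balanced_subset[OF submodule_image[OF module_Q module_BP spread_linear]])
      (simp add: tuples_PB pb_in_range_spread[of 0])
qed

text \<open>With the domain rewritten as the range of \<open>spread\<close>, the left inverse law of
  \<open>collapse\<close> also yields the other law, since spread(collapse(spread q)) = spread
  q.\<close>

lemma collapse_bij: "bij_betw (collapse (Suc m)) (carrier (BP (Suc m))) (carrier (Q (Suc m)))"
  unfolding spread_surj[symmetric]
  by (rule bij_betw_byWitness[where f' = "spread m"])
    (auto simp: collapse_spread)

lemma isomorphic_powers: "isomorphic_bimodules K S S (S_power K A B \<psi> (Suc m)) (A_power_B K A B \<psi> (Suc m))"
proof (rule isomorphic_bimodulesI[OF bimodule_S_power, where \<phi> = "collapse (Suc m)"])
  have space: "space (A_power_B K A B \<psi> (Suc m)) = Q (Suc m)" by (simp add: A_power_B_def Let_def)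
  show "module K (space (A_power_B K A B \<psi> (Suc m)))"
    and "collapse (Suc m) \<in> linear_maps K (space (S_power K A B \<psi> (Suc m))) (space (A_power_B K A B \<psi> (Suc m)))"
    and "bij_betw (collapse (Suc m)) (carrier (space (S_power K A B \<psi> (Suc m)))) (carrier (space (A_power_B K A B \<psi> (Suc m))))"
    by (simp_all add: space space_S_power module_Q collapse_linear collapse_bij)
qed (simp_all add: space_S_power carrier_S lact_S_power ract_S_power lact_eq ract_eq collapse_left collapse_right
      linear_maps_closed[OF collapse_linear])

lemma incl_hom: "\<iota> \<in> linear_maps K B S" "\<iota> \<one>\<^bsub>B\<^esub> = \<one>\<^bsub>S\<^esub>"
  by (simp add: linear_maps_S incl_linear, simp add: one_S incl_eq)

end


subsection \<open>The case without tensor factors\<close>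

lemma module_ground_module:
  assumes "cring K"
  shows "module K (ground_module K)"
proof -
  interpret K: cring K by fact
  have "abelian_group (ground_module K)"
    by (rule abelian_groupI) (auto simp: ground_module_def K.a_ac intro: K.l_neg)
  then show ?thesis
    by (intro moduleI assms) (simp_all add: ground_module_def K.l_distr K.r_distr K.m_assoc)
qed

text \<open>The unit isomorphism b \<mapsto> 1 \<otimes> b; its inverse \<open>?chi\<close> is
  scalar multiplication, and a scalar crosses the tensor sign by bilinearity.\<close>

lemma isomorphic_ground_tensor:
  assumes B: "assoc_algebra K B"
  shows "isomorphic_bimodules K B B (regular_bimodule B) (ground_tensor_B K B)"
proof -
  interpret B: module K B using B by (simp add: assoc_algebra_def)
  let ?k = "ground_module K"
  interpret G: tensor_product K ?k B
    by (intro tensor_product.intro module_ground_module B.R.is_cring B.module_axioms)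
  have multB: "bilinear K B B B (mult B)" by (rule assoc_algebra_mult_bilinear[OF B])
  note bil = G.pure_tensor_bilinear
  have k: "carrier ?k = carrier K" "c \<odot>\<^bsub>?k\<^esub> d = c \<otimes>\<^bsub>K\<^esub> d" "c \<oplus>\<^bsub>?k\<^esub> d = c \<oplus>\<^bsub>K\<^esub> d" for c d
    by (simp_all add: ground_module_def)
  let ?phi = "G.pure \<one>\<^bsub>K\<^esub>"
  have phi: "?phi \<in> linear_maps K B G.W" by (rule bilinear_right[OF bil]) (simp add: k)
  have smult: "bilinear K ?k B B (smult B)"
    by (intro bilinearI linear_mapsI)
      (simp_all add: k B.smult_l_distr B.smult_r_distr B.smult_assoc1 B.R.m_comm flip: B.smult_assoc1)
  let ?chi = "extend_linearly K B (\<lambda>(c, b). c \<odot>\<^bsub>B\<^esub> b)"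
  note chi = G.tensor_extend_linear[OF B.module_axioms smult]
  have chi_pure: "?chi (G.pure c b) = c \<odot>\<^bsub>B\<^esub> b" if "c \<in> carrier K" "b \<in> carrier B" for c b
    using that by (intro G.tensor_extend_pure[OF B.module_axioms smult]) (simp_all add: k)
  have phi_chi: "?phi (?chi t) = t" if "t \<in> carrier G.W" for t
  proof (rule G.tensor_eqI[OF G.module_tensor linear_maps_comp[OF chi phi] linear_maps_id _ that])
    fix c b assume cb: "c \<in> carrier ?k" "b \<in> carrier B"
    have "?phi (c \<odot>\<^bsub>B\<^esub> b) = c \<odot>\<^bsub>G.W\<^esub> ?phi b" using cb by (simp add: linear_maps_smult[OF phi] k)
    also have "\<dots> = G.pure (c \<odot>\<^bsub>?k\<^esub> \<one>\<^bsub>K\<^esub>) b"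
      using cb by (simp add: linear_maps_smult[OF bilinear_left[OF bil], symmetric] k(1))
    finally show "?phi (?chi (G.pure c b)) = G.pure c b" using cb by (simp add: chi_pure k)
  qed
  have aux_l: "bilinear K ?k B G.W (\<lambda>c b'. G.pure c (b \<otimes>\<^bsub>B\<^esub> b'))" if "b \<in> carrier B" for b
    by (rule bilinear_comp_right[OF bil bilinear_right[OF multB that]])
  have aux_r: "bilinear K ?k B G.W (\<lambda>c b'. G.pure c (b' \<otimes>\<^bsub>B\<^esub> b))" if "b \<in> carrier B" for b
    by (rule bilinear_comp_right[OF bil bilinear_left[OF multB that]])
  show ?thesis
  proof (rule isomorphic_bimodulesI[OF bimodule_regular[OF B], where \<phi> = ?phi])
    show "module K (space (ground_tensor_B K B))"
      by (simp add: ground_tensor_B_def Let_def G.module_tensor)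
    show "?phi \<in> linear_maps K (space (regular_bimodule B)) (space (ground_tensor_B K B))"
      using phi by (simp add: ground_tensor_B_def Let_def regular_bimodule_def)
    have "bij_betw ?phi (carrier B) (carrier G.W)"
      by (rule bij_betw_byWitness[where f' = ?chi])
        (auto simp: chi_pure phi_chi linear_maps_closed[OF phi] linear_maps_closed[OF chi])
    then show "bij_betw ?phi (carrier (space (regular_bimodule B))) (carrier (space (ground_tensor_B K B)))"
      by (simp add: ground_tensor_B_def Let_def regular_bimodule_def)
  qed (simp_all add: ground_tensor_B_def Let_def regular_bimodule_def k
      G.tensor_extend_pure[OF G.module_tensor aux_l] G.tensor_extend_pure[OF G.module_tensor aux_r])
qed

theorem theorem2p1:
  fixes K :: "'k ring" and A :: "('k, 'a) module" and B :: "('k, 'b) module"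
    and \<psi> :: "('b \<times> 'a \<Rightarrow> 'k) set \<Rightarrow> ('a \<times> 'b \<Rightarrow> 'k) set"
  assumes "field K" and "char_zero K"
    and "assoc_algebra K A" and "finite_dim K A"
    and "assoc_algebra K B" and "finite_dim K B"
    and "factorisation K A B \<psi>"
  shows "let S = factorisation_algebra K A B \<psi>;
             \<iota> = incl_B K A B;
             P = S_power K A B \<psi>;
             Q = A_power_B K A B \<psi>
         in (\<forall>n\<ge>1.
               isomorphic_bimodules K S S (P n) (Q n) \<and>
               isomorphic_bimodules K S B (restrict_right \<iota> (P n)) (restrict_right \<iota> (Q n)) \<and>
               isomorphic_bimodules K B S (restrict_left \<iota> (P n)) (restrict_left \<iota> (Q n)) \<and>
               isomorphic_bimodules K B B (restrict_left \<iota> (restrict_right \<iota> (P n)))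
                                          (restrict_left \<iota> (restrict_right \<iota> (Q n)))) \<and>
            isomorphic_bimodules K B B (regular_bimodule B) (ground_tensor_B K B)"
proof -
  interpret factorisation_setup K A B \<psi>
    using assms by (intro factorisation_setup.intro)
  \<comment> \<open>The inclusion of B is a unital algebra homomorphism, so the S-S isomorphism
    restricts on either side; restricting on both gives the B-B case.\<close>
  note left = isomorphic_restrict_left[OF _ algebra_B incl_hom incl_mult]
  note right = isomorphic_restrict_right[OF _ algebra_B incl_hom incl_mult]
  have "isomorphic_bimodules K S S (S_power K A B \<psi> n) (A_power_B K A B \<psi> n)" if "n \<ge> 1" for n
    \<comment> \<open>The positive powers were treated as \<open>Suc m\<close>, so that first and
      last factors exist.\<close>
    using isomorphic_powers[of "n - 1"] that by simp
  then show ?thesis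
    using isomorphic_ground_tensor[OF algebra_B] by (simp add: left right)
qed

end
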